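(* Let $X$ be a $K$-convex Banach space and let $-A$ be the generator of a $C_0$-semigroup on $X$. If $\omega^{\gamma}(A)>-\infty$, then $$\omega^{\gamma}(A)=\omega(A)=s_0^{\gamma}(A).$$
   Context: All Banach spaces are complex. $R(z,A)=(zI-A)^{-1}$ for $z\in\rho(A)$, and $R_\alpha=\{z\in\mathbb{C}:\mathrm{Re}(z)>\alpha\}$. $(\gamma_n)_{n\geq1}$ is a sequence of independent complex standard Gaussian variables on a probability space $\Sigma$; $G(X)$ is the closure of $\{\sum_{k=1}^n\gamma_k\otimes x_k: x_k\in X,\ n\in\mathbb{N}\}$ in $L^2(\Sigma,X)$, with the induced norm. A set $\mathcal{T}\subset\mathcal{L}(X)$ is $\gamma$-bounded if there is $C\geq0$ such that $\|\sum_{n=1}^N\gamma_n\otimes T_nx_n\|_{G(X)}\leq C\|\sum_{n=1}^N\gamma_n\otimes x_n\|_{G(X)}$ for all finite sequences $(T_n)\subset\mathcal{T}$, $(x_n)\subset X$. $X$ is $K$-convex iff (equivalently to having non-trivial type) there is $K>0$ such that for all $x_1,\ldots,x_N\in X$, $\|\sum_n\gamma_n\otimes x_n\|_{G(X)}\leq K\sup\{|\sum_n\langle x_n,y_n\rangle|: y_n\in X^*,\ \|\sum_n\gamma_n\otimes y_n\|_{G(X^* )}\leq1\}$. If $-A$ generates the $C_0$-semigroup $(T_t)_{t\geq0}$ on $X$, define $\omega(A):=\sup\{\omega\in\mathbb{R}:\ \exists M_\omega>0\text{ such that }\|T_t\|\leq M_\omega e^{-\omega t}\text{ for all }t\geq0\}$;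 $\omega^\gamma(A):=\sup\{\omega\in\mathbb{R}:\ \{e^{\omega t}T_t:t\geq0\}\text{ is }\gamma\text{-bounded}\}$, with $\omega^\gamma(A)=-\infty$ if no such $\omega$ exists; $s_0^\gamma(A):=\sup\{\alpha\in\mathbb{R}:\ \sigma(A)\subset R_\alpha\text{ and }\{R(z,A):\mathrm{Re}(z)\leq\alpha\}\text{ is }\gamma\text{-bounded}\}$, with $s_0^\gamma(A)=-\infty$ if no such $\alpha$ exists. *)

theory Defs
  imports "HOL-Probability.Probability"
begin

section \<open>Complex Banach spaces\<close>

class complex_banach = banach +
  fixes scaleC :: "complex \<Rightarrow> 'a \<Rightarrow> 'a"  (infixr "*\<^sub>C" 75)
  assumes scaleC_add_right: "c *\<^sub>C (x + y) = c *\<^sub>C x + c *\<^sub>C y"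
    and scaleC_add_left: "(c + d) *\<^sub>C x = c *\<^sub>C x + d *\<^sub>C x"
    and scaleC_scaleC: "c *\<^sub>C (d *\<^sub>C x) = (c * d) *\<^sub>C x"
    and scaleC_of_real: "complex_of_real r *\<^sub>C x = r *\<^sub>R x"
    and norm_scaleC: "norm (c *\<^sub>C x) = cmod c * norm x"

instantiation complex :: complex_banach
begin

definition scaleC_complex :: "complex \<Rightarrow> complex \<Rightarrow> complex"
  where "scaleC_complex c z = c * z"

instance
  by standard (simp_all add: scaleC_complex_def algebra_simps norm_mult scaleR_conv_of_real)

end

lemma bounded_linear_scaleC: "bounded_linear (\<lambda>x :: 'a :: complex_banach. c *\<^sub>C x)"
proof (rule bounded_linear_intro[where K = "cmod c"])
  fix r and x :: 'a
  show "c *\<^sub>C (r *\<^sub>R x) = r *\<^sub>R (c *\<^sub>C x)"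
    by (simp add: scaleC_of_real[symmetric] scaleC_scaleC mult.commute)
qed (simp_all add: scaleC_add_right norm_scaleC mult.commute)

text \<open>The real-linear bounded maps from a real normed space into a complex Banach space form a
  complex Banach space under pointwise scaling and the operator norm.\<close>

instantiation blinfun :: (real_normed_vector, complex_banach) complex_banach
begin

definition scaleC_blinfun :: "complex \<Rightarrow> 'a \<Rightarrow>\<^sub>L 'b \<Rightarrow> 'a \<Rightarrow>\<^sub>L 'b"
  where "scaleC_blinfun c f = Blinfun (\<lambda>x. c *\<^sub>C blinfun_apply f x)"

lemma blinfun_apply_scaleC: "blinfun_apply (c *\<^sub>C f) x = c *\<^sub>C blinfun_apply f x"
  unfolding scaleC_blinfun_def
  by (subst bounded_linear_Blinfun_apply)
    (auto intro: bounded_linear_compose[OF bounded_linear_scaleC] blinfun.bounded_linear_right)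

instance
proof
  fix c d :: complex and r :: real and f g :: "'a \<Rightarrow>\<^sub>L 'b"
  show "c *\<^sub>C (f + g) = c *\<^sub>C f + c *\<^sub>C g"
    by (rule blinfun_eqI) (simp add: blinfun_apply_scaleC blinfun.add_left scaleC_add_right)
  show "(c + d) *\<^sub>C f = c *\<^sub>C f + d *\<^sub>C f"
    by (rule blinfun_eqI) (simp add: blinfun_apply_scaleC blinfun.add_left scaleC_add_left)
  show "c *\<^sub>C (d *\<^sub>C f) = (c * d) *\<^sub>C f"
    by (rule blinfun_eqI) (simp add: blinfun_apply_scaleC scaleC_scaleC)
  show "complex_of_real r *\<^sub>C f = r *\<^sub>R f"
    by (rule blinfun_eqI) (simp add: blinfun_apply_scaleC blinfun.scaleR_left scaleC_of_real)
  have "norm (c *\<^sub>C f) = (SUP x. cmod c * (norm (blinfun_apply f x) / norm x))"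
    by (simp add: norm_blinfun.rep_eq onorm_def blinfun_apply_scaleC norm_scaleC)
  also have "\<dots> = onorm (\<lambda>x. cmod c *\<^sub>R blinfun_apply f x)"
    by (simp add: onorm_def)
  also have "\<dots> = cmod c * norm f"
    by (simp add: onorm_scaleR[OF blinfun.bounded_linear_right] norm_blinfun.rep_eq)
  finally show "norm (c *\<^sub>C f) = cmod c * norm f" .
qed

end

text \<open>Elements of \<open>'a \<Rightarrow>\<^sub>L 'b\<close> are only real-linear; the space \<open>\<L>(X, Y)\<close> of bounded
  complex-linear operators, and in particular the dual \<open>X\<^sup>* = \<L>(X, \<complex>)\<close>, is this subspace.\<close>

definition complex_ops :: "('a :: complex_banach \<Rightarrow>\<^sub>L 'b :: complex_banach) set"
  where "complex_ops =
    {T. \<forall>c x. blinfun_apply T (c *\<^sub>C x) = c *\<^sub>C blinfun_apply T x}"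


section \<open>Gaussian sums\<close>

text \<open>A complex standard Gaussian is \<open>(g + i h) / \<surd>2\<close> with \<open>g, h\<close> independent real standard
  Gaussians, so that its second absolute moment is 1. Sequences are indexed from 0.\<close>

definition complex_gaussian_sequence :: "'w measure \<Rightarrow> (nat \<Rightarrow> 'w \<Rightarrow> complex) \<Rightarrow> bool"
  where "complex_gaussian_sequence M \<gamma> \<longleftrightarrow>
    prob_space M \<and>
    prob_space.indep_vars M (\<lambda>_. borel) \<gamma> UNIV \<and>
    (\<forall>n. prob_space.indep_var M borel (\<lambda>w. Re (\<gamma> n w)) borel (\<lambda>w. Im (\<gamma> n w)) \<and>
         distributed M lborel (\<lambda>w. Re (\<gamma> n w)) (\<lambda>x. ennreal (normal_density 0 (1 / sqrt 2) x)) \<and>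
         distributed M lborel (\<lambda>w. Im (\<gamma> n w)) (\<lambda>x. ennreal (normal_density 0 (1 / sqrt 2) x)))"

text \<open>\<open>\<parallel>\<Sum>n<N. \<gamma>\<^sub>n \<otimes> x\<^sub>n\<parallel>\<close> in \<open>G(X)\<close>, i.e. in \<open>L\<^sup>2(\<Sigma>, X)\<close>; only finite sums are ever measured.\<close>

definition gauss_norm ::
  "'w measure \<Rightarrow> (nat \<Rightarrow> 'w \<Rightarrow> complex) \<Rightarrow> nat \<Rightarrow> (nat \<Rightarrow> 'a :: complex_banach) \<Rightarrow> real"
  where "gauss_norm M \<gamma> N x = sqrt (\<integral>w. (norm (\<Sum>n<N. \<gamma> n w *\<^sub>C x n))\<^sup>2 \<partial>M)"

definition gamma_bounded ::
  "'w measure \<Rightarrow> (nat \<Rightarrow> 'w \<Rightarrow> complex) \<Rightarrow> ('a :: complex_banach \<Rightarrow>\<^sub>L 'a) set \<Rightarrow> bool"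
  where "gamma_bounded M \<gamma> \<T> \<longleftrightarrow>
    (\<exists>C\<ge>0. \<forall>N T x. (\<forall>n<N. T n \<in> \<T>) \<longrightarrow>
      gauss_norm M \<gamma> N (\<lambda>n. blinfun_apply (T n) (x n)) \<le> C * gauss_norm M \<gamma> N x)"

definition K_convex ::
  "'w measure \<Rightarrow> (nat \<Rightarrow> 'w \<Rightarrow> complex) \<Rightarrow> 'a :: complex_banach itself \<Rightarrow> bool"
  where "K_convex M \<gamma> _ \<longleftrightarrow>
    (\<exists>K>0. \<forall>N (x :: nat \<Rightarrow> 'a).
      ereal (gauss_norm M \<gamma> N x) \<le> ereal K *
        (SUP y \<in> {y :: nat \<Rightarrow> 'a \<Rightarrow>\<^sub>L complex.
                   (\<forall>n<N. y n \<in> complex_ops) \<and> gauss_norm M \<gamma> N y \<le> 1}.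
           ereal (cmod (\<Sum>n<N. blinfun_apply (y n) (x n)))))"


section \<open>Unbounded operators and semigroups\<close>

text \<open>An unbounded operator on \<open>X\<close> is a partial function \<open>A\<close> with domain \<open>dom A\<close>. The
  next predicate says that \<open>R \<in> \<L>(X)\<close> is a two-sided inverse of \<open>zI - A : dom A \<rightarrow> X\<close>.\<close>

definition is_resolvent ::
  "('a :: complex_banach \<rightharpoonup> 'a) \<Rightarrow> complex \<Rightarrow> ('a \<Rightarrow>\<^sub>L 'a) \<Rightarrow> bool"
  where "is_resolvent A z R \<longleftrightarrow> R \<in> complex_ops \<and>
    (\<forall>x. \<exists>y. A (blinfun_apply R x) = Some y \<and> z *\<^sub>C blinfun_apply R x - y = x) \<and>
    (\<forall>x y. A x = Some y \<longrightarrow> blinfun_apply R (z *\<^sub>C x - y) = x)"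

definition resolvent_set :: "('a :: complex_banach \<rightharpoonup> 'a) \<Rightarrow> complex set"
  where "resolvent_set A = {z. \<exists>R. is_resolvent A z R}"

definition spectrum :: "('a :: complex_banach \<rightharpoonup> 'a) \<Rightarrow> complex set"
  where "spectrum A = - resolvent_set A"

definition resolvent :: "complex \<Rightarrow> ('a :: complex_banach \<rightharpoonup> 'a) \<Rightarrow> 'a \<Rightarrow>\<^sub>L 'a"
  where "resolvent z A = (THE R. is_resolvent A z R)"

text \<open>Semigroups are families indexed by all reals whose values at negative times are irrelevant.\<close>

definition C0_semigroup :: "(real \<Rightarrow> 'a :: complex_banach \<Rightarrow>\<^sub>L 'a) \<Rightarrow> bool"
  where "C0_semigroup T \<longleftrightarrow>
    (\<forall>t\<ge>0. T t \<in> complex_ops) \<and>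
    T 0 = id_blinfun \<and>
    (\<forall>s\<ge>0. \<forall>t\<ge>0. T (s + t) = T s o\<^sub>L T t) \<and>
    (\<forall>x. ((\<lambda>t. blinfun_apply (T t) x) \<longlongrightarrow> x) (at_right 0))"

text \<open>\<open>-A\<close> is the generator of \<open>T\<close>: the difference quotient at \<open>x\<close> converges iff \<open>x \<in> dom A\<close>, and
  then its limit is \<open>-A x\<close>.\<close>

definition neg_generates ::
  "('a :: complex_banach \<rightharpoonup> 'a) \<Rightarrow> (real \<Rightarrow> 'a \<Rightarrow>\<^sub>L 'a) \<Rightarrow> bool"
  where "neg_generates A T \<longleftrightarrow> C0_semigroup T \<and>
    (\<forall>x y. A x = Some y \<longleftrightarrow>
      ((\<lambda>t. (blinfun_apply (T t) x - x) /\<^sub>R t) \<longlongrightarrow> - y) (at_right 0))"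


section \<open>Growth bounds and abscissae\<close>

text \<open>The suprema are taken in the extended reals, where the supremum of the empty set is
  \<open>-\<infinity>\<close>. The bounds \<open>\<omega>(A)\<close> and \<open>\<omega>\<^sup>\<gamma>(A)\<close> are functions of the semigroup generated by \<open>-A\<close>.\<close>

definition omega :: "(real \<Rightarrow> 'a :: complex_banach \<Rightarrow>\<^sub>L 'a) \<Rightarrow> ereal"
  where "omega T = (SUP \<omega> \<in> {\<omega>. \<exists>K>0. \<forall>t\<ge>0. norm (T t) \<le> K * exp (- \<omega> * t)}. ereal \<omega>)"

definition omega_gamma ::
  "'w measure \<Rightarrow> (nat \<Rightarrow> 'w \<Rightarrow> complex) \<Rightarrow> (real \<Rightarrow> 'a :: complex_banach \<Rightarrow>\<^sub>L 'a) \<Rightarrow> ereal"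
  where "omega_gamma M \<gamma> T =
    (SUP \<omega> \<in> {\<omega>. gamma_bounded M \<gamma> {exp (\<omega> * t) *\<^sub>R T t | t. t \<ge> 0}}. ereal \<omega>)"

definition s0_gamma ::
  "'w measure \<Rightarrow> (nat \<Rightarrow> 'w \<Rightarrow> complex) \<Rightarrow> ('a :: complex_banach \<rightharpoonup> 'a) \<Rightarrow> ereal"
  where "s0_gamma M \<gamma> A =
    (SUP \<alpha> \<in> {\<alpha>. spectrum A \<subseteq> {z. Re z > \<alpha>} \<and>
               gamma_bounded M \<gamma> {resolvent z A | z. Re z \<le> \<alpha>}}. ereal \<alpha>)"

end

theory Submission
  imports Defs
begin

text \<open>The hypothesis \<open>\<omega>\<^sup>\<gamma>(A) > -\<infinity>\<close> makes \<open>{T\<^sub>t : 0 \<le> t \<le> 1}\<close> \<open>\<gamma>\<close>-bounded. The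
theorem splits into four inequalities between the three abscissae, and this local bound enters the last
three.

\<open>\<omega>\<^sup>\<gamma> \<le> \<omega>\<close>: a \<open>\<gamma>\<close>-bound dominates every single operator norm.

\<open>\<omega> \<le> \<omega>\<^sup>\<gamma>\<close>: write \<open>t = n + s\<close> with \<open>n\<close> the integer part of \<open>t\<close>. For \<open>\<omega>' < \<omega>\<close> the operators
\<open>e\<^bsup>\<omega>'n\<^esup> T\<^sub>n\<close> have summable norms, and grouping the terms of a Gaussian sum by their value of \<open>n\<close> turns
summable norms into a \<open>\<gamma>\<close>-bound; the factor \<open>T\<^sub>s\<close> is covered by the local bound.

\<open>\<omega> \<le> s\<^sub>0\<^sup>\<gamma>\<close>: let \<open>P\<^sub>z\<close> be the integral of \<open>e\<^bsup>zt\<^esup> T\<^sub>t\<close> over \<open>[0, 1]\<close>. Then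
\<open>(z - A) P\<^sub>z = e\<^sup>z T\<^sub>1 - I\<close>, so that \<open>R(z, A) = - P\<^sub>z \<Sum>\<^sub>n e\<^bsup>zn\<^esup> T\<^sub>n\<close> to the left of \<open>\<omega>\<close>. The \<open>P\<^sub>z\<close> are limits of
means of local operators and the series has summable norms, so both factors are \<open>\<gamma>\<close>-bounded.

\<open>s\<^sub>0\<^sup>\<gamma> \<le> \<omega>\<close>: this is a Gearhart-Pruess argument in which Gaussian norms replace the Hilbert space norm.
What replaces Plancherel's theorem is that Gaussian sums are invariant under unitary matrices, here
under the discrete Fourier transform of size \<open>2\<^sup>m\<close> (\<open>gn_dft\<close>). Put \<open>z\<^sub>k = z + 2\<pi>ik\<close>. The identity
\<open>P\<^bsub>z\<^sub>k\<^esub> x = R(z\<^sub>k, A) (e\<^sup>z T\<^sub>1 x - x)\<close> says that the Fourier coefficients of the orbit \<open>e\<^bsup>zt\<^esup> T\<^sub>t x\<close> on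
\<open>[0, 1]\<close> are values of the resolvent at \<open>e\<^sup>z T\<^sub>1 x - x\<close>. Far to the left of the spectrum the local bound
and the unitary invariance control \<open>(R(z\<^sub>k, A) u)\<^sub>k\<close> by \<open>\<parallel>u\<parallel>\<close> (\<open>resolvent_analysis_far_left\<close>); the
resolvent identity and the \<open>\<gamma>\<close>-bound of the resolvents carry this estimate to every line \<open>Re z \<le> \<alpha>\<close>
(\<open>resolvent_analysis\<close>). Fejer summation, again with the unitary invariance and the local bound,
recovers \<open>e\<^sup>z T\<^sub>1 x\<close> from the coefficients, and so
\<open>\<parallel>e\<^sup>z T\<^sub>1 x\<parallel> \<le> B \<parallel>e\<^sup>z T\<^sub>1 x - x\<parallel>\<close> for \<open>Re z \<le> \<alpha>\<close> (\<open>orbit_bounded_below\<close>). Hence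
\<open>I - \<mu> e\<^sup>\<alpha> T\<^sub>1\<close> is bounded below uniformly in \<open>|\<mu>| \<le> 1\<close>, and an elementary spectral radius argument
gives an \<open>m\<close> with \<open>e\<^bsup>\<alpha>m\<^esup> \<parallel>T\<^sub>m\<parallel> \<le> 1/2\<close> (\<open>eventual_contraction\<close>).\<close>

section \<open>Rotation invariance of Gaussian measures\<close>

text \<open>The variance is 1/2, that of the real and imaginary parts of a complex standard Gaussian.\<close>

definition half_normal :: "real measure"
  where "half_normal = density lborel (\<lambda>x. ennreal (normal_density 0 (1 / sqrt 2) x))"

lemma prob_space_half_normal: "prob_space half_normal"
  unfolding half_normal_def by (rule prob_space_normal_density) simp

lemma sets_half_normal[simp, measurable_cong]: "sets half_normal = sets borel"
  by (simp add: half_normal_def)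

lemma space_half_normal[simp]: "space half_normal = UNIV"
  by (simp add: half_normal_def)

lemma half_normal_density_rotation:
  fixes a b x y :: real
  assumes "a\<^sup>2 + b\<^sup>2 = 1"
  shows "normal_density 0 (1 / sqrt 2) x * normal_density 0 (1 / sqrt 2) y =
    normal_density 0 (1 / sqrt 2) (a * x - b * y) * normal_density 0 (1 / sqrt 2) (b * x + a * y)"
proof -
  have "(a * x - b * y)\<^sup>2 + (b * x + a * y)\<^sup>2 = (a\<^sup>2 + b\<^sup>2) * (x\<^sup>2 + y\<^sup>2)"
    by (simp add: power2_eq_square algebra_simps)
  then have "exp (- (a * x - b * y)\<^sup>2) * exp (- (b * x + a * y)\<^sup>2) = exp (- x\<^sup>2) * exp (- y\<^sup>2)"
    using assms by (simp add: exp_add[symmetric])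
  then show ?thesis
    by (simp add: normal_density_def power_divide)
qed

text \<open>Rotations with \<open>a \<noteq> 0\<close> are two successive one-dimensional affine substitutions, so that Fubini's
theorem suffices. The remaining rotations are squares of these.\<close>

lemma half_normal_rotation:
  fixes F :: "real \<times> real \<Rightarrow> ennreal"
  assumes ab: "a\<^sup>2 + b\<^sup>2 = 1" and a: "a \<noteq> 0" and [measurable]: "F \<in> borel_measurable borel"
  shows "(\<integral>\<^sup>+x. \<integral>\<^sup>+y. F (a * x - b * y, b * x + a * y) \<partial>half_normal \<partial>half_normal) =
    (\<integral>\<^sup>+x. \<integral>\<^sup>+y. F (x, y) \<partial>half_normal \<partial>half_normal)"
proof -
  define d where "d = (\<lambda>x. ennreal (normal_density 0 (1 / sqrt 2) x))"
  have [measurable]: "d \<in> borel_measurable borel" unfolding d_def by measurable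
  define H where "H = (\<lambda>p. d (fst p) * d (snd p) * F p)"
  have [measurable]: "F \<in> borel_measurable (borel \<Otimes>\<^sub>M borel)" by (simp add: borel_prod)
  have [measurable]: "H \<in> borel_measurable (borel \<Otimes>\<^sub>M borel)" unfolding H_def by measurable
  have expand: "(\<integral>\<^sup>+x. \<integral>\<^sup>+y. G x y \<partial>half_normal \<partial>half_normal)
      = (\<integral>\<^sup>+x. \<integral>\<^sup>+y. d x * d y * G x y \<partial>lborel \<partial>lborel)"
    if [measurable]: "case_prod G \<in> borel_measurable (borel \<Otimes>\<^sub>M borel)" for G
    unfolding half_normal_def d_def
    by (subst nn_integral_density; (subst nn_integral_density)?;
       (simp add: nn_integral_cmult[symmetric] mult.assoc)?; measurable)
  have dd: "d x * d y = d (a * x - b * y) * d (b * x + a * y)" for x y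
    unfolding d_def using half_normal_density_rotation[OF ab, of x y]
    by (simp add: ennreal_mult'[symmetric])
  have "ennreal \<bar>a\<bar> * (\<integral>\<^sup>+x. \<integral>\<^sup>+y. F (a * x - b * y, b * x + a * y) \<partial>half_normal \<partial>half_normal)
    = \<bar>a\<bar> * (\<integral>\<^sup>+x. \<integral>\<^sup>+y. H (a * x - b * y, b * x + a * y) \<partial>lborel \<partial>lborel)"
    by (subst expand) (auto simp: H_def dd[symmetric])
  also have "\<dots> = \<bar>a\<bar> * (\<integral>\<^sup>+y. \<integral>\<^sup>+x. H (a * x - b * y, b * x + a * y) \<partial>lborel \<partial>lborel)"
    by (subst lborel_pair.Fubini') auto
  also have "\<dots> = (\<integral>\<^sup>+y. (\<bar>a\<bar> * (\<integral>\<^sup>+x. H (a * x - b * y, b * x + a * y) \<partial>lborel)) \<partial>lborel)"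
    by (subst nn_integral_cmult) auto
  \<comment> \<open>for fixed \<open>y\<close> substitute \<open>u = a x - b y\<close>; then \<open>b x + a y = (b u + y) / a\<close>, because \<open>a\<^sup>2 + b\<^sup>2 = 1\<close>\<close>
  also have "\<dots> = (\<integral>\<^sup>+y. \<integral>\<^sup>+x. H (x, (b * x + y) / a) \<partial>lborel \<partial>lborel)"
  proof (intro nn_integral_cong)
    fix y :: real
    have e: "(b * (a * x - b * y) + y) / a = b * x + a * y" for x
    proof -
      have "b * (a * x - b * y) + y = a * b * x + (1 - b\<^sup>2) * y"
        by (simp add: power2_eq_square algebra_simps)
      also have "\<dots> = a * (b * x + a * y)"
        using ab by (simp add: power2_eq_square algebra_simps flip: ab)
      finally show ?thesis using a by simp
    qed
    show "\<bar>a\<bar> * (\<integral>\<^sup>+x. H (a * x - b * y, b * x + a * y) \<partial>lborel) = (\<integral>\<^sup>+x. H (x, (b * x + y) / a) \<partial>lborel)"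
      using nn_integral_real_affine[of "\<lambda>x. H (x, (b * x + y) / a)" a "- (b * y)"] a by (simp add: e)
  qed
  also have "\<dots> = (\<integral>\<^sup>+x. \<integral>\<^sup>+y. H (x, (b * x + y) / a) \<partial>lborel \<partial>lborel)"
    by (subst lborel_pair.Fubini') auto
  \<comment> \<open>now \<open>u\<close> is fixed and the second coordinate is affine in \<open>y\<close> with slope \<open>1 / a\<close>\<close>
  also have "\<dots> = (\<integral>\<^sup>+x. (\<bar>a\<bar> * (\<integral>\<^sup>+y. H (x, y) \<partial>lborel)) \<partial>lborel)"
  proof (intro nn_integral_cong)
    fix x :: real
    have "(\<integral>\<^sup>+y. H (x, y) \<partial>lborel) = \<bar>1/a\<bar> * (\<integral>\<^sup>+y. H (x, b * x / a + 1 / a * y) \<partial>lborel)"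
      by (rule nn_integral_real_affine) (use a in auto)
    moreover have "b * x / a + 1 / a * y = (b * x + y) / a" for y by (simp add: add_divide_distrib)
    moreover have "ennreal \<bar>a\<bar> * ennreal \<bar>1/a\<bar> = 1" using a by (simp flip: ennreal_mult)
    ultimately show "(\<integral>\<^sup>+y. H (x, (b * x + y) / a) \<partial>lborel) = \<bar>a\<bar> * (\<integral>\<^sup>+y. H (x, y) \<partial>lborel)"
      by (simp add: mult.assoc[symmetric])
  qed
  also have "\<dots> = \<bar>a\<bar> * (\<integral>\<^sup>+x. \<integral>\<^sup>+y. H (x, y) \<partial>lborel \<partial>lborel)"
    by (subst nn_integral_cmult) auto
  also have "\<dots> = \<bar>a\<bar> * (\<integral>\<^sup>+x. \<integral>\<^sup>+y. F (x, y) \<partial>half_normal \<partial>half_normal)"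
    by (subst expand) (auto simp: H_def)
  finally show ?thesis
    using a by (auto simp: ennreal_mult_cancel_left)
qed

definition std_gaussian :: "complex measure"
  where "std_gaussian = distr (half_normal \<Otimes>\<^sub>M half_normal) borel (\<lambda>p. Complex (fst p) (snd p))"

lemma measurable_Complex[measurable]: "(\<lambda>p. Complex (fst p) (snd p)) \<in> borel_measurable (borel \<Otimes>\<^sub>M borel)"
proof -
  have "(\<lambda>p. complex_of_real (fst p) + \<i> * complex_of_real (snd p)) \<in> borel_measurable (borel \<Otimes>\<^sub>M borel)"
    by measurable
  then show ?thesis by (simp add: Complex_eq)
qed

lemma sets_std_gaussian[simp, measurable_cong]: "sets std_gaussian = sets borel"
  by (simp add: std_gaussian_def)

lemma space_std_gaussian[simp]: "space std_gaussian = UNIV"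
  by (simp add: std_gaussian_def)

interpretation half_normal: prob_space half_normal
  by (rule prob_space_half_normal)

interpretation half_normal_pair: pair_prob_space half_normal half_normal
  by unfold_locales

interpretation std_gaussian: prob_space std_gaussian
  unfolding std_gaussian_def
  by (rule half_normal_pair.prob_space_distr) measurable

interpretation std_gaussian_family: product_sigma_finite "\<lambda>_. std_gaussian"
  by unfold_locales

lemma nn_integral_std_gaussian:
  assumes [measurable]: "F \<in> borel_measurable borel"
  shows "(\<integral>\<^sup>+z. F z \<partial>std_gaussian) = (\<integral>\<^sup>+x. \<integral>\<^sup>+y. F (Complex x y) \<partial>half_normal \<partial>half_normal)"
proof -
  have "(\<integral>\<^sup>+z. F z \<partial>std_gaussian) = (\<integral>\<^sup>+p. F (Complex (fst p) (snd p)) \<partial>(half_normal \<Otimes>\<^sub>M half_normal))"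
    unfolding std_gaussian_def by (subst nn_integral_distr) auto
  also have "\<dots> = (\<integral>\<^sup>+x. \<integral>\<^sup>+y. F (Complex x y) \<partial>half_normal \<partial>half_normal)"
    by (subst half_normal.nn_integral_fst[symmetric]) auto
  finally show ?thesis .
qed

lemma std_gaussian_phase:
  assumes u: "cmod u = 1" and F: "F \<in> borel_measurable borel"
  shows "(\<integral>\<^sup>+z. F (u * z) \<partial>std_gaussian) = (\<integral>\<^sup>+z. F z \<partial>std_gaussian)"
proof -
  have base: "(\<integral>\<^sup>+z. F (v * z) \<partial>std_gaussian) = (\<integral>\<^sup>+z. F z \<partial>std_gaussian)"
    if v: "cmod v = 1" "Re v \<noteq> 0" and [measurable]: "F \<in> borel_measurable borel" for v F
  proof -
    have [measurable]: "(\<lambda>p. F (Complex (fst p) (snd p))) \<in> borel_measurable borel"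
      by (simp add: borel_prod[symmetric])
    have "(\<integral>\<^sup>+z. F (v * z) \<partial>std_gaussian) = (\<integral>\<^sup>+x. \<integral>\<^sup>+y. F (v * Complex x y) \<partial>half_normal \<partial>half_normal)"
      by (subst nn_integral_std_gaussian) auto
    also have "\<dots> = (\<integral>\<^sup>+x. \<integral>\<^sup>+y. (\<lambda>p. F (Complex (fst p) (snd p)))
        (Re v * x - Im v * y, Im v * x + Re v * y) \<partial>half_normal \<partial>half_normal)"
      by (intro nn_integral_cong arg_cong[where f = F]) (simp add: complex_eq_iff algebra_simps)
    also have "\<dots> = (\<integral>\<^sup>+x. \<integral>\<^sup>+y. (\<lambda>p. F (Complex (fst p) (snd p))) (x, y) \<partial>half_normal \<partial>half_normal)"
      by (rule half_normal_rotation) (use v in \<open>auto simp: cmod_def real_sqrt_eq_1_iff\<close>)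
    also have "\<dots> = (\<integral>\<^sup>+z. F z \<partial>std_gaussian)"
      by (subst nn_integral_std_gaussian) auto
    finally show ?thesis .
  qed
  \<comment> \<open>a purely imaginary phase is the square of a phase with nonzero real part\<close>
  define v where "v = csqrt u"
  have uv: "u = v * v" by (simp add: v_def flip: power2_eq_square)
  show ?thesis
  proof (cases "Re u = 0")
    case False then show ?thesis using base u F by blast
  next
    case True
    then have "Re v \<noteq> 0" using u
      by (auto simp: v_def cmod_def real_sqrt_eq_1_iff)
    moreover have "cmod v = 1" using u
      by (metis norm_csqrt real_sqrt_one v_def)
    ultimately have "(\<integral>\<^sup>+z. F (v * (v * z)) \<partial>std_gaussian) = (\<integral>\<^sup>+z. F z \<partial>std_gaussian)"
      using base[of v F] base[of v "\<lambda>z. F (v * z)"] F by simp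
    then show ?thesis by (simp add: uv mult.assoc)
  qed
qed

text \<open>A rotation with real coefficients of a pair of complex Gaussians acts separately on the pair of real
parts and on the pair of imaginary parts.\<close>

lemma std_gaussian_pair_rotation:
  fixes a b :: real
  assumes ab: "a\<^sup>2 + b\<^sup>2 = 1" and a: "a \<noteq> 0"
    and [measurable]: "F \<in> borel_measurable (borel \<Otimes>\<^sub>M borel)"
  shows "(\<integral>\<^sup>+z. \<integral>\<^sup>+w. F (of_real a * z - of_real b * w, of_real b * z + of_real a * w) \<partial>std_gaussian \<partial>std_gaussian)
    = (\<integral>\<^sup>+z. \<integral>\<^sup>+w. F (z, w) \<partial>std_gaussian \<partial>std_gaussian)"
proof -
  have [measurable]: "(\<lambda>p. Complex (f p) (g p)) \<in> borel_measurable N"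
    if [measurable]: "f \<in> borel_measurable N" "g \<in> borel_measurable N" for f g and N :: "'z measure"
    using measurable_compose[OF measurable_Pair[OF that] measurable_Complex] by simp
  have expand: "(\<integral>\<^sup>+z. \<integral>\<^sup>+w. G z w \<partial>std_gaussian \<partial>std_gaussian)
     = (\<integral>\<^sup>+x. \<integral>\<^sup>+x'. \<integral>\<^sup>+y. \<integral>\<^sup>+y'. G (Complex x y) (Complex x' y')
         \<partial>half_normal \<partial>half_normal \<partial>half_normal \<partial>half_normal)"
    if [measurable]: "case_prod G \<in> borel_measurable (borel \<Otimes>\<^sub>M borel)" for G
  proof -
    have "(\<integral>\<^sup>+z. \<integral>\<^sup>+w. G z w \<partial>std_gaussian \<partial>std_gaussian)
      = (\<integral>\<^sup>+x. \<integral>\<^sup>+y. \<integral>\<^sup>+w. G (Complex x y) w \<partial>std_gaussian \<partial>half_normal \<partial>half_normal)"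
      by (subst nn_integral_std_gaussian) measurable
    also have "\<dots> = (\<integral>\<^sup>+x. \<integral>\<^sup>+y. \<integral>\<^sup>+x'. \<integral>\<^sup>+y'. G (Complex x y) (Complex x' y')
         \<partial>half_normal \<partial>half_normal \<partial>half_normal \<partial>half_normal)"
      by (subst nn_integral_std_gaussian) measurable
    also have "\<dots> = (\<integral>\<^sup>+x. \<integral>\<^sup>+x'. \<integral>\<^sup>+y. \<integral>\<^sup>+y'. G (Complex x y) (Complex x' y')
         \<partial>half_normal \<partial>half_normal \<partial>half_normal \<partial>half_normal)"
      by (subst half_normal_pair.Fubini') measurable
    finally show ?thesis .
  qed
  define \<Psi> where "\<Psi> = (\<lambda>p. \<integral>\<^sup>+y. \<integral>\<^sup>+y'. F (Complex (fst p) y, Complex (snd p) y') \<partial>half_normal \<partial>half_normal)"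
  have \<Psi>_meas: "\<Psi> \<in> borel_measurable borel"
    unfolding \<Psi>_def borel_prod[symmetric] by measurable
  have inner: "(\<integral>\<^sup>+y. \<integral>\<^sup>+y'. (\<lambda>p. F (Complex r (fst p), Complex s (snd p)))
      (a * y - b * y', b * y + a * y') \<partial>half_normal \<partial>half_normal)
    = (\<integral>\<^sup>+y. \<integral>\<^sup>+y'. (\<lambda>p. F (Complex r (fst p), Complex s (snd p))) (y, y') \<partial>half_normal \<partial>half_normal)" for r s
    by (rule half_normal_rotation[OF ab a]) (simp add: borel_prod[symmetric])
  have "(\<integral>\<^sup>+z. \<integral>\<^sup>+w. F (of_real a * z - of_real b * w, of_real b * z + of_real a * w) \<partial>std_gaussian \<partial>std_gaussian)
    = (\<integral>\<^sup>+x. \<integral>\<^sup>+x'. \<integral>\<^sup>+y. \<integral>\<^sup>+y'. (\<lambda>p. F (Complex (a * x - b * x') (fst p), Complex (b * x + a * x') (snd p)))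
         (a * y - b * y', b * y + a * y') \<partial>half_normal \<partial>half_normal \<partial>half_normal \<partial>half_normal)"
    by (subst expand)
      (auto intro!: nn_integral_cong arg_cong[where f = F] simp: complex_eq_iff)
  also have "\<dots> = (\<integral>\<^sup>+x. \<integral>\<^sup>+x'. \<Psi> (a * x - b * x', b * x + a * x') \<partial>half_normal \<partial>half_normal)"
    unfolding \<Psi>_def
    by (simp add: inner[simplified])
  also have "\<dots> = (\<integral>\<^sup>+x. \<integral>\<^sup>+x'. \<Psi> (x, x') \<partial>half_normal \<partial>half_normal)"
    by (rule half_normal_rotation[OF ab a \<Psi>_meas])
  also have "\<dots> = (\<integral>\<^sup>+z. \<integral>\<^sup>+w. F (z, w) \<partial>std_gaussian \<partial>std_gaussian)"
    by (subst expand) (auto simp: \<Psi>_def)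
  finally show ?thesis .
qed

section \<open>Gaussian sums over finite index sets\<close>

lemma scaleC_zero_left[simp]: "0 *\<^sub>C x = (0 :: 'a :: complex_banach)"
  using norm_scaleC[of 0 x] by simp

lemma scaleC_zero_right[simp]: "c *\<^sub>C 0 = (0 :: 'a :: complex_banach)"
  using norm_scaleC[of c "0 :: 'a"] by simp

lemma scaleC_one[simp]: "1 *\<^sub>C x = (x :: 'a :: complex_banach)"
  using scaleC_of_real[of 1 x] by simp

lemma bounded_bilinear_scaleC: "bounded_bilinear (\<lambda>c (x :: 'a :: complex_banach). c *\<^sub>C x)"
proof
  show "\<exists>K. \<forall>a b. norm (a *\<^sub>C (b :: 'a)) \<le> norm a * norm b * K"
    by (intro exI[of _ 1]) (simp add: norm_scaleC)
  fix r :: real and a :: complex and b :: 'a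
  show "(r *\<^sub>R a) *\<^sub>C b = r *\<^sub>R (a *\<^sub>C b)"
    by (simp add: scaleR_conv_of_real scaleC_of_real scaleC_scaleC[symmetric])
  show "a *\<^sub>C (r *\<^sub>R b) = r *\<^sub>R (a *\<^sub>C b)"
    by (simp add: scaleC_of_real[symmetric] scaleC_scaleC mult.commute)
qed (simp_all add: scaleC_add_left scaleC_add_right)

interpretation scaleC: bounded_bilinear "\<lambda>c (x :: 'a :: complex_banach). c *\<^sub>C x"
  by (rule bounded_bilinear_scaleC)

text \<open>The second moment of the Gaussian sum over an arbitrary finite index set. It is computed on the product
space itself, which frees the combinatorics below from the given probability space: index sets may be
pairs, and they may be reindexed.\<close>

definition gauss_sq :: "'i set \<Rightarrow> ('i \<Rightarrow> 'a :: complex_banach) \<Rightarrow> ennreal"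
  where "gauss_sq I x = (\<integral>\<^sup>+c. ennreal ((norm (\<Sum>i\<in>I. c i *\<^sub>C x i))\<^sup>2) \<partial>(\<Pi>\<^sub>M i\<in>I. std_gaussian))"

text \<open>The norm of \<open>\<Sum>\<^sub>i \<gamma>\<^sub>i \<otimes> x\<^sub>i\<close> in \<open>G(X)\<close>, independent of the underlying Gaussian sequence
(\<open>gauss_norm_eq_gn\<close> below).\<close>

definition gn :: "'i set \<Rightarrow> ('i \<Rightarrow> 'a :: complex_banach) \<Rightarrow> real"
  where "gn I x = sqrt (enn2real (gauss_sq I x))"

text \<open>The space \<open>X\<close> may be nonseparable, and then sums of \<open>X\<close>-valued measurable functions need not be
measurable. But the norm of the sum is a continuous function of its scalar coefficients, and these
take values in a second countable space.\<close>

lemma measurable_gauss_sum_general: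
  fixes x :: "'i :: countable \<Rightarrow> 'a :: complex_banach"
  assumes f: "\<And>i. i \<in> I \<Longrightarrow> (\<lambda>w. f w i) \<in> borel_measurable M" 
  shows "(\<lambda>w. norm (\<Sum>i\<in>I. f w i *\<^sub>C x i)) \<in> borel_measurable M"
proof -
  define \<Phi> where "\<Phi> = (\<lambda>c. norm (\<Sum>i\<in>I. c i *\<^sub>C x i))"
  have "continuous_on UNIV \<Phi>"
    unfolding \<Phi>_def
    by (intro continuous_intros scaleC.continuous_on) (auto intro: continuous_on_product_coordinates)
  then have 1: "\<Phi> \<in> borel_measurable borel" by (rule borel_measurable_continuous_onI)
  have 2: "(\<lambda>w. (\<lambda>i. if i \<in> I then f w i else 0)) \<in> borel_measurable M"
  proof (rule measurable_coordinatewise_then_product)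
    fix i show "(\<lambda>w. if i \<in> I then f w i else 0) \<in> borel_measurable M"
      using f[of i] by (cases "i \<in> I") auto
  qed
  have "(\<lambda>w. \<Phi> (\<lambda>i. if i \<in> I then f w i else 0)) \<in> borel_measurable M"
    using measurable_compose[OF 2 1] .
  then show ?thesis unfolding \<Phi>_def by (simp cong: sum.cong)
qed

text \<open>Countability of the index type is removed by enumerating the finite index set.\<close>

lemma measurable_gauss_sum:
  fixes x :: "'i \<Rightarrow> 'a :: complex_banach"
  assumes I: "finite I" and f: "\<And>i. i \<in> I \<Longrightarrow> (\<lambda>w. f w i) \<in> borel_measurable M"
  shows "(\<lambda>w. norm (\<Sum>i\<in>I. f w i *\<^sub>C x i)) \<in> borel_measurable M"
proof -
  obtain h where h: "bij_betw h {..<card I} I"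
    using I by (metis bij_betw_from_nat_into_finite)
  have "(\<lambda>w. norm (\<Sum>n<card I. f w (h n) *\<^sub>C x (h n))) \<in> borel_measurable M"
    by (rule measurable_gauss_sum_general[where f = "\<lambda>w n. f w (h n)"])
      (use f h in \<open>auto simp: bij_betw_def\<close>)
  moreover have "(\<Sum>n<card I. f w (h n) *\<^sub>C x (h n)) = (\<Sum>i\<in>I. f w i *\<^sub>C x i)" for w
    using h by (rule sum.reindex_bij_betw)
  ultimately show ?thesis by simp
qed

lemma measurable_gauss_sq:
  fixes x :: "'i \<Rightarrow> 'a :: complex_banach"
  assumes "finite I" "I \<subseteq> J"
  shows "(\<lambda>c. ennreal ((norm (\<Sum>i\<in>I. c i *\<^sub>C x i))\<^sup>2)) \<in> borel_measurable (\<Pi>\<^sub>M i\<in>J. std_gaussian)"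
  by (intro measurable_compose[OF _ measurable_ennreal] borel_measurable_power measurable_gauss_sum)
    (use assms in auto)

lemma gauss_sq_law:
  fixes x :: "'i \<Rightarrow> 'a :: complex_banach" and \<gamma> :: "'i \<Rightarrow> 'w \<Rightarrow> complex"
  assumes I: "finite I" and law: "distr M (\<Pi>\<^sub>M i\<in>I. borel) (\<lambda>w. \<lambda>i\<in>I. \<gamma> i w) = (\<Pi>\<^sub>M i\<in>I. std_gaussian)"
    and meas: "\<And>i. i \<in> I \<Longrightarrow> \<gamma> i \<in> borel_measurable M"
  shows "gauss_sq I x = (\<integral>\<^sup>+w. ennreal ((norm (\<Sum>i\<in>I. \<gamma> i w *\<^sub>C x i))\<^sup>2) \<partial>M)"
proof -
  have 1: "(\<lambda>w. \<lambda>i\<in>I. \<gamma> i w) \<in> measurable M (Pi\<^sub>M I (\<lambda>i. borel))"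
    using meas by (intro measurable_restrict)
  have 2: "(\<lambda>c. ennreal ((norm (\<Sum>i\<in>I. c i *\<^sub>C x i))\<^sup>2)) \<in> borel_measurable (Pi\<^sub>M I (\<lambda>i. borel))"
    by (intro measurable_compose[OF _ measurable_ennreal] borel_measurable_power measurable_gauss_sum)
      (use I in auto)
  have "gauss_sq I x = (\<integral>\<^sup>+w. ennreal ((norm (\<Sum>i\<in>I. (\<lambda>i\<in>I. \<gamma> i w) i *\<^sub>C x i))\<^sup>2) \<partial>M)"
    unfolding gauss_sq_def law[symmetric]
    by (rule nn_integral_distr[OF 1]) (use 2 in \<open>simp only: measurable_distr_eq1\<close>)
  then show ?thesis by (simp cong: sum.cong)
qed

lemma complex_gaussian_law:
  assumes "complex_gaussian_sequence M \<gamma>"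
  shows "distr M borel (\<gamma> n) = std_gaussian"
proof -
  interpret prob_space M using assms by (simp add: complex_gaussian_sequence_def)
  have ind: "indep_var borel (\<lambda>w. Re (\<gamma> n w)) borel (\<lambda>w. Im (\<gamma> n w))"
    and re: "distributed M lborel (\<lambda>w. Re (\<gamma> n w)) (\<lambda>x. ennreal (normal_density 0 (1 / sqrt 2) x))"
    and im: "distributed M lborel (\<lambda>w. Im (\<gamma> n w)) (\<lambda>x. ennreal (normal_density 0 (1 / sqrt 2) x))"
    using assms by (auto simp: complex_gaussian_sequence_def)
  have [measurable]: "(\<lambda>w. Re (\<gamma> n w)) \<in> borel_measurable M" "(\<lambda>w. Im (\<gamma> n w)) \<in> borel_measurable M"
    using distributed_measurable[OF re] distributed_measurable[OF im] by auto
  have "distr M borel (\<lambda>w. Re (\<gamma> n w)) = half_normal" "distr M borel (\<lambda>w. Im (\<gamma> n w)) = half_normal"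
    using distributed_distr_eq_density[OF re] distributed_distr_eq_density[OF im]
    by (simp_all add: half_normal_def cong: distr_cong)
  then have "half_normal \<Otimes>\<^sub>M half_normal = distr M (borel \<Otimes>\<^sub>M borel) (\<lambda>w. (Re (\<gamma> n w), Im (\<gamma> n w)))"
    using ind by (simp add: indep_var_distribution_eq)
  then show ?thesis
    unfolding std_gaussian_def by (simp add: distr_distr comp_def)
qed

lemma gauss_norm_eq_gn:
  fixes x :: "nat \<Rightarrow> 'a :: complex_banach"
  assumes \<gamma>: "complex_gaussian_sequence M \<gamma>"
  shows "gauss_norm M \<gamma> N x = gn {..<N} x"
proof -
  interpret prob_space M using assms by (simp add: complex_gaussian_sequence_def)
  have ind: "indep_vars (\<lambda>_. borel) \<gamma> UNIV" using \<gamma> by (simp add: complex_gaussian_sequence_def)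
  have meas: "\<gamma> i \<in> borel_measurable M" for i
    using ind by (auto simp: indep_vars_def)
  have law: "distr M (\<Pi>\<^sub>M i\<in>{..<N}. borel) (\<lambda>w. \<lambda>i\<in>{..<N}. \<gamma> i w) = (\<Pi>\<^sub>M i\<in>{..<N}. std_gaussian)"
  proof (cases "N = 0")
    case True
    show ?thesis
    proof (rule measure_eqI)
      fix A assume "A \<in> sets (distr M (\<Pi>\<^sub>M i\<in>{..<N}. borel) (\<lambda>w. \<lambda>i\<in>{..<N}. \<gamma> i w))"
      then have "A \<in> {{}, {\<lambda>_. undefined}}" using True by (simp add: sets_PiM_empty)
      then show "emeasure (distr M (\<Pi>\<^sub>M i\<in>{..<N}. borel) (\<lambda>w. \<lambda>i\<in>{..<N}. \<gamma> i w)) A =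
          emeasure (\<Pi>\<^sub>M i\<in>{..<N}. std_gaussian) A"
        using True by (auto simp: emeasure_distr sets_PiM_empty PiM_empty emeasure_space_1 restrict_def)
    qed (simp add: sets_PiM_empty True)
  next
    case False
    then have "distr M (\<Pi>\<^sub>M i\<in>{..<N}. borel) (\<lambda>w. \<lambda>i\<in>{..<N}. \<gamma> i w) = (\<Pi>\<^sub>M i\<in>{..<N}. distr M borel (\<gamma> i))"
      using indep_vars_subset[OF ind, of "{..<N}"] meas by (subst indep_vars_iff_distr_eq_PiM[symmetric]) auto
    then show ?thesis by (simp add: complex_gaussian_law[OF \<gamma>])
  qed
  have [measurable]: "(\<lambda>w. norm (\<Sum>n<N. \<gamma> n w *\<^sub>C x n)) \<in> borel_measurable M"
    using meas by (intro measurable_gauss_sum) auto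
  show ?thesis
    unfolding gauss_norm_def gn_def gauss_sq_law[OF finite_lessThan law meas]
    by (subst integral_eq_nn_integral) auto
qed

lemma gauss_sq_insert:
  fixes x :: "'i \<Rightarrow> 'a :: complex_banach"
  assumes "finite I" "i \<notin> I"
  shows "gauss_sq (insert i I) x =
    (\<integral>\<^sup>+c. \<integral>\<^sup>+z. ennreal ((norm (z *\<^sub>C x i + (\<Sum>j\<in>I. c j *\<^sub>C x j)))\<^sup>2) \<partial>std_gaussian \<partial>(\<Pi>\<^sub>M i\<in>I. std_gaussian))"
proof -
  have "(\<Sum>j\<in>insert i I. (c(i := z)) j *\<^sub>C x j) = z *\<^sub>C x i + (\<Sum>j\<in>I. c j *\<^sub>C x j)" for c z
    using assms by (auto intro!: sum.cong)
  then show ?thesis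
    unfolding gauss_sq_def
    using assms
    by (simp add: std_gaussian_family.product_nn_integral_insert[OF assms measurable_gauss_sq[OF _ order_refl]]
        del: sum.insert)
qed

lemma norm_affine_sq_measurable[measurable]:
  fixes v s :: "'a :: complex_banach"
  shows "(\<lambda>z. ennreal ((norm (z *\<^sub>C v + s))\<^sup>2)) \<in> borel_measurable borel"
proof -
  have "continuous_on UNIV (\<lambda>z. norm (z *\<^sub>C v + s))"
    by (intro continuous_intros scaleC.continuous_on)
  then have [measurable]: "(\<lambda>z. norm (z *\<^sub>C v + s)) \<in> borel_measurable borel"
    by (rule borel_measurable_continuous_onI)
  show ?thesis by measurable
qed

lemma norm_affine2_sq_measurable[measurable]:
  fixes v v' s :: "'a :: complex_banach"
  shows "(\<lambda>p. ennreal ((norm (fst p *\<^sub>C v + (snd p *\<^sub>C v' + s)))\<^sup>2)) \<in> borel_measurable (borel \<Otimes>\<^sub>M borel)"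
proof -
  have "continuous_on UNIV (\<lambda>p. norm (fst p *\<^sub>C v + (snd p *\<^sub>C v' + s)))"
    by (intro continuous_intros scaleC.continuous_on)
  then have [measurable]: "(\<lambda>p. norm (fst p *\<^sub>C v + (snd p *\<^sub>C v' + s))) \<in> borel_measurable (borel \<Otimes>\<^sub>M borel)"
    unfolding borel_prod by (rule borel_measurable_continuous_onI)
  show ?thesis by measurable
qed

lemma gauss_sq_cong: "(\<And>i. i \<in> I \<Longrightarrow> x i = y i) \<Longrightarrow> gauss_sq I x = gauss_sq I y"
  unfolding gauss_sq_def by (intro nn_integral_cong) (simp cong: sum.cong)

lemma gn_cong: "(\<And>i. i \<in> I \<Longrightarrow> x i = y i) \<Longrightarrow> gn I x = gn I y"
  unfolding gn_def by (metis gauss_sq_cong)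

lemma gauss_sq_phase_one:
  fixes x :: "'i \<Rightarrow> 'a :: complex_banach"
  assumes I: "finite I" and u: "cmod u = 1"
  shows "gauss_sq I (x(i := u *\<^sub>C x i)) = gauss_sq I x"
proof (cases "i \<in> I")
  case False
  then show ?thesis by (intro gauss_sq_cong) auto
next
  case True
  define J where "J = I - {i}"
  have J: "finite J" "i \<notin> J" "I = insert i J" using True I by (auto simp: J_def)
  have "gauss_sq I (x(i := u *\<^sub>C x i)) = (\<integral>\<^sup>+c. \<integral>\<^sup>+z. ennreal ((norm ((u * z) *\<^sub>C x i + (\<Sum>j\<in>J. c j *\<^sub>C x j)))\<^sup>2)
      \<partial>std_gaussian \<partial>(\<Pi>\<^sub>M i\<in>J. std_gaussian))"
    unfolding J(3) gauss_sq_insert[OF J(1,2)]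
  proof (intro nn_integral_cong)
    fix c z
    have "(\<Sum>j\<in>J. c j *\<^sub>C (x(i := u *\<^sub>C x i)) j) = (\<Sum>j\<in>J. c j *\<^sub>C x j)"
      using J by (intro sum.cong) auto
    then show "ennreal ((norm (z *\<^sub>C (x(i := u *\<^sub>C x i)) i + (\<Sum>j\<in>J. c j *\<^sub>C (x(i := u *\<^sub>C x i)) j)))\<^sup>2)
      = ennreal ((norm ((u * z) *\<^sub>C x i + (\<Sum>j\<in>J. c j *\<^sub>C x j)))\<^sup>2)"
      by (simp add: scaleC_scaleC mult.commute)
  qed
  also have "\<dots> = gauss_sq I x"
    unfolding J(3) gauss_sq_insert[OF J(1,2)]
    by (intro nn_integral_cong std_gaussian_phase[OF u]) measurable
  finally show ?thesis .
qed

text \<open>This is invariance under rotations in a coordinate plane: moving the rotation of the coefficient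
vectors \<open>x\<^sub>i, x\<^sub>j\<close> over to the variables \<open>\<gamma>\<^sub>i, \<gamma>\<^sub>j\<close> gives the transposed rotation, which preserves
their joint law.\<close>

lemma gauss_sq_rotate_two:
  fixes x :: "'i \<Rightarrow> 'a :: complex_banach" and a b :: real
  assumes I: "finite I" "i \<in> I" "j \<in> I" "i \<noteq> j" and ab: "a\<^sup>2 + b\<^sup>2 = 1" "a \<noteq> 0"
  shows "gauss_sq I (x(i := a *\<^sub>R x i + b *\<^sub>R x j, j := a *\<^sub>R x j - b *\<^sub>R x i)) = gauss_sq I x"
proof -
  define J where "J = I - {i, j}"
  have J: "finite J" "j \<notin> J" "i \<notin> insert j J" "I = insert i (insert j J)" "finite (insert j J)"
    using I by (auto simp: J_def)
  define P where "P = (\<Pi>\<^sub>M i\<in>J. std_gaussian)"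
  have peel: "gauss_sq I y = (\<integral>\<^sup>+c. \<integral>\<^sup>+w. \<integral>\<^sup>+z. ennreal ((norm (z *\<^sub>C y i + (w *\<^sub>C y j + (\<Sum>k\<in>J. c k *\<^sub>C y k))))\<^sup>2)
      \<partial>std_gaussian \<partial>std_gaussian \<partial>P)" for y :: "'i \<Rightarrow> 'a"
  proof -
    have s: "(\<Sum>k\<in>insert j J. (c(j := w)) k *\<^sub>C y k) = w *\<^sub>C y j + (\<Sum>k\<in>J. c k *\<^sub>C y k)" for c w
      using J by (auto intro!: sum.cong)
    have 1: "(\<lambda>(c,z). ennreal ((norm (z *\<^sub>C y i + (\<Sum>k\<in>insert j J. c k *\<^sub>C y k)))\<^sup>2))
      \<in> borel_measurable ((\<Pi>\<^sub>M i\<in>insert j J. std_gaussian) \<Otimes>\<^sub>M std_gaussian)"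
    proof -
      have "(\<lambda>p. norm (\<Sum>k\<in>insert i (insert j J). (\<lambda>p k. if k = i then snd p else fst p k) p k *\<^sub>C y k))
        \<in> borel_measurable ((\<Pi>\<^sub>M i\<in>insert j J. std_gaussian) \<Otimes>\<^sub>M std_gaussian)"
      proof (rule measurable_gauss_sum)
        fix k assume "k \<in> insert i (insert j J)"
        then show "(\<lambda>p. (\<lambda>p k. if k = i then snd p else fst p k) p k)
          \<in> borel_measurable ((\<Pi>\<^sub>M i\<in>insert j J. std_gaussian) \<Otimes>\<^sub>M std_gaussian)"
          by (cases "k = i") auto
      qed (use J in auto)
      moreover have "(\<Sum>k\<in>insert i (insert j J). (\<lambda>p k. if k = i then snd p else fst p k) p k *\<^sub>C y k)
        = snd p *\<^sub>C y i + (\<Sum>k\<in>insert j J. fst p k *\<^sub>C y k)" for p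
        using J by (subst sum.insert) (auto intro!: sum.cong)
      ultimately show ?thesis by (simp add: case_prod_beta)
    qed
    show ?thesis
      unfolding J(4) gauss_sq_insert[OF J(5,3)] P_def
      by (subst std_gaussian_family.product_nn_integral_insert[OF J(1,2)])
        (use 1 s in \<open>auto simp del: sum.insert simp: std_gaussian.borel_measurable_nn_integral\<close>)
  qed
  have "gauss_sq I (x(i := a *\<^sub>R x i + b *\<^sub>R x j, j := a *\<^sub>R x j - b *\<^sub>R x i)) =
    (\<integral>\<^sup>+c. \<integral>\<^sup>+w. \<integral>\<^sup>+z. (\<lambda>p. ennreal ((norm (snd p *\<^sub>C x i + (fst p *\<^sub>C x j + (\<Sum>k\<in>J. c k *\<^sub>C x k))))\<^sup>2))
      (of_real a * w - of_real (- b) * z, of_real (- b) * w + of_real a * z) \<partial>std_gaussian \<partial>std_gaussian \<partial>P)"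
    unfolding peel
  proof (intro nn_integral_cong arg_cong[where f = "\<lambda>v. ennreal ((norm v)\<^sup>2)"])
    fix c w z
    let ?y = "x(i := a *\<^sub>R x i + b *\<^sub>R x j, j := a *\<^sub>R x j - b *\<^sub>R x i)"
    have "(\<Sum>k\<in>J. c k *\<^sub>C ?y k) = (\<Sum>k\<in>J. c k *\<^sub>C x k)" using J by (intro sum.cong) auto
    then show "z *\<^sub>C ?y i + (w *\<^sub>C ?y j + (\<Sum>k\<in>J. c k *\<^sub>C ?y k)) =
      snd (of_real a * w - of_real (- b) * z, of_real (- b) * w + of_real a * z) *\<^sub>C x i +
      (fst (of_real a * w - of_real (- b) * z, of_real (- b) * w + of_real a * z) *\<^sub>C x j + (\<Sum>k\<in>J. c k *\<^sub>C x k))"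
      using I(4)
      by (simp add: scaleC_add_left scaleC_add_right scaleC_of_real[symmetric] scaleC_scaleC
          scaleC.diff_right scaleC.diff_left scaleC.minus_left mult.commute)
  qed
  also have "\<dots> = gauss_sq I x"
  proof -
    have r: "(\<integral>\<^sup>+w. \<integral>\<^sup>+z. (\<lambda>p. ennreal ((norm (snd p *\<^sub>C x i + (fst p *\<^sub>C x j + s)))\<^sup>2))
      (of_real a * w - of_real (- b) * z, of_real (- b) * w + of_real a * z) \<partial>std_gaussian \<partial>std_gaussian)
      = (\<integral>\<^sup>+w. \<integral>\<^sup>+z. (\<lambda>p. ennreal ((norm (snd p *\<^sub>C x i + (fst p *\<^sub>C x j + s)))\<^sup>2))
      (w, z) \<partial>std_gaussian \<partial>std_gaussian)" for s
    proof (rule std_gaussian_pair_rotation)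
      have "(\<lambda>p. ennreal ((norm (fst p *\<^sub>C x j + (snd p *\<^sub>C x i + s)))\<^sup>2)) \<in> borel_measurable (borel \<Otimes>\<^sub>M borel)"
        by measurable
      then show "(\<lambda>p. ennreal ((norm (snd p *\<^sub>C x i + (fst p *\<^sub>C x j + s)))\<^sup>2)) \<in> borel_measurable (borel \<Otimes>\<^sub>M borel)"
        by (simp add: add.left_commute)
    qed (use ab in auto)
    show ?thesis unfolding peel r by simp
  qed
  finally show ?thesis .
qed

section \<open>The Gaussian norm\<close>

lemma half_normal_second_moment: "(\<integral>\<^sup>+x. ennreal (x\<^sup>2) \<partial>half_normal) = ennreal (1 / 2)"
proof -
  have "has_bochner_integral lborel (\<lambda>x. normal_density 0 (1 / sqrt 2) x * (x - 0) ^ (2 * 1))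
      (fact (2 * 1) / ((2 / (1 / sqrt 2)\<^sup>2) ^ 1 * fact 1))"
    by (rule normal_moment_even) simp
  then have "has_bochner_integral lborel (\<lambda>x. normal_density 0 (1 / sqrt 2) x * x\<^sup>2) (1 / 2)"
    by (simp add: power_divide fact_numeral)
  then have "integrable lborel (\<lambda>x. normal_density 0 (1 / sqrt 2) x * x\<^sup>2)"
    and "(LINT x|lborel. normal_density 0 (1 / sqrt 2) x * x\<^sup>2) = 1 / 2"
    unfolding has_bochner_integral_iff by blast+
  then have "(\<integral>\<^sup>+x. ennreal (normal_density 0 (1 / sqrt 2) x * x\<^sup>2) \<partial>lborel) = ennreal (1 / 2)"
    by (subst nn_integral_eq_integral) (simp_all only: zero_le_mult_iff, auto)
  then show ?thesis
    unfolding half_normal_def by (subst nn_integral_density) (auto simp: ennreal_mult)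
qed

lemma std_gaussian_second_moment: "(\<integral>\<^sup>+z. ennreal ((cmod z)\<^sup>2) \<partial>std_gaussian) = 1"
proof -
  have "(\<integral>\<^sup>+z. ennreal ((cmod z)\<^sup>2) \<partial>std_gaussian) = (\<integral>\<^sup>+x. \<integral>\<^sup>+y. ennreal (x\<^sup>2) + ennreal (y\<^sup>2) \<partial>half_normal \<partial>half_normal)"
    by (subst nn_integral_std_gaussian) (auto simp: cmod_power2 intro!: nn_integral_cong)
  also have "\<dots> = (\<integral>\<^sup>+x. ennreal (x\<^sup>2) + ennreal (1 / 2) \<partial>half_normal)"
    by (intro nn_integral_cong, subst nn_integral_add)
      (auto simp: half_normal_second_moment half_normal.emeasure_space_1[simplified])
  also have "\<dots> = ennreal (1 / 2) + ennreal (1 / 2)"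
    by (subst nn_integral_add)
      (auto simp: half_normal_second_moment half_normal.emeasure_space_1[simplified])
  also have "\<dots> = 1" by (subst ennreal_plus[symmetric]) auto
  finally show ?thesis .
qed

lemma prob_space_gaussian_product: "prob_space (\<Pi>\<^sub>M i\<in>I. std_gaussian)"
  by (intro prob_space_PiM std_gaussian.prob_space_axioms)

lemma gauss_sq_empty[simp]: "gauss_sq {} x = 0"
  by (simp add: gauss_sq_def)

lemma gauss_sq_single:
  fixes x :: "'i \<Rightarrow> 'a :: complex_banach"
  shows "gauss_sq {i} x = ennreal ((norm (x i))\<^sup>2)"
proof -
  have "gauss_sq {i} x = (\<integral>\<^sup>+c. \<integral>\<^sup>+z. ennreal ((cmod z)\<^sup>2) * ennreal ((norm (x i))\<^sup>2) \<partial>std_gaussian \<partial>(\<Pi>\<^sub>M i\<in>({} :: 'i set). std_gaussian))"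
    by (subst gauss_sq_insert)
      (auto simp: norm_scaleC power_mult_distrib ennreal_mult intro!: nn_integral_cong)
  also have "\<dots> = (\<integral>\<^sup>+c. ennreal ((norm (x i))\<^sup>2) \<partial>(\<Pi>\<^sub>M i\<in>({} :: 'i set). std_gaussian))"
    by (intro nn_integral_cong, subst nn_integral_multc) (simp_all add: std_gaussian_second_moment)
  also have "\<dots> = ennreal ((norm (x i))\<^sup>2)"
    by (simp add: prob_space.emeasure_space_1[OF prob_space_gaussian_product])
  finally show ?thesis .
qed

lemma gn_empty[simp]: "gn {} x = 0"
  by (simp add: gn_def)

lemma gn_single: "gn {i} x = norm (x i)"
  by (simp add: gn_def gauss_sq_single)

lemma norm_add_square_le: "(norm (a + b))\<^sup>2 \<le> 2 * (norm a)\<^sup>2 + 2 * (norm b)\<^sup>2"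
proof -
  have "(norm (a + b))\<^sup>2 \<le> (norm a + norm b)\<^sup>2"
    by (intro power_mono norm_triangle_ineq) auto
  also have "\<dots> \<le> 2 * (norm a)\<^sup>2 + 2 * (norm b)\<^sup>2"
    using sum_squares_bound[of "norm a" "norm b"] by (simp add: power2_sum)
  finally show ?thesis .
qed

lemma gauss_sq_finite:
  fixes x :: "'i \<Rightarrow> 'a :: complex_banach"
  assumes "finite I" shows "gauss_sq I x < \<infinity>"
  using assms
proof (induction I)
  case (insert i I)
  let ?P = "\<Pi>\<^sub>M i\<in>I. std_gaussian"
  have m[measurable]: "(\<lambda>c. ennreal ((norm (\<Sum>j\<in>I. c j *\<^sub>C x j))\<^sup>2)) \<in> borel_measurable ?P"
    by (rule measurable_gauss_sq) (use insert in auto)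
  have "gauss_sq (insert i I) x \<le> (\<integral>\<^sup>+c. \<integral>\<^sup>+z. ennreal (2 * (norm (x i))\<^sup>2) * ennreal ((cmod z)\<^sup>2)
      + 2 * ennreal ((norm (\<Sum>j\<in>I. c j *\<^sub>C x j))\<^sup>2) \<partial>std_gaussian \<partial>?P)"
    unfolding gauss_sq_insert[OF insert(1,2)]
  proof (intro nn_integral_mono)
    fix c z
    let ?s = "\<Sum>j\<in>I. c j *\<^sub>C x j"
    have "ennreal ((norm (z *\<^sub>C x i + ?s))\<^sup>2) \<le> ennreal (2 * (norm (x i))\<^sup>2 * (cmod z)\<^sup>2 + 2 * (norm ?s)\<^sup>2)"
      using norm_add_square_le[of "z *\<^sub>C x i" ?s]
      by (intro ennreal_leI) (simp add: norm_scaleC power_mult_distrib mult_ac)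
    also have "\<dots> = ennreal (2 * (norm (x i))\<^sup>2) * ennreal ((cmod z)\<^sup>2) + 2 * ennreal ((norm ?s)\<^sup>2)"
      by (simp add: ennreal_mult)
    finally show "ennreal ((norm (z *\<^sub>C x i + ?s))\<^sup>2) \<le> \<dots>" .
  qed
  also have "\<dots> = (\<integral>\<^sup>+c. ennreal (2 * (norm (x i))\<^sup>2) + 2 * ennreal ((norm (\<Sum>j\<in>I. c j *\<^sub>C x j))\<^sup>2) \<partial>?P)"
    by (intro nn_integral_cong, subst nn_integral_add)
      (auto simp: nn_integral_cmult std_gaussian_second_moment std_gaussian.emeasure_space_1[simplified])
  also have "\<dots> = ennreal (2 * (norm (x i))\<^sup>2) + 2 * gauss_sq I x"
    unfolding gauss_sq_def
    by (subst nn_integral_add)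
      (simp_all add: nn_integral_cmult[OF m] prob_space.emeasure_space_1[OF prob_space_gaussian_product])
  also have "\<dots> < \<infinity>" using insert by (simp add: ennreal_mult_less_top)
  finally show ?case .
qed simp

lemma gn_nonneg[simp]: "0 \<le> gn I x"
  by (simp add: gn_def)

lemma gauss_sq_eq_gn: "finite I \<Longrightarrow> gauss_sq I x = ennreal ((gn I x)\<^sup>2)"
  using gauss_sq_finite[of I x] by (simp add: gn_def)

lemma gn_leI: "finite I \<Longrightarrow> 0 \<le> a \<Longrightarrow> gauss_sq I x \<le> ennreal (a\<^sup>2) \<Longrightarrow> gn I x \<le> a"
  by (metis ennreal_le_iff gauss_sq_eq_gn power2_le_imp_le zero_le_power2)

text \<open>The form in which most estimates of Gaussian norms arise: an inequality between the sums for every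
choice of the coefficients.\<close>

lemma gn_mono_pointwise:
  assumes I: "finite I" and K: "0 \<le> K"
    and le: "\<And>c. norm (\<Sum>i\<in>I. c i *\<^sub>C y i) \<le> K * norm (\<Sum>i\<in>I. c i *\<^sub>C x i)"
  shows "gn I y \<le> K * gn I x"
proof (rule gn_leI[OF I])
  have m: "(\<lambda>c. ennreal ((norm (\<Sum>j\<in>I. c j *\<^sub>C x j))\<^sup>2)) \<in> borel_measurable (\<Pi>\<^sub>M i\<in>I. std_gaussian)"
    by (rule measurable_gauss_sq) (use I in auto)
  have "gauss_sq I y \<le> (\<integral>\<^sup>+c. ennreal (K\<^sup>2) * ennreal ((norm (\<Sum>i\<in>I. c i *\<^sub>C x i))\<^sup>2) \<partial>(\<Pi>\<^sub>M i\<in>I. std_gaussian))"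
    unfolding gauss_sq_def
  proof (intro nn_integral_mono)
    fix c
    have "(norm (\<Sum>i\<in>I. c i *\<^sub>C y i))\<^sup>2 \<le> K\<^sup>2 * (norm (\<Sum>i\<in>I. c i *\<^sub>C x i))\<^sup>2"
      using power_mono[OF le[of c], of 2] by (simp add: power_mult_distrib)
    then show "ennreal ((norm (\<Sum>i\<in>I. c i *\<^sub>C y i))\<^sup>2) \<le> ennreal (K\<^sup>2) * ennreal ((norm (\<Sum>i\<in>I. c i *\<^sub>C x i))\<^sup>2)"
      by (simp add: ennreal_mult[symmetric] ennreal_leI)
  qed
  also have "\<dots> = ennreal (K\<^sup>2) * gauss_sq I x"
    unfolding gauss_sq_def by (rule nn_integral_cmult[OF m])
  also have "\<dots> = ennreal ((K * gn I x)\<^sup>2)"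
    by (simp add: gauss_sq_eq_gn[OF I] ennreal_mult[symmetric] power_mult_distrib)
  finally show "gauss_sq I y \<le> ennreal ((K * gn I x)\<^sup>2)" .
qed (use K in auto)

lemma gn_triangle:
  fixes x y :: "'i \<Rightarrow> 'a :: complex_banach"
  assumes I: "finite I"
  shows "gn I (\<lambda>i. x i + y i) \<le> gn I x + gn I y"
proof (rule field_le_epsilon)
  fix e :: real assume e: "0 < e"
  \<comment> \<open>strictly positive bounds allow a division by \<open>a\<close> and \<open>b\<close> in the weighted quadratic inequality\<close>
  define a where "a = gn I x + e / 2"
  define b where "b = gn I y + e / 2"
  have a: "gn I x \<le> a" "0 < a" and b: "gn I y \<le> b" "0 < b"
    using e by (auto simp: a_def b_def add_nonneg_pos)
  let ?X = "\<lambda>c. norm (\<Sum>j\<in>I. c j *\<^sub>C x j)" and ?Y = "\<lambda>c. norm (\<Sum>j\<in>I. c j *\<^sub>C y j)"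
  have mx[measurable]: "(\<lambda>c. ennreal ((?X c)\<^sup>2)) \<in> borel_measurable (\<Pi>\<^sub>M i\<in>I. std_gaussian)"
    by (rule measurable_gauss_sq) (use I in auto)
  have my[measurable]: "(\<lambda>c. ennreal ((?Y c)\<^sup>2)) \<in> borel_measurable (\<Pi>\<^sub>M i\<in>I. std_gaussian)"
    by (rule measurable_gauss_sq) (use I in auto)
  have "gn I (\<lambda>i. x i + y i) \<le> a + b"
  proof (rule gn_leI[OF I])
    have "gauss_sq I (\<lambda>i. x i + y i) \<le>
      (\<integral>\<^sup>+c. ennreal ((a + b) / a) * ennreal ((?X c)\<^sup>2) + ennreal ((a + b) / b) * ennreal ((?Y c)\<^sup>2) \<partial>(\<Pi>\<^sub>M i\<in>I. std_gaussian))"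
      unfolding gauss_sq_def
    proof (intro nn_integral_mono)
      fix c
      have "(norm (\<Sum>i\<in>I. c i *\<^sub>C (x i + y i)))\<^sup>2 \<le> (?X c + ?Y c)\<^sup>2"
        by (intro power_mono) (simp_all add: scaleC_add_right sum.distrib norm_triangle_ineq)
      also have "\<dots> \<le> (a + b) / a * (?X c)\<^sup>2 + (a + b) / b * (?Y c)\<^sup>2"
      proof -
        have "0 \<le> (b * ?X c - a * ?Y c)\<^sup>2 / (a * b)" using a b by simp
        also have "\<dots> = (a + b) / a * (?X c)\<^sup>2 + (a + b) / b * (?Y c)\<^sup>2 - (?X c + ?Y c)\<^sup>2"
          using a b by (simp add: field_simps power2_eq_square)
        finally show ?thesis by simp
      qed
      finally have "ennreal ((norm (\<Sum>i\<in>I. c i *\<^sub>C (x i + y i)))\<^sup>2) \<le> ennreal \<dots>"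
        by (rule ennreal_leI)
      also have "\<dots> = ennreal ((a + b) / a) * ennreal ((?X c)\<^sup>2) + ennreal ((a + b) / b) * ennreal ((?Y c)\<^sup>2)"
        using a b by (simp add: ennreal_mult[symmetric] ennreal_plus[symmetric] del: ennreal_plus)
      finally show "ennreal ((norm (\<Sum>i\<in>I. c i *\<^sub>C (x i + y i)))\<^sup>2) \<le> \<dots>" .
    qed
    also have "\<dots> = ennreal ((a + b) / a) * gauss_sq I x + ennreal ((a + b) / b) * gauss_sq I y"
      unfolding gauss_sq_def by (simp add: nn_integral_add nn_integral_cmult[OF mx] nn_integral_cmult[OF my])
    also have "\<dots> \<le> ennreal ((a + b) / a) * ennreal (a\<^sup>2) + ennreal ((a + b) / b) * ennreal (b\<^sup>2)"
      using a b by (intro add_mono mult_left_mono) (auto simp: gauss_sq_eq_gn[OF I] power_mono)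
    also have "\<dots> = ennreal ((a + b)\<^sup>2)"
      using a b by (simp add: ennreal_mult[symmetric] ennreal_plus[symmetric] del: ennreal_plus)
        (simp add: power2_eq_square field_simps)
    finally show "gauss_sq I (\<lambda>i. x i + y i) \<le> ennreal ((a + b)\<^sup>2)" .
  qed (use a b in auto)
  then show "gn I (\<lambda>i. x i + y i) \<le> gn I x + gn I y + e"
    by (simp add: a_def b_def)
qed

lemma gn_scale_le:
  assumes "finite I" shows "gn I (\<lambda>i. c *\<^sub>C x i) \<le> cmod c * gn I x"
proof (rule gn_mono_pointwise[OF assms])
  fix d
  have "(\<Sum>i\<in>I. d i *\<^sub>C c *\<^sub>C x i) = c *\<^sub>C (\<Sum>i\<in>I. d i *\<^sub>C x i)"
    by (simp add: scaleC.sum_right scaleC_scaleC mult.commute)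
  then show "norm (\<Sum>i\<in>I. d i *\<^sub>C c *\<^sub>C x i) \<le> cmod c * norm (\<Sum>i\<in>I. d i *\<^sub>C x i)"
    by (simp add: norm_scaleC)
qed simp

lemma gn_operator:
  assumes "finite I" "S \<in> complex_ops"
  shows "gn I (\<lambda>i. S (x i)) \<le> norm S * gn I x"
proof (rule gn_mono_pointwise[OF assms(1)])
  fix d
  have "(\<Sum>i\<in>I. d i *\<^sub>C S (x i)) = S (\<Sum>i\<in>I. d i *\<^sub>C x i)"
    using assms(2) by (simp add: blinfun.sum_right complex_ops_def)
  then show "norm (\<Sum>i\<in>I. d i *\<^sub>C S (x i)) \<le> norm S * norm (\<Sum>i\<in>I. d i *\<^sub>C x i)"
    by (simp add: norm_blinfun)
qed simp

lemma gn_sum: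
  assumes "finite I" "finite K"
  shows "gn I (\<lambda>i. \<Sum>k\<in>K. x k i) \<le> (\<Sum>k\<in>K. gn I (x k))"
  using assms(2)
proof (induction K)
  case empty
  show ?case using gn_scale_le[OF assms(1), of 0 "\<lambda>_. 0"] by simp
next
  case (insert k K)
  then show ?case using gn_triangle[OF assms(1), of "x k" "\<lambda>i. \<Sum>k\<in>K. x k i"] by simp
qed

lemma gn_phase:
  fixes x :: "'i \<Rightarrow> 'a :: complex_banach"
  assumes I: "finite I" and u: "\<And>i. i \<in> I \<Longrightarrow> cmod (u i) = 1"
  shows "gn I (\<lambda>i. u i *\<^sub>C x i) = gn I x"
proof -
  have "gauss_sq I (\<lambda>i. if i \<in> J then u i *\<^sub>C x i else x i) = gauss_sq I x" if "finite J" "J \<subseteq> I" for J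
    using that
  proof (induction J)
    case (insert j J)
    let ?y = "\<lambda>i. if i \<in> J then u i *\<^sub>C x i else x i"
    have "gauss_sq I (\<lambda>i. if i \<in> insert j J then u i *\<^sub>C x i else x i) = gauss_sq I (?y(j := u j *\<^sub>C ?y j))"
      using insert by (intro arg_cong[where f = "gauss_sq I"]) auto
    also have "\<dots> = gauss_sq I ?y" by (rule gauss_sq_phase_one[OF I]) (use insert u in auto)
    finally show ?case using insert by simp
  qed simp
  from this[OF I order_refl] gauss_sq_cong[of I "\<lambda>i. if i \<in> I then u i *\<^sub>C x i else x i" "\<lambda>i. u i *\<^sub>C x i"]
  show ?thesis by (simp add: gn_def)
qed

lemma mean_of_two_phases:
  assumes "cmod c \<le> 1" shows "\<exists>u v. cmod u = 1 \<and> cmod v = 1 \<and> c = (u + v) / 2"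
proof -
  define t where "t = arccos (cmod c)"
  have "cos t = cmod c" using assms unfolding t_def by (intro cos_arccos) (auto intro: order_trans[of _ 0])
  then have "c = (cis (Arg c + t) + cis (Arg c - t)) / 2"
    by (subst rcis_cmod_Arg[of c, symmetric])
      (simp add: rcis_def complex_eq_iff cos_add cos_diff sin_add sin_diff)
  then show ?thesis by (metis norm_cis)
qed

text \<open>Kahane's contraction principle for complex coefficients. A coefficient in the closed unit disc is the
mean of two phases, and phases do not change the Gaussian norm.\<close>

lemma gn_contract:
  fixes x :: "'i \<Rightarrow> 'a :: complex_banach"
  assumes I: "finite I" and u: "\<And>i. i \<in> I \<Longrightarrow> cmod (c i) \<le> K" and K: "0 \<le> K"
  shows "gn I (\<lambda>i. c i *\<^sub>C x i) \<le> K * gn I x"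
proof -
  have unit: "gn I (\<lambda>i. d i *\<^sub>C y i) \<le> gn I y" if d: "\<And>i. i \<in> I \<Longrightarrow> cmod (d i) \<le> 1" for d and y :: "'i \<Rightarrow> 'a"
  proof -
    have "\<forall>i\<in>I. \<exists>u v. cmod u = 1 \<and> cmod v = 1 \<and> d i = (u + v) / 2"
      using d mean_of_two_phases by blast
    then obtain u v where uv: "\<And>i. i \<in> I \<Longrightarrow> cmod (u i) = 1 \<and> cmod (v i) = 1 \<and> d i = (u i + v i) / 2"
      by metis
    have "gn I (\<lambda>i. d i *\<^sub>C y i) = gn I (\<lambda>i. u i *\<^sub>C (1/2) *\<^sub>C y i + v i *\<^sub>C (1/2) *\<^sub>C y i)"
      using uv by (intro gn_cong) (simp add: scaleC_scaleC scaleC_add_left[symmetric] add_divide_distrib)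
    also have "\<dots> \<le> gn I (\<lambda>i. u i *\<^sub>C (1/2) *\<^sub>C y i) + gn I (\<lambda>i. v i *\<^sub>C (1/2) *\<^sub>C y i)"
      by (rule gn_triangle[OF I])
    also have "\<dots> = gn I (\<lambda>i. (1/2) *\<^sub>C y i) + gn I (\<lambda>i. (1/2) *\<^sub>C y i)"
      using uv by (simp add: gn_phase[OF I])
    also have "\<dots> \<le> gn I y"
      using gn_scale_le[OF I, of "1/2" y] by simp
    finally show ?thesis .
  qed
  show ?thesis
  proof (cases "K = 0")
    case True
    then have "gn I (\<lambda>i. c i *\<^sub>C x i) = gn I (\<lambda>i. 0 *\<^sub>C x i)" using u by (intro gn_cong) auto
    then show ?thesis using gn_scale_le[OF I, of 0 x] True by simp
  next
    case False
    then have "gn I (\<lambda>i. c i *\<^sub>C x i) = gn I (\<lambda>i. (c i / of_real K) *\<^sub>C of_real K *\<^sub>C x i)"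
      by (simp add: scaleC_scaleC)
    also have "\<dots> \<le> gn I (\<lambda>i. of_real K *\<^sub>C x i)"
      using False K u by (intro unit) (simp add: norm_divide)
    also have "\<dots> \<le> K * gn I x" using gn_scale_le[OF I, of "of_real K" x] K by simp
    finally show ?thesis .
  qed
qed

lemma gn_superset:
  fixes x :: "'i \<Rightarrow> 'a :: complex_banach"
  assumes "finite I" "J \<subseteq> I" "\<And>i. i \<in> I - J \<Longrightarrow> x i = 0"
  shows "gn I x = gn J x"
proof -
  have "gauss_sq (J \<union> D) x = gauss_sq J x" if "finite D" "D \<inter> J = {}" "\<And>i. i \<in> D \<Longrightarrow> x i = 0" for D
    using that
  proof (induction D)
    case (insert d D)
    have "finite J" using assms finite_subset by blast
    then have "gauss_sq (insert d (J \<union> D)) x = gauss_sq (J \<union> D) x"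
      using insert by (subst gauss_sq_insert)
        (auto simp: gauss_sq_def std_gaussian.emeasure_space_1[simplified])
    then show ?case using insert by simp
  qed simp
  moreover have "(I - J) \<inter> J = {}" "J \<union> (I - J) = I" using assms by auto
  ultimately show ?thesis using assms unfolding gn_def by (metis finite_Diff)
qed

text \<open>Setting a coefficient to zero is a contraction.\<close>

lemma gn_subset:
  assumes "finite I" "J \<subseteq> I" shows "gn J x \<le> gn I x"
proof -
  have "gn J x = gn J (\<lambda>i. (if i \<in> J then 1 else 0) *\<^sub>C x i)"
    by (intro gn_cong) auto
  also have "\<dots> = gn I (\<lambda>i. (if i \<in> J then 1 else 0) *\<^sub>C x i)"
    by (rule gn_superset[symmetric]) (use assms in auto)
  also have "\<dots> \<le> 1 * gn I x" by (rule gn_contract[OF assms(1)]) auto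
  finally show ?thesis by simp
qed

lemma gn_reindex:
  fixes x :: "'j \<Rightarrow> 'a :: complex_banach"
  assumes I: "finite I" and p: "inj_on p I"
  shows "gn I (\<lambda>i. x (p i)) = gn (p ` I) x"
proof -
  have law: "distr (\<Pi>\<^sub>M j\<in>p ` I. std_gaussian) (\<Pi>\<^sub>M i\<in>I. borel) (\<lambda>w. \<lambda>i\<in>I. w (p i)) = (\<Pi>\<^sub>M i\<in>I. std_gaussian)"
  proof -
    have "distr (\<Pi>\<^sub>M j\<in>p ` I. std_gaussian) (\<Pi>\<^sub>M i\<in>I. std_gaussian) (\<lambda>w. \<lambda>i\<in>I. w (p i)) = (\<Pi>\<^sub>M i\<in>I. std_gaussian)"
      by (rule distr_PiM_reindex) (use p in \<open>auto simp: std_gaussian.prob_space_axioms\<close>)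
    moreover have "sets (\<Pi>\<^sub>M i\<in>I. borel) = sets (\<Pi>\<^sub>M i\<in>I. std_gaussian)"
      by (intro sets_PiM_cong) auto
    ultimately show ?thesis by (simp cong: distr_cong)
  qed
  have "gauss_sq I (\<lambda>i. x (p i)) = (\<integral>\<^sup>+w. ennreal ((norm (\<Sum>i\<in>I. w (p i) *\<^sub>C x (p i)))\<^sup>2) \<partial>(\<Pi>\<^sub>M j\<in>p ` I. std_gaussian))"
    by (rule gauss_sq_law[OF I law]) auto
  also have "\<dots> = gauss_sq (p ` I) x"
    unfolding gauss_sq_def by (simp add: sum.reindex[OF p])
  finally show ?thesis by (simp add: gn_def)
qed

text \<open>The basic step of the fast Fourier transform, applied to all the pairs at once. On each pair it is a
rotation by \<open>\<pi>/4\<close> followed by a change of sign.\<close>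

lemma gn_butterfly:
  fixes x :: "'p \<times> bool \<Rightarrow> 'a :: complex_banach"
  assumes P: "finite P"
  shows "gn (P \<times> UNIV) (\<lambda>(p, s). (1 / sqrt 2) *\<^sub>R (if s then x (p, False) - x (p, True) else x (p, False) + x (p, True)))
    = gn (P \<times> UNIV) x"
proof -
  define y where "y = (\<lambda>Q (p, s). if p \<in> Q then (1 / sqrt 2) *\<^sub>R (if s then x (p, False) - x (p, True)
      else x (p, False) + x (p, True)) else x (p, s))"
  have fin: "finite (P \<times> (UNIV :: bool set))" using P by simp
  have "gauss_sq (P \<times> UNIV) (y Q) = gauss_sq (P \<times> UNIV) x" if "finite Q" "Q \<subseteq> P" for Q
    using that
  proof (induction Q)
    case (insert q Q)
    let ?i = "(q, False)" and ?j = "(q, True)" and ?a = "1 / sqrt 2"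
    define z where "z = (y Q)(?i := ?a *\<^sub>R y Q ?i + ?a *\<^sub>R y Q ?j, ?j := ?a *\<^sub>R y Q ?j - ?a *\<^sub>R y Q ?i)"
    have "(- 1) *\<^sub>C v = - v" for v :: 'a using scaleC.minus_left[of 1 v] by simp
    then have "y (insert q Q) = z(?j := (- 1) *\<^sub>C z ?j)"
      using insert by (auto simp: y_def z_def fun_eq_iff scaleR_right_diff_distrib scaleR_right_distrib)
    then have "gauss_sq (P \<times> UNIV) (y (insert q Q)) = gauss_sq (P \<times> UNIV) z"
      by (simp only: gauss_sq_phase_one[OF fin] norm_minus_cancel norm_one)
    also have "\<dots> = gauss_sq (P \<times> UNIV) (y Q)"
      unfolding z_def by (rule gauss_sq_rotate_two[OF fin]) (use insert in \<open>auto simp: power_divide\<close>)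
    finally show ?case using insert by simp
  qed (simp add: y_def)
  from this[OF P order_refl] have "gn (P \<times> UNIV) (y P) = gn (P \<times> UNIV) x" by (simp add: gn_def)
  moreover have "gn (P \<times> UNIV) (\<lambda>(p, s). (1 / sqrt 2) *\<^sub>R (if s then x (p, False) - x (p, True)
      else x (p, False) + x (p, True))) = gn (P \<times> UNIV) (y P)"
    by (rule gn_cong) (auto simp: y_def)
  ultimately show ?thesis by simp
qed

section \<open>Invariance under the discrete Fourier transform\<close>

lemma cis_eq_one_of_nat: "s = 1 \<or> s = - 1 \<Longrightarrow> cis (s * (2 * pi * real n)) = 1"
  using cis_multiple_2pi[of "real n"] cis_multiple_2pi[of "- real n"] by auto

text \<open>The unitary discrete Fourier transform; the sign \<open>s = 1\<close> or \<open>s = -1\<close> of the exponent selects the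
transform or its inverse.\<close>

definition dft :: "real \<Rightarrow> nat \<Rightarrow> (nat \<Rightarrow> 'a :: complex_banach) \<Rightarrow> nat \<Rightarrow> 'a"
  where "dft s N x k = (1 / sqrt (real N)) *\<^sub>R (\<Sum>j<N. cis (s * (2 * pi * (real j * real k / real N))) *\<^sub>C x j)"

lemma sum_lessThan_add: "(\<Sum>j<m + n. f j) = (\<Sum>j<m. f j) + (\<Sum>j<n. f (m + j))" for n :: nat
  by (induction n) (auto simp: add_ac)

lemma scaleC_scaleR: "c *\<^sub>C r *\<^sub>R (v :: 'a :: complex_banach) = r *\<^sub>R c *\<^sub>C v"
  by (simp add: scaleC_of_real[symmetric] scaleC_scaleC mult.commute)

text \<open>The Cooley-Tukey recursion (decimation in frequency): the coefficients of even and odd index are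
transforms of half the size, of sums and of twisted differences.\<close>

lemma dft_radix_two:
  fixes x :: "nat \<Rightarrow> 'a :: complex_banach"
  assumes s: "s = 1 \<or> s = - 1" and M: "0 < M"
  shows "dft s (2 * M) x (2 * k + (if b then 1 else 0)) =
    dft s M (\<lambda>j. cis (if b then s * (2 * pi * (real j / real (2 * M))) else 0) *\<^sub>C
      (1 / sqrt 2) *\<^sub>R (if b then x j - x (M + j) else x j + x (M + j))) k"
proof -
  let ?w = "\<lambda>j. cis (s * (2 * pi * (real j * real (2 * k + (if b then 1 else 0)) / real (2 * M))))"
  let ?v = "\<lambda>j. cis (s * (2 * pi * (real j * real k / real M)))"
  let ?t = "\<lambda>j. cis (if b then s * (2 * pi * (real j / real (2 * M))) else 0)"
  have w: "?w j = ?v j * ?t j" for j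
    using M by (auto simp: cis_mult field_simps intro!: arg_cong[where f = cis])
  have wM: "?w (M + j) = (if b then - 1 else 1) * (?v j * ?t j)" for j
  proof -
    have "s * (2 * pi * (real (M + j) * real (2 * k + (if b then 1 else 0)) / real (2 * M)))
      = s * (2 * pi * real k) + (if b then s * pi else 0) +
        s * (2 * pi * (real j * real (2 * k + (if b then 1 else 0)) / real (2 * M)))"
      using M by (auto simp: field_simps)
    then have "?w (M + j) = cis (s * (2 * pi * real k)) * cis (if b then s * pi else 0) * ?w j"
      by (simp only: cis_mult[symmetric])
    moreover have "cis (if b then s * pi else 0) = (if b then - 1 else 1)"
      using s by (auto simp: cis.ctr complex_eq_iff)
    ultimately show ?thesis using s by (simp only: cis_eq_one_of_nat w mult_1 mult_1_right)
  qed
  have "(\<Sum>j<2 * M. ?w j *\<^sub>C x j) = (\<Sum>j<M. ?w j *\<^sub>C x j) + (\<Sum>j<M. ?w (M + j) *\<^sub>C x (M + j))"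
    by (simp only: mult_2 sum_lessThan_add)
  also have "\<dots> = (\<Sum>j<M. ?v j *\<^sub>C ?t j *\<^sub>C (if b then x j - x (M + j) else x j + x (M + j)))"
    unfolding sum.distrib[symmetric]
  proof (intro sum.cong refl)
    fix j
    show "?w j *\<^sub>C x j + ?w (M + j) *\<^sub>C x (M + j)
        = ?v j *\<^sub>C ?t j *\<^sub>C (if b then x j - x (M + j) else x j + x (M + j))"
      unfolding wM w[of j]
      by (auto simp: scaleC_scaleC scaleC.diff_right scaleC_add_right scaleC.minus_left)
  qed
  finally show ?thesis
    unfolding dft_def using M
    by (simp add: scaleC_scaleR scaleR_sum_right[symmetric] real_sqrt_mult)
qed

text \<open>Gaussian norms are invariant under all unitary matrices; for the Fourier matrix of size \<open>2\<^sup>m\<close> the fast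
Fourier transform is an explicit factorisation into butterflies and phases, each of which is known to
be harmless. The second index \<open>r\<close> is a spectator. It makes the induction work, since one step replaces a
transform of size \<open>2M\<close> by two simultaneous transforms of size \<open>M\<close>, distinguished by one more bit of \<open>r\<close>.\<close>

lemma gn_dft_product:
  fixes x :: "nat \<times> bool list \<Rightarrow> 'a :: complex_banach"
  assumes s: "s = 1 \<or> s = - 1" and R: "finite R"
  shows "gn ({..<2 ^ m} \<times> R) (\<lambda>(k, r). dft s (2 ^ m) (\<lambda>j. x (j, r)) k) = gn ({..<2 ^ m} \<times> R) x"
  using R
proof (induction m arbitrary: x R)
  case 0
  show ?case by (rule gn_cong) (auto simp: dft_def)
next
  case (Suc m)
  define M where "M = (2 :: nat) ^ m"
  have M: "0 < M" "2 ^ Suc m = 2 * M" by (auto simp: M_def)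
  define P where "P = {..<M} \<times> R"
  define R' where "R' = (\<lambda>(b, r). b # r) ` (UNIV \<times> R)"
  have fin: "finite P" "finite R'" "finite (P \<times> (UNIV :: bool set))"
    using Suc.prems by (auto simp: P_def R'_def)
  \<comment> \<open>three numberings of the pairs: lower and upper half in time, parity moved to the spectator, and
    even and odd frequencies\<close>
  define e1 :: "(nat \<times> bool list) \<times> bool \<Rightarrow> nat \<times> bool list"
    where "e1 = (\<lambda>((j, r), b). (if b then M + j else j, r))"
  define e2 :: "(nat \<times> bool list) \<times> bool \<Rightarrow> nat \<times> bool list"
    where "e2 = (\<lambda>((j, r), b). (j, b # r))"
  define e3 :: "(nat \<times> bool list) \<times> bool \<Rightarrow> nat \<times> bool list"
    where "e3 = (\<lambda>((k, r), b). (2 * k + (if b then 1 else 0), r))"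
  have inj: "inj_on e1 (P \<times> UNIV)" "inj_on e2 (P \<times> UNIV)" "inj_on e3 (P \<times> UNIV)"
    unfolding inj_on_def e1_def e2_def e3_def P_def by (auto split: if_splits; presburger)+
  have im1: "e1 ` (P \<times> UNIV) = {..<2 * M} \<times> R"
  proof (intro equalityI subsetI)
    fix q assume "q \<in> {..<2 * M} \<times> R"
    then obtain j r where q: "q = (j, r)" "j < 2 * M" "r \<in> R" by auto
    show "q \<in> e1 ` (P \<times> UNIV)"
    proof (cases "j < M")
      case True
      then show ?thesis using q by (intro image_eqI[of _ _ "((j, r), False)"]) (auto simp: e1_def P_def)
    next
      case False
      then show ?thesis using q by (intro image_eqI[of _ _ "((j - M, r), True)"]) (auto simp: e1_def P_def)
    qed
  qed (auto simp: e1_def P_def)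
  have im2: "e2 ` (P \<times> UNIV) = {..<M} \<times> R'"
    by (auto simp: e2_def P_def R'_def image_iff)
  have im3: "e3 ` (P \<times> UNIV) = {..<2 * M} \<times> R"
  proof (intro equalityI subsetI)
    fix q assume "q \<in> {..<2 * M} \<times> R"
    then obtain j r where q: "q = (j, r)" "j < 2 * M" "r \<in> R" by auto
    have "j = 2 * (j div 2) + (if odd j then 1 else 0)" by auto
    then show "q \<in> e3 ` (P \<times> UNIV)"
      using q by (intro image_eqI[of _ _ "((j div 2, r), odd j)"]) (auto simp: e3_def P_def)
  qed (auto simp: e3_def P_def)
  define y where "y = (\<lambda>(p, b). (1 / sqrt 2) *\<^sub>R (if b then x (e1 (p, False)) - x (e1 (p, True))
      else x (e1 (p, False)) + x (e1 (p, True))))"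
  define u where "u = (\<lambda>((j, r :: bool list), b). cis (if b then s * (2 * pi * (real j / real (2 * M))) else 0))"
  define z where "z = (\<lambda>(j, l). u ((j, tl l), hd l) *\<^sub>C y ((j, tl l), hd l))"
  have "gn ({..<2 * M} \<times> R) x = gn (P \<times> UNIV) (\<lambda>q. x (e1 q))"
    by (simp add: gn_reindex[OF fin(3) inj(1)] im1)
  also have "\<dots> = gn (P \<times> UNIV) y"
    unfolding y_def by (rule gn_butterfly[OF fin(1), symmetric])
  also have "\<dots> = gn (P \<times> UNIV) (\<lambda>q. u q *\<^sub>C y q)"
    by (rule gn_phase[OF fin(3), symmetric]) (auto simp: u_def)
  also have "\<dots> = gn (P \<times> UNIV) (\<lambda>q. z (e2 q))"
    by (intro gn_cong) (auto simp: z_def e2_def)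
  also have "\<dots> = gn ({..<M} \<times> R') z"
    by (simp add: gn_reindex[OF fin(3) inj(2)] im2)
  also have "\<dots> = gn ({..<M} \<times> R') (\<lambda>(k, l). dft s M (\<lambda>j. z (j, l)) k)"
    unfolding M_def by (rule Suc.IH[OF fin(2), symmetric])
  also have "\<dots> = gn (P \<times> UNIV) (\<lambda>q. (\<lambda>(k, l). dft s M (\<lambda>j. z (j, l)) k) (e2 q))"
    by (simp only: gn_reindex[OF fin(3) inj(2)] im2)
  also have "\<dots> = gn (P \<times> UNIV) (\<lambda>q. (\<lambda>(k, r). dft s (2 * M) (\<lambda>j. x (j, r)) k) (e3 q))"
  proof (rule gn_cong, clarify)
    fix k r b
    show "(\<lambda>(k, l). dft s M (\<lambda>j. z (j, l)) k) (e2 ((k, r), b)) =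
      (\<lambda>(k, r). dft s (2 * M) (\<lambda>j. x (j, r)) k) (e3 ((k, r), b))"
      using dft_radix_two[OF s M(1), of "\<lambda>j. x (j, r)" k b]
      by (cases b) (simp_all add: e2_def e3_def z_def u_def y_def e1_def)
  qed
  also have "\<dots> = gn ({..<2 * M} \<times> R) (\<lambda>(k, r). dft s (2 * M) (\<lambda>j. x (j, r)) k)"
    by (simp only: gn_reindex[OF fin(3) inj(3)] im3)
  finally show ?case by (simp only: M(2))
qed

lemma gn_dft:
  fixes x :: "nat \<Rightarrow> 'a :: complex_banach"
  assumes s: "s = 1 \<or> s = - 1"
  shows "gn {..<2 ^ m} (dft s (2 ^ m) x) = gn {..<2 ^ m} x"
proof -
  have re: "gn {..<2 ^ m} y = gn ({..<2 ^ m} \<times> {[] :: bool list}) (\<lambda>(j, r). y j)" for y :: "nat \<Rightarrow> 'a"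
  proof -
    have "gn {..<2 ^ m} (\<lambda>j. (\<lambda>(j, r). y j) (j, [] :: bool list)) =
      gn ((\<lambda>j. (j, [])) ` {..<2 ^ m}) (\<lambda>(j, r :: bool list). y j)"
      by (rule gn_reindex) (auto simp: inj_on_def)
    moreover have "(\<lambda>j. (j, [] :: bool list)) ` {..<(2 :: nat) ^ m} = {..<2 ^ m} \<times> {[]}" by auto
    ultimately show ?thesis by simp
  qed
  show ?thesis
    using gn_dft_product[OF s, of "{[]}" m "\<lambda>(j, r). x j"] by (simp add: re)
qed

text \<open>A constant family is the transform of a family with a single nonzero entry.\<close>

lemma gn_constant:
  fixes v :: "'a :: complex_banach"
  shows "gn {..<(2 :: nat) ^ m} (\<lambda>_. (1 / sqrt (2 ^ m)) *\<^sub>R v) = norm v"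
proof -
  define x where "x = (\<lambda>j :: nat. if j = 0 then v else 0)"
  have "dft 1 (2 ^ m) x = (\<lambda>_. (1 / sqrt (2 ^ m)) *\<^sub>R v)"
  proof
    fix k
    have "(\<Sum>j<2 ^ m. cis (1 * (2 * pi * (real j * real k / real (2 ^ m)))) *\<^sub>C x j) =
      (\<Sum>j<(2 :: nat) ^ m. if j = 0 then v else 0)"
      by (intro sum.cong) (auto simp: x_def)
    then show "dft 1 (2 ^ m) x k = (1 / sqrt (2 ^ m)) *\<^sub>R v" by (simp add: dft_def)
  qed
  then have "gn {..<(2 :: nat) ^ m} (\<lambda>_. (1 / sqrt (2 ^ m)) *\<^sub>R v) = gn {..<2 ^ m} x"
    using gn_dft[of 1 m x] by simp
  also have "\<dots> = gn {0} x"
    by (rule gn_superset) (auto simp: x_def)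
  finally show ?thesis by (simp add: gn_single x_def)
qed

text \<open>The left-hand side is the Fourier coefficient at frequency zero.\<close>

lemma norm_mean_le_gn:
  fixes x :: "nat \<Rightarrow> 'a :: complex_banach"
  shows "norm ((1 / sqrt (2 ^ m)) *\<^sub>R (\<Sum>j<2 ^ m. x j)) \<le> gn {..<2 ^ m} x"
proof -
  have "gn {0} (dft 1 (2 ^ m) x) \<le> gn {..<2 ^ m} (dft 1 (2 ^ m) x)"
    by (rule gn_subset) auto
  then show ?thesis by (simp add: gn_dft gn_single dft_def)
qed

section \<open>Gamma-bounds\<close>

lemma gn_le_sum_norm:
  fixes x :: "'i \<Rightarrow> 'a :: complex_banach"
  assumes I: "finite I" shows "gn I x \<le> (\<Sum>i\<in>I. norm (x i))"
proof -
  have "gn I x = gn I (\<lambda>i. \<Sum>k\<in>I. if i = k then x i else 0)"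
    using I by (intro gn_cong) simp
  also have "\<dots> \<le> (\<Sum>k\<in>I. gn I (\<lambda>i. if i = k then x i else 0))"
    by (rule gn_sum[OF I I])
  also have "\<dots> = (\<Sum>k\<in>I. norm (x k))"
  proof (rule sum.cong)
    fix k assume "k \<in> I"
    then have "gn I (\<lambda>i. if i = k then x i else 0) = gn {k} (\<lambda>i. if i = k then x i else 0)"
      by (intro gn_superset) (use I in auto)
    then show "gn I (\<lambda>i. if i = k then x i else 0) = norm (x k)" by (simp add: gn_single)
  qed simp
  finally show ?thesis .
qed

lemma gn_diff_le:
  fixes x y :: "'i \<Rightarrow> 'a :: complex_banach"
  assumes I: "finite I"
  shows "gn I x \<le> gn I y + (\<Sum>i\<in>I. norm (x i - y i))"
  using gn_triangle[OF I, of y "\<lambda>i. x i - y i"] gn_le_sum_norm[OF I, of "\<lambda>i. x i - y i"] by simp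

lemma gn_le_lim:
  fixes x :: "'i \<Rightarrow> 'a :: complex_banach"
  assumes I: "finite I" and lim: "\<And>i. i \<in> I \<Longrightarrow> (\<lambda>m. y m i) \<longlonglongrightarrow> x i"
    and le: "eventually (\<lambda>m. gn I (y m) \<le> C) sequentially"
  shows "gn I x \<le> C"
proof -
  have "(\<lambda>m. C + (\<Sum>i\<in>I. norm (x i - y m i))) \<longlonglongrightarrow> C + (\<Sum>i\<in>I. norm (x i - x i))"
    by (intro tendsto_intros lim)
  then have "(\<lambda>m. C + (\<Sum>i\<in>I. norm (x i - y m i))) \<longlonglongrightarrow> C" by simp
  moreover have "eventually (\<lambda>m. gn I x \<le> C + (\<Sum>i\<in>I. norm (x i - y m i))) sequentially"
    using le
  proof eventually_elim
    case (elim m)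
    then show ?case using gn_diff_le[OF I, of x "y m"] by linarith
  qed
  ultimately show ?thesis by (rule tendsto_lowerbound) simp
qed

text \<open>\<open>\<gamma>\<close>-boundedness with an explicit constant. The definition runs over initial segments of the natural
numbers to agree with \<open>gamma_bounded\<close>; \<open>has_gamma_boundD\<close> then extends it to all finite families.\<close>

definition has_gamma_bound :: "real \<Rightarrow> ('a :: complex_banach \<Rightarrow>\<^sub>L 'a) set \<Rightarrow> bool"
  where "has_gamma_bound C \<T> \<longleftrightarrow> 0 \<le> C \<and>
    (\<forall>(N :: nat) T x. (\<forall>n<N. T n \<in> \<T>) \<longrightarrow> gn {..<N} (\<lambda>n. (T n) (x n)) \<le> C * gn {..<N} x)"

lemma gamma_bounded_iff:
  fixes \<T> :: "('a :: complex_banach \<Rightarrow>\<^sub>L 'a) set"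
  assumes "complex_gaussian_sequence M \<gamma>"
  shows "gamma_bounded M \<gamma> \<T> \<longleftrightarrow> (\<exists>C. has_gamma_bound C \<T>)"
  unfolding gamma_bounded_def has_gamma_bound_def gauss_norm_eq_gn[OF assms] ..

lemma has_gamma_boundD:
  assumes "has_gamma_bound C \<T>" "finite I" "\<And>i. i \<in> I \<Longrightarrow> T i \<in> \<T>"
  shows "gn I (\<lambda>i. (T i) (x i)) \<le> C * gn I x"
proof -
  obtain h where h: "bij_betw h {..<card I} I"
    using assms(2) by (metis bij_betw_from_nat_into_finite)
  have re: "gn {..<card I} (\<lambda>n. y (h n)) = gn I y" for y :: "_ \<Rightarrow> 'a"
    using h gn_reindex[of "{..<card I}" h y] by (auto simp: bij_betw_def)
  have "gn {..<card I} (\<lambda>n. (T (h n)) (x (h n))) \<le> C * gn {..<card I} (\<lambda>n. x (h n))"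
  proof -
    have "\<forall>n<card I. T (h n) \<in> \<T>" using h assms(3) by (auto simp: bij_betw_def)
    then show ?thesis
      using assms(1)[unfolded has_gamma_bound_def, THEN conjunct2, THEN spec[of _ "card I"],
          THEN spec[of _ "\<lambda>n. T (h n)"], THEN spec[of _ "\<lambda>n. x (h n)"]] by blast
  qed
  then show ?thesis using re[of "\<lambda>i. (T i) (x i)"] re[of x] by simp
qed

lemma gamma_bound_subset: "has_gamma_bound C \<T> \<Longrightarrow> \<S> \<subseteq> \<T> \<Longrightarrow> has_gamma_bound C \<S>"
  unfolding has_gamma_bound_def by blast

lemma gamma_bound_norm:
  assumes "has_gamma_bound C \<T>" "S \<in> \<T>" shows "norm S \<le> C"
proof (rule norm_blinfun_bound)
  show "0 \<le> C" using assms by (simp add: has_gamma_bound_def)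
  show "norm (S v) \<le> C * norm v" for v
    using has_gamma_boundD[OF assms(1), of "{()}" "\<lambda>_. S" "\<lambda>_. v"] assms(2) by (simp add: gn_single)
qed

lemma gamma_bound_scale:
  assumes "has_gamma_bound C \<T>" "0 \<le> K"
  shows "has_gamma_bound (K * C) {c *\<^sub>C S | c S. cmod c \<le> K \<and> S \<in> \<T>}"
  unfolding has_gamma_bound_def
proof (intro conjI allI impI)
  show C: "0 \<le> K * C" using assms by (simp add: has_gamma_bound_def)
  fix N :: nat and T :: "nat \<Rightarrow> 'a \<Rightarrow>\<^sub>L 'a" and x :: "nat \<Rightarrow> 'a" assume "\<forall>n<N. T n \<in> {c *\<^sub>C S | c S. cmod c \<le> K \<and> S \<in> \<T>}"
  then obtain c S where cS: "\<And>n. n < N \<Longrightarrow> T n = c n *\<^sub>C S n \<and> cmod (c n) \<le> K \<and> S n \<in> \<T>"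
    by simp metis
  have "gn {..<N} (\<lambda>n. (T n) (x n)) = gn {..<N} (\<lambda>n. c n *\<^sub>C (S n) (x n))"
    using cS by (intro gn_cong) (simp add: blinfun_apply_scaleC)
  also have "\<dots> \<le> K * gn {..<N} (\<lambda>n. (S n) (x n))"
    using cS assms(2) by (intro gn_contract) auto
  also have "\<dots> \<le> K * (C * gn {..<N} x)"
    using cS assms by (intro mult_left_mono has_gamma_boundD) auto
  finally show "gn {..<N} (\<lambda>n. (T n) (x n)) \<le> K * C * gn {..<N} x" by (simp add: mult.assoc)
qed

lemma gamma_bound_compose:
  assumes "has_gamma_bound C \<T>" "has_gamma_bound D \<S>"
  shows "has_gamma_bound (C * D) {T o\<^sub>L S | T S. T \<in> \<T> \<and> S \<in> \<S>}"
  unfolding has_gamma_bound_def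
proof (intro conjI allI impI)
  show "0 \<le> C * D" using assms by (simp add: has_gamma_bound_def)
  fix N :: nat and U :: "nat \<Rightarrow> 'a \<Rightarrow>\<^sub>L 'a" and x :: "nat \<Rightarrow> 'a" assume "\<forall>n<N. U n \<in> {T o\<^sub>L S | T S. T \<in> \<T> \<and> S \<in> \<S>}"
  then obtain T S where TS: "\<And>n. n < N \<Longrightarrow> U n = T n o\<^sub>L S n \<and> T n \<in> \<T> \<and> S n \<in> \<S>"
    by simp metis
  have "gn {..<N} (\<lambda>n. (U n) (x n)) = gn {..<N} (\<lambda>n. (T n) ((S n) (x n)))"
    using TS by (intro gn_cong) simp
  also have "\<dots> \<le> C * gn {..<N} (\<lambda>n. (S n) (x n))"
    using TS by (intro has_gamma_boundD[OF assms(1)]) auto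
  also have "\<dots> \<le> C * (D * gn {..<N} x)"
    using TS assms(1) by (intro mult_left_mono has_gamma_boundD[OF assms(2)]) (auto simp: has_gamma_bound_def)
  finally show "gn {..<N} (\<lambda>n. (U n) (x n)) \<le> C * D * gn {..<N} x" by (simp add: mult.assoc)
qed

text \<open>The approximants range over sets \<open>\<T> m\<close> that vary with \<open>m\<close>, because the means of different lengths that
approximate an integral form different sets.\<close>

lemma gamma_bound_limit:
  fixes \<S> :: "('a :: complex_banach \<Rightarrow>\<^sub>L 'a) set"
  assumes \<T>: "\<And>m :: nat. has_gamma_bound C (\<T> m)"
    and lim: "\<And>S. S \<in> \<S> \<Longrightarrow> \<exists>f. (\<forall>m. f m \<in> \<T> m) \<and> (\<forall>v. (\<lambda>m. (f m) v) \<longlonglongrightarrow> S v)"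
  shows "has_gamma_bound C \<S>"
  unfolding has_gamma_bound_def
proof (intro conjI allI impI)
  show "0 \<le> C" using \<T> by (simp add: has_gamma_bound_def)
  fix N :: nat and S :: "nat \<Rightarrow> 'a \<Rightarrow>\<^sub>L 'a" and x :: "nat \<Rightarrow> 'a" assume "\<forall>n<N. S n \<in> \<S>"
  then have "\<forall>n. \<exists>f. n < N \<longrightarrow> (\<forall>m. f m \<in> \<T> m) \<and> (\<forall>v. (\<lambda>m. (f m) v) \<longlonglongrightarrow> (S n) v)"
    using lim by blast
  then obtain f where f: "\<And>n m. n < N \<Longrightarrow> f n m \<in> \<T> m"
    "\<And>n v. n < N \<Longrightarrow> (\<lambda>m. (f n m) v) \<longlonglongrightarrow> (S n) v"
    by metis
  show "gn {..<N} (\<lambda>n. (S n) (x n)) \<le> C * gn {..<N} x"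
    by (rule gn_le_lim[where y = "\<lambda>m n. (f n m) (x n)"])
      (use f in \<open>auto intro!: always_eventually has_gamma_boundD[OF \<T>]\<close>)
qed

lemma gamma_bound_mean:
  assumes \<T>: "has_gamma_bound C \<T>"
  shows "has_gamma_bound C {(1 / real K) *\<^sub>R (\<Sum>k<K. S k) | S. \<forall>k<K. S k \<in> \<T>}"
  unfolding has_gamma_bound_def
proof (intro conjI allI impI)
  show C: "0 \<le> C" using \<T> by (simp add: has_gamma_bound_def)
  fix N :: nat and U :: "nat \<Rightarrow> 'a \<Rightarrow>\<^sub>L 'a" and x :: "nat \<Rightarrow> 'a"
  assume "\<forall>n<N. U n \<in> {(1 / real K) *\<^sub>R (\<Sum>k<K. S k) | S. \<forall>k<K. S k \<in> \<T>}"
  then obtain S where S: "\<And>n. n < N \<Longrightarrow> U n = (1 / real K) *\<^sub>R (\<Sum>k<K. S n k) \<and> (\<forall>k<K. S n k \<in> \<T>)"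
    by simp metis
  have "gn {..<N} (\<lambda>n. (U n) (x n)) =
      gn {..<N} (\<lambda>n. \<Sum>k<K. (S n k) ((1 / real K) *\<^sub>R x n))"
    using S by (intro gn_cong) (simp add: blinfun.sum_left blinfun.scaleR_left blinfun.scaleR_right scaleR_sum_right)
  also have "\<dots> \<le> (\<Sum>k<K. gn {..<N} (\<lambda>n. (S n k) ((1 / real K) *\<^sub>R x n)))"
    by (rule gn_sum) auto
  also have "\<dots> \<le> (\<Sum>k<K. C * gn {..<N} (\<lambda>n. (1 / real K) *\<^sub>R x n))"
    by (intro sum_mono has_gamma_boundD[OF \<T>]) (use S in auto)
  also have "\<dots> \<le> (\<Sum>k<K. C * (1 / real K * gn {..<N} x))"
    using gn_scale_le[of "{..<N}" "of_real (1 / real K)" x] C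
    by (intro sum_mono mult_left_mono) (auto simp: scaleC_of_real simp del: of_real_divide)
  also have "\<dots> \<le> C * gn {..<N} x" using C by (cases "K = 0") auto
  finally show "gn {..<N} (\<lambda>n. (U n) (x n)) \<le> C * gn {..<N} x" .
qed

section \<open>Semigroups and truncated Laplace transforms\<close>

text \<open>The form of a one-sided derivative in which generators of semigroups are defined.\<close>

lemma has_vector_derivative_at_right_limit:
  fixes f :: "real \<Rightarrow> 'a :: real_normed_vector"
  assumes "(f has_vector_derivative D) (at 0 within {0..b})" "0 < b"
  shows "((\<lambda>h. (f h - f 0) /\<^sub>R h) \<longlongrightarrow> D) (at_right 0)"
proof -
  have "((\<lambda>y. norm ((f y - f 0) - (y - 0) *\<^sub>R D) / norm (y - 0)) \<longlongrightarrow> 0) (at_right 0)"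
    using assms at_within_Icc_at_right[OF assms(2)]
    by (simp add: has_vector_derivative_def has_derivative_iff_norm)
  moreover have "eventually (\<lambda>y. norm ((f y - f 0) - (y - 0) *\<^sub>R D) / norm (y - 0) =
      norm ((f y - f 0) /\<^sub>R y - D)) (at_right (0::real))"
    unfolding eventually_at_filter
  proof (intro always_eventually allI impI)
    fix y :: real assume "y \<noteq> 0" "y \<in> {0<..}"
    then have "(f y - f 0) /\<^sub>R y - D = ((f y - f 0) - y *\<^sub>R D) /\<^sub>R y"
      by (simp add: scaleR_diff_right)
    then show "norm ((f y - f 0) - (y - 0) *\<^sub>R D) / norm (y - 0) = norm ((f y - f 0) /\<^sub>R y - D)"
      using \<open>y \<in> {0<..}\<close> by (simp add: divide_inverse mult.commute)
  qed
  ultimately have "((\<lambda>y. norm ((f y - f 0) /\<^sub>R y - D)) \<longlongrightarrow> 0) (at_right 0)"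
    by (simp only: tendsto_cong)
  then have "((\<lambda>y. (f y - f 0) /\<^sub>R y - D) \<longlongrightarrow> 0) (at_right 0)"
    by (rule tendsto_norm_zero_cancel)
  then show ?thesis by (rule Lim_null[THEN iffD2])
qed

lemma Riemann_sum_error:
  fixes g :: "real \<Rightarrow> 'a :: banach"
  assumes g: "continuous_on {0..1} g" and N: "0 < N"
    and e: "\<And>s t. \<lbrakk>s \<in> {0..1}; t \<in> {0..1}; \<bar>s - t\<bar> \<le> 1 / real N\<rbrakk> \<Longrightarrow> norm (g s - g t) \<le> e"
  shows "norm (integral {0..1} g - (1 / real N) *\<^sub>R (\<Sum>j<N. g (real j / real N))) \<le> e"
proof -
  let ?a = "\<lambda>j. real j / real N"
  have a: "?a j \<le> ?a (Suc j)" "0 \<le> ?a j" "?a (Suc j) - ?a j = 1 / real N" for j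
    using N by (auto simp: field_simps)
  have a1: "?a j \<le> 1" if "j \<le> N" for j using N that by (auto simp: field_simps)
  have split: "integral {0..?a n} g = (\<Sum>j<n. integral {?a j..?a (Suc j)} g)" if "n \<le> N" for n
    using that
  proof (induction n)
    case (Suc n)
    have "integral {0..?a n} g + integral {?a n..?a (Suc n)} g = integral {0..?a (Suc n)} g"
      by (rule Henstock_Kurzweil_Integration.integral_combine)
        (use a a1[OF Suc.prems] in \<open>auto intro!: integrable_continuous_real continuous_on_subset[OF g]\<close>)
    then show ?case using Suc by simp
  qed simp
  have piece: "norm (integral {?a j..?a (Suc j)} g - (1 / real N) *\<^sub>R g (?a j)) \<le> e * (1 / real N)"
    if j: "j < N" for j
  proof -
    have c: "continuous_on {?a j..?a (Suc j)} g"
      by (rule continuous_on_subset[OF g]) (use a a1[of "Suc j"] j in auto)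
    have "integral {?a j..?a (Suc j)} (\<lambda>t. g t - g (?a j)) =
        integral {?a j..?a (Suc j)} g - (1 / real N) *\<^sub>R g (?a j)"
      using a(1,3)[of j] integrable_continuous_real[OF c] by (subst integral_diff) auto
    moreover have "norm (integral {?a j..?a (Suc j)} (\<lambda>t. g t - g (?a j))) \<le> e * (?a (Suc j) - ?a j)"
    proof (rule integral_bound[OF a(1)])
      show "continuous_on {?a j..?a (Suc j)} (\<lambda>t. g t - g (?a j))"
        by (intro continuous_intros c)
      fix t assume t: "t \<in> {?a j..?a (Suc j)}"
      have t': "?a j \<le> t" "t \<le> ?a (Suc j)" using t unfolding atLeastAtMost_iff by blast+
      have "0 \<le> t" "t \<le> 1" "\<bar>t - ?a j\<bar> \<le> 1 / real N"
        using t' a(2,3)[of j] a1[of "Suc j"] j by linarith+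
      then show "norm (g t - g (?a j)) \<le> e"
        using a(2)[of j] a1[of j] j by (intro e) auto
    qed
    ultimately show ?thesis using a(3)[of j] by simp
  qed
  have "integral {0..1} g - (1 / real N) *\<^sub>R (\<Sum>j<N. g (?a j)) =
      (\<Sum>j<N. integral {?a j..?a (Suc j)} g - (1 / real N) *\<^sub>R g (?a j))"
    using split[of N] N by (simp add: sum_subtractf scaleR_sum_right)
  also have "norm \<dots> \<le> (\<Sum>j<N. e * (1 / real N))"
  proof (rule sum_norm_le)
    fix j assume "j \<in> {..<N}"
    then show "norm (integral {?a j..?a (Suc j)} g - (1 / real N) *\<^sub>R g (?a j)) \<le> e * (1 / real N)"
      by (intro piece) simp
  qed
  also have "\<dots> = e" using N by simp
  finally show ?thesis .
qed

lemma Riemann_sums_tendsto: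
  fixes g :: "real \<Rightarrow> 'a :: banach"
  assumes g: "continuous_on {0..1} g"
  shows "(\<lambda>N. (1 / real N) *\<^sub>R (\<Sum>j<N. g (real j / real N))) \<longlonglongrightarrow> integral {0..1} g"
proof (rule LIMSEQ_I)
  fix e :: real assume "0 < e"
  then have e: "0 < e / 2" by simp
  have "uniformly_continuous_on {0..1} g"
    using g by (rule compact_uniformly_continuous) simp
  then obtain d where d: "0 < d" "\<And>s t. \<lbrakk>s \<in> {0..1}; t \<in> {0..1}; dist s t < d\<rbrakk> \<Longrightarrow> dist (g s) (g t) < e / 2"
    using e unfolding uniformly_continuous_on_def by metis
  obtain N0 where N0: "1 / d < real N0" using reals_Archimedean2 by blast
  have "norm ((1 / real N) *\<^sub>R (\<Sum>j<N. g (real j / real N)) - integral {0..1} g) < e" if "N0 \<le> N" for N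
  proof -
    have N: "1 / d < real N" using N0 that by linarith
    then have "0 < real N" using d(1) by (meson divide_pos_pos less_trans zero_less_one)
    then have lt: "1 / real N < d" using N d(1) by (simp add: field_simps)
    have "norm (integral {0..1} g - (1 / real N) *\<^sub>R (\<Sum>j<N. g (real j / real N))) \<le> e / 2"
      by (rule Riemann_sum_error[OF g])
        (use d(2) lt \<open>0 < real N\<close> in \<open>auto simp: dist_norm intro!: less_imp_le\<close>)
    then show ?thesis using \<open>0 < e\<close> by (simp add: norm_minus_commute)
  qed
  then show "\<exists>no. \<forall>n\<ge>no. norm ((1 / real n) *\<^sub>R (\<Sum>j<n. g (real j / real n)) - integral {0..1} g) < e"
    by blast
qed

lemma is_resolvent_unique:
  assumes "is_resolvent A z R" "is_resolvent A z S" shows "R = S"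
proof (rule blinfun_eqI)
  fix x
  obtain y where y: "A (R x) = Some y" "z *\<^sub>C R x - y = x"
    using assms(1) unfolding is_resolvent_def by blast
  then have "S (z *\<^sub>C R x - y) = R x"
    using assms(2) unfolding is_resolvent_def by blast
  then show "R x = S x" using y by simp
qed

lemma resolvent_eqI: "is_resolvent A z R \<Longrightarrow> resolvent z A = R"
  unfolding resolvent_def by (rule the_equality) (auto intro: is_resolvent_unique)

lemma is_resolvent_resolvent:
  assumes "z \<notin> spectrum A" shows "is_resolvent A z (resolvent z A)"
  using assms resolvent_eqI by (fastforce simp: spectrum_def resolvent_set_def)

lemma resolvent_identity:
  assumes R: "is_resolvent A w R" and S: "is_resolvent A z S"
  shows "R u = S u + (z - w) *\<^sub>C R (S u)"
proof -
  define p where "p = S u"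
  obtain y where y: "A p = Some y" "z *\<^sub>C p - y = u"
    using S unfolding is_resolvent_def p_def by blast
  have "R (w *\<^sub>C p - y) = p"
    using R y unfolding is_resolvent_def by blast
  moreover have "w *\<^sub>C p - y = u - (z - w) *\<^sub>C p"
    unfolding y(2)[symmetric] by (simp add: scaleC.diff_left)
  ultimately have "R u - (z - w) *\<^sub>C R p = p"
    using R by (simp add: is_resolvent_def complex_ops_def blinfun.diff_right)
  then show ?thesis unfolding p_def[symmetric] by (simp add: algebra_simps)
qed

locale generated_semigroup =
  fixes A :: "'a :: complex_banach \<rightharpoonup> 'a" and T :: "real \<Rightarrow> 'a \<Rightarrow>\<^sub>L 'a" and C :: real
  assumes generates: "neg_generates A T"
    and locally_bounded: "\<And>t. \<lbrakk>0 \<le> t; t \<le> 1\<rbrakk> \<Longrightarrow> norm (T t) \<le> C"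
begin

lemma semigroup: "C0_semigroup T"
  using generates by (simp add: neg_generates_def)

lemma T_zero: "T 0 = id_blinfun"
  using semigroup by (simp add: C0_semigroup_def)

lemma T_add: "0 \<le> s \<Longrightarrow> 0 \<le> t \<Longrightarrow> T (s + t) = T s o\<^sub>L T t"
  using semigroup by (simp add: C0_semigroup_def)

lemma T_add_apply: "0 \<le> s \<Longrightarrow> 0 \<le> t \<Longrightarrow> (T (s + t)) x = (T s) ((T t) x)"
  by (simp add: T_add)

lemma T_complex_ops: "0 \<le> t \<Longrightarrow> T t \<in> complex_ops"
  using semigroup by (simp add: C0_semigroup_def)

lemma T_scaleC: "0 \<le> t \<Longrightarrow> (T t) (c *\<^sub>C x) = c *\<^sub>C (T t) x"
  using T_complex_ops by (simp add: complex_ops_def)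

lemma T_right_continuous: "((\<lambda>t. (T t) x) \<longlongrightarrow> x) (at_right 0)"
  using semigroup by (simp add: C0_semigroup_def)

lemma C_nonneg: "0 \<le> C"
  using locally_bounded[of 0] norm_ge_zero[of "T 0"] by linarith

lemma T_bounded_on: "\<exists>B\<ge>0. \<forall>t\<in>{0..real n}. norm (T t) \<le> B"
proof (induction n)
  case 0
  then show ?case using locally_bounded C_nonneg by (intro exI[of _ C]) auto
next
  case (Suc n)
  then obtain B where B: "0 \<le> B" "\<And>t. t \<in> {0..real n} \<Longrightarrow> norm (T t) \<le> B" by blast
  have "norm (T t) \<le> max B (B * C)" if t: "t \<in> {0..real (Suc n)}" for t
  proof (cases "t \<le> real n")
    case False
    then have "T t = T (real n) o\<^sub>L T (t - real n)" using t T_add[of "real n" "t - real n"] by simp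
    then have "norm (T t) \<le> norm (T (real n)) * norm (T (t - real n))"
      by (simp add: norm_blinfun_compose)
    also have "\<dots> \<le> B * C" using B t False by (intro mult_mono locally_bounded) auto
    finally show ?thesis by simp
  qed (use B t in \<open>auto simp: le_max_iff_disj\<close>)
  then show ?case using B(1) by (intro exI[of _ "max B (B * C)"]) auto
qed

text \<open>Right continuity at 0 gives continuity, because the operators \<open>T\<^sub>t\<close> are bounded on bounded intervals.\<close>

lemma T_continuous: "continuous_on {0..real n} (\<lambda>t. (T t) x)"
proof -
  obtain B where B: "0 \<le> B" "\<And>t. t \<in> {0..real n} \<Longrightarrow> norm (T t) \<le> B" using T_bounded_on by blast
  have step: "norm ((T t) x - (T s) x) \<le> B * norm ((T (t - s)) x - x)"
    if "0 \<le> s" "s \<le> t" "t \<le> real n" for s t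
  proof -
    have "(T t) x - (T s) x = (T s) ((T (t - s)) x - x)"
      using T_add_apply[of s "t - s" x] that by (simp add: blinfun.diff_right)
    then have "norm ((T t) x - (T s) x) \<le> norm (T s) * norm ((T (t - s)) x - x)"
      by (simp add: norm_blinfun)
    also have "\<dots> \<le> B * norm ((T (t - s)) x - x)"
      using that by (intro mult_right_mono B) auto
    finally show ?thesis .
  qed
  show ?thesis
    unfolding continuous_on_iff
  proof (intro ballI allI impI)
    fix s e :: real assume s: "s \<in> {0..real n}" and e: "0 < e"
    have "eventually (\<lambda>h. dist ((T h) x) x < e / (B + 1)) (at_right 0)"
      using T_right_continuous e B(1) by (intro tendstoD) auto
    then obtain d where d: "0 < d" "\<And>h. 0 < h \<Longrightarrow> h < d \<Longrightarrow> norm ((T h) x - x) < e / (B + 1)"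
      unfolding eventually_at_right_field by (auto simp: dist_norm)
    have d': "norm ((T h) x - x) < e / (B + 1)" if "0 \<le> h" "h < d" for h
      using d that T_zero e B(1) by (cases "h = 0") auto
    have "dist ((T t) x) ((T s) x) < e" if t: "t \<in> {0..real n}" "dist t s < d" for t
    proof -
      have "norm ((T t) x - (T s) x) \<le> B * norm ((T \<bar>t - s\<bar>) x - x)"
        using step[of s t] step[of t s] s t by (cases "s \<le> t") (auto simp: norm_minus_commute)
      also have "\<dots> \<le> B * (e / (B + 1))"
        using d'[of "\<bar>t - s\<bar>"] t(2) B(1) by (intro mult_left_mono) (auto simp: dist_real_def)
      also have "\<dots> < e" using e B(1) by (simp add: field_simps)
      finally show ?thesis by (simp add: dist_norm)
    qed
    then show "\<exists>d>0. \<forall>t\<in>{0..real n}. dist t s < d \<longrightarrow> dist ((T t) x) ((T s) x) < e"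
      using d(1) by blast
  qed
qed

definition orbit :: "complex \<Rightarrow> 'a \<Rightarrow> real \<Rightarrow> 'a"
  where "orbit z x t = exp (z * of_real t) *\<^sub>C (T t) x"

lemma orbit_continuous: "continuous_on {0..real n} (orbit z x)"
  unfolding orbit_def by (intro scaleC.continuous_on continuous_intros T_continuous)

lemma orbit_continuous_on: "0 \<le> a \<Longrightarrow> continuous_on {a..b} (orbit z x)"
  by (rule continuous_on_subset[OF orbit_continuous[of "nat \<lceil>b\<rceil>"]])
    (use real_nat_ceiling_ge[of b] in \<open>fastforce intro: order_trans\<close>)

lemma orbit_integrable: "0 \<le> a \<Longrightarrow> orbit z x integrable_on {a..b}"
  by (intro integrable_continuous_real orbit_continuous_on)

lemma T_orbit:
  assumes "0 \<le> h" "0 \<le> t"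
  shows "(T h) (orbit z x t) = exp (- z * of_real h) *\<^sub>C orbit z x (t + h)"
proof -
  have "exp (z * of_real t) = exp (- z * of_real h) * exp (z * of_real (t + h))"
    by (simp add: exp_add[symmetric] algebra_simps)
  then show ?thesis
    using T_add_apply[of h t x] assms by (simp add: orbit_def T_scaleC scaleC_scaleC add.commute)
qed

text \<open>The operator \<open>P\<^sub>z\<close>, the Laplace transform of the semigroup truncated to \<open>[0, 1]\<close>. Along
\<open>z + 2\<pi>ik\<close> its values are the Fourier coefficients of an orbit.\<close>

definition local_transform :: "complex \<Rightarrow> 'a \<Rightarrow>\<^sub>L 'a"
  where "local_transform z = Blinfun (\<lambda>x. integral {0..1} (orbit z x))"

lemma local_transform_apply: "(local_transform z) x = integral {0..1} (orbit z x)"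
proof -
  have "bounded_linear (\<lambda>x. integral {0..1} (orbit z x))"
  proof (rule bounded_linear_intro[where K = "exp \<bar>Re z\<bar> * C"])
    fix x y r
    have "integral {0..1} (orbit z (x + y)) = integral {0..1} (\<lambda>t. orbit z x t + orbit z y t)"
      by (intro integral_cong) (simp add: orbit_def blinfun.add_right scaleC_add_right)
    then show "integral {0..1} (orbit z (x + y)) = integral {0..1} (orbit z x) + integral {0..1} (orbit z y)"
      by (simp add: integral_add orbit_integrable)
    have "integral {0..1} (orbit z (r *\<^sub>R x)) = integral {0..1} (\<lambda>t. r *\<^sub>R orbit z x t)"
      by (intro integral_cong) (simp add: orbit_def blinfun.scaleR_right scaleC_scaleR)
    then show "integral {0..1} (orbit z (r *\<^sub>R x)) = r *\<^sub>R integral {0..1} (orbit z x)"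
      by simp
    have "norm (integral {0..1} (orbit z x)) \<le> (exp \<bar>Re z\<bar> * (C * norm x)) * (1 - 0)"
    proof (rule integral_bound)
      fix t :: real assume t: "t \<in> {0..1}"
      have "norm (orbit z x t) = exp (Re z * t) * norm ((T t) x)"
        by (simp add: orbit_def norm_scaleC)
      also have "\<dots> \<le> exp \<bar>Re z\<bar> * (C * norm x)"
      proof (intro mult_mono)
        have "Re z * t \<le> \<bar>Re z\<bar> * t" using t by (intro mult_right_mono) auto
        also have "\<dots> \<le> \<bar>Re z\<bar> * 1" using t by (intro mult_left_mono) auto
        finally show "exp (Re z * t) \<le> exp \<bar>Re z\<bar>" by simp
        have "norm ((T t) x) \<le> norm (T t) * norm x" by (rule norm_blinfun)
        also have "\<dots> \<le> C * norm x" using t by (intro mult_right_mono locally_bounded) auto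
        finally show "norm ((T t) x) \<le> C * norm x" .
      qed auto
      finally show "norm (orbit z x t) \<le> exp \<bar>Re z\<bar> * (C * norm x)" .
    qed (auto intro: orbit_continuous_on)
    then show "norm (integral {0..1} (orbit z x)) \<le> norm x * (exp \<bar>Re z\<bar> * C)" by (simp add: mult_ac)
  qed
  then show ?thesis unfolding local_transform_def by (simp add: bounded_linear_Blinfun_apply)
qed

lemma local_transform_complex_ops: "local_transform z \<in> complex_ops"
proof -
  have "integral {0..1} (orbit z (c *\<^sub>C x)) = c *\<^sub>C integral {0..1} (orbit z x)" for c x
  proof -
    have "integral {0..1} ((\<lambda>v. c *\<^sub>C v) \<circ> orbit z x) = c *\<^sub>C integral {0..1} (orbit z x)"
      by (rule integral_linear[OF orbit_integrable bounded_linear_scaleC]) simp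
    moreover have "integral {0..1} (orbit z (c *\<^sub>C x)) = integral {0..1} ((\<lambda>v. c *\<^sub>C v) \<circ> orbit z x)"
      by (rule integral_cong) (simp add: orbit_def T_scaleC scaleC_scaleC mult.commute)
    ultimately show ?thesis by simp
  qed
  then show ?thesis by (simp add: complex_ops_def local_transform_apply)
qed

lemma T_local_transform:
  assumes h: "0 \<le> h"
  shows "(T h) ((local_transform z) x) = exp (- z * of_real h) *\<^sub>C integral {h..1 + h} (orbit z x)"
    and "(T h) ((local_transform z) x) = (local_transform z) ((T h) x)"
proof -
  have 1: "(T h) ((local_transform z) x) = integral {0..1} (\<lambda>t. (T h) (orbit z x t))"
    unfolding local_transform_apply
    using integral_linear[OF orbit_integrable[of 0 z x 1] blinfun.bounded_linear_right[of "T h"]]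
    by (simp add: o_def)
  have "\<dots> = integral {0..1} (\<lambda>t. exp (- z * of_real h) *\<^sub>C orbit z x (t + h))"
    by (rule integral_cong) (use h in \<open>simp add: T_orbit\<close>)
  also have "\<dots> = exp (- z * of_real h) *\<^sub>C integral {0..1} (\<lambda>t. orbit z x (t + h))"
  proof -
    have "(\<lambda>t. orbit z x (t + h)) integrable_on {0..1}"
      by (intro integrable_continuous_real continuous_on_compose2[OF orbit_continuous_on[of 0 "1 + h" z x]] continuous_intros)
        (use h in auto)
    from integral_linear[OF this bounded_linear_scaleC] show ?thesis by (simp add: o_def)
  qed
  also have "integral {0..1} (\<lambda>t. orbit z x (t + h)) = integral {h..1 + h} (orbit z x)"
    using integral_shift_Icc_real[of 0 1 "orbit z x" h] by (simp add: o_def add.commute)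
  finally show "(T h) ((local_transform z) x) = exp (- z * of_real h) *\<^sub>C integral {h..1 + h} (orbit z x)"
    using 1 by simp
  have "integral {0..1} (\<lambda>t. (T h) (orbit z x t)) = integral {0..1} (orbit z ((T h) x))"
  proof (rule integral_cong)
    fix t :: real assume "t \<in> {0..1}"
    then show "(T h) (orbit z x t) = orbit z ((T h) x) t"
      using h T_add_apply[of h t x] T_add_apply[of t h x] by (simp add: orbit_def T_scaleC add.commute)
  qed
  then show "(T h) ((local_transform z) x) = (local_transform z) ((T h) x)"
    using 1 by (simp add: local_transform_apply)
qed

text \<open>Shifting the orbit by \<open>h\<close> moves the window of integration from \<open>[0, 1]\<close> to \<open>[h, 1 + h]\<close>. The derivative
consists of the two boundary terms and of a term from the factor \<open>e\<^bsup>-zh\<^esup>\<close>.\<close>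

lemma local_transform_derivative:
  "((\<lambda>h. ((T h) ((local_transform z) x) - (local_transform z) x) /\<^sub>R h)
    \<longlongrightarrow> orbit z x 1 - x - z *\<^sub>C (local_transform z) x) (at_right 0)"
proof -
  define H where "H = (\<lambda>u. integral {0..u} (orbit z x))"
  have H: "(H has_vector_derivative orbit z x u) (at u within {0..2})" if "u \<in> {0..2}" for u
    unfolding H_def by (rule integral_has_vector_derivative) (use that orbit_continuous_on in auto)
  define K where "K = (\<lambda>h. exp (- z * of_real h) *\<^sub>C (H (1 + h) - H h))"
  have K: "K h = (T h) ((local_transform z) x)" if "h \<in> {0..1}" for h
  proof -
    have "integral {0..h} (orbit z x) + integral {h..1 + h} (orbit z x) = integral {0..1 + h} (orbit z x)"
      by (rule Henstock_Kurzweil_Integration.integral_combine) (use that orbit_integrable in auto)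
    then have "H (1 + h) - H h = integral {h..1 + h} (orbit z x)"
      unfolding H_def by (metis add_diff_cancel_left')
    then show ?thesis using that T_local_transform(1)[of h z x] by (simp add: K_def)
  qed
  have 1: "((H \<circ> (\<lambda>h. 1 + h)) has_vector_derivative 1 *\<^sub>R orbit z x (1 + 0)) (at 0 within {0..1})"
  proof (rule vector_diff_chain_within)
    show "((\<lambda>h. 1 + h) has_vector_derivative 1) (at 0 within {0..1 :: real})"
      by (auto intro!: derivative_eq_intros)
    show "(H has_vector_derivative orbit z x (1 + 0)) (at (1 + 0) within (+) 1 ` {0..1})"
      by (rule has_vector_derivative_within_subset[OF H]) auto
  qed
  have 2: "(H has_vector_derivative orbit z x 0) (at 0 within {0..1})"
    by (rule has_vector_derivative_within_subset[OF H]) auto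
  have 3: "((\<lambda>h. exp (- z * of_real h)) has_vector_derivative (- z * exp (- z * of_real 0))) (at 0 within {0..1 :: real})"
  proof -
    have "((\<lambda>w. exp (- z * w)) has_field_derivative (exp (- z * of_real 0) * (- z))) (at (of_real 0))"
      by (auto intro!: derivative_eq_intros)
    then show ?thesis
      using has_vector_derivative_real_field[of "\<lambda>w. exp (- z * w)" _ 0 "{0..1}"] by (simp add: mult.commute)
  qed
  have "(K has_vector_derivative
      (exp (- z * of_real 0) *\<^sub>C (1 *\<^sub>R orbit z x (1 + 0) - orbit z x 0) +
      (- z * exp (- z * of_real 0)) *\<^sub>C ((H \<circ> (\<lambda>h. 1 + h)) 0 - H 0))) (at 0 within {0..1})"
    using scaleC.has_vector_derivative[OF 3 has_vector_derivative_diff[OF 1 2]] by (simp add: K_def o_def)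
  then have "((\<lambda>h. (K h - K 0) /\<^sub>R h) \<longlongrightarrow> 
      (exp (- z * of_real 0) *\<^sub>C (1 *\<^sub>R orbit z x (1 + 0) - orbit z x 0) +
      (- z * exp (- z * of_real 0)) *\<^sub>C ((H \<circ> (\<lambda>h. 1 + h)) 0 - H 0))) (at_right 0)"
    by (rule has_vector_derivative_at_right_limit) simp
  moreover have "(exp (- z * of_real 0) *\<^sub>C (1 *\<^sub>R orbit z x (1 + 0) - orbit z x 0) +
      (- z * exp (- z * of_real 0)) *\<^sub>C ((H \<circ> (\<lambda>h. 1 + h)) 0 - H 0)) =
    orbit z x 1 - x - z *\<^sub>C (local_transform z) x"
    by (simp add: H_def local_transform_apply orbit_def T_zero scaleC.minus_left)
  moreover have "eventually (\<lambda>h. (K h - K 0) /\<^sub>R h =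
      ((T h) ((local_transform z) x) - (local_transform z) x) /\<^sub>R h) (at_right 0)"
    unfolding eventually_at_right_field using K[of 0] K T_zero by (intro exI[of _ 1]) auto
  ultimately show ?thesis by (simp only: tendsto_cong)
qed

lemma local_transform_in_domain:
  "A ((local_transform z) x) = Some (z *\<^sub>C (local_transform z) x - (orbit z x 1 - x))"
proof -
  have "A p = Some y \<longleftrightarrow> ((\<lambda>t. ((T t) p - p) /\<^sub>R t) \<longlongrightarrow> - y) (at_right 0)" for p y
    using generates unfolding neg_generates_def by blast
  then show ?thesis
    using local_transform_derivative[of z x] by simp
qed

text \<open>The operator \<open>P\<^sub>z\<close> commutes with the semigroup, so that the difference quotients of \<open>x\<close> are mapped to
those of \<open>P\<^sub>z x\<close>.\<close>

lemma local_transform_on_domain: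
  assumes "A x = Some y"
  shows "(local_transform z) (z *\<^sub>C x - y) = orbit z x 1 - x"
proof -
  have "((\<lambda>h. ((T h) x - x) /\<^sub>R h) \<longlongrightarrow> - y) (at_right 0)"
    using assms generates unfolding neg_generates_def by blast
  then have "((\<lambda>h. (local_transform z) (((T h) x - x) /\<^sub>R h))
      \<longlongrightarrow> (local_transform z) (- y)) (at_right 0)"
    by (intro tendsto_intros)
  moreover have "eventually (\<lambda>h. (local_transform z) (((T h) x - x) /\<^sub>R h) =
      ((T h) ((local_transform z) x) - (local_transform z) x) /\<^sub>R h) (at_right 0)"
    unfolding eventually_at_right_field
    by (intro exI[of _ 1]) (simp add: T_local_transform(2) blinfun.diff_right blinfun.scaleR_right)
  ultimately have "((\<lambda>h. ((T h) ((local_transform z) x) - (local_transform z) x) /\<^sub>R h)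
      \<longlongrightarrow> (local_transform z) (- y)) (at_right 0)"
    by (simp only: tendsto_cong)
  from tendsto_unique[OF _ this local_transform_derivative]
  have "(local_transform z) (- y) = orbit z x 1 - x - z *\<^sub>C (local_transform z) x"
    by simp
  then have "(local_transform z) y = z *\<^sub>C (local_transform z) x - (orbit z x 1 - x)"
    by (simp add: blinfun.minus_right minus_equation_iff[of "(local_transform z) y"])
  then show ?thesis
    using local_transform_complex_ops[of z] by (simp add: complex_ops_def blinfun.diff_right)
qed

text \<open>The bridge between resolvents and Fourier coefficients.\<close>

lemma resolvent_local_transform:
  assumes "is_resolvent A z R"
  shows "R (orbit z x 1 - x) = (local_transform z) x"
proof -
  have "R (z *\<^sub>C p - y) = p" if "A p = Some y" for p y
    using assms that unfolding is_resolvent_def by blast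
  from this[OF local_transform_in_domain[of z x]] show ?thesis by simp
qed

end

section \<open>Resolvents along vertical lines\<close>

locale gamma_bounded_semigroup =
  fixes A :: "'a :: complex_banach \<rightharpoonup> 'a" and T :: "real \<Rightarrow> 'a \<Rightarrow>\<^sub>L 'a" and C :: real
  assumes generates': "neg_generates A T"
    and gamma_local: "has_gamma_bound C {T t | t. 0 \<le> t \<and> t \<le> 1}"

sublocale gamma_bounded_semigroup \<subseteq> generated_semigroup A T C
  by unfold_locales (use generates' gamma_bound_norm[OF gamma_local] in auto)

context gamma_bounded_semigroup
begin

text \<open>The operators \<open>e\<^bsup>zt\<^esup> T\<^sub>t\<close> with \<open>0 \<le> t \<le> 1\<close> and \<open>Re z \<le> a\<close> lie in this \<open>\<gamma>\<close>-bounded set, whatever the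
imaginary part of \<open>z\<close> is.\<close>

definition weighted :: "real \<Rightarrow> ('a \<Rightarrow>\<^sub>L 'a) set"
  where "weighted a = {c *\<^sub>C S | c S. cmod c \<le> exp \<bar>a\<bar> \<and> S \<in> {T t | t. 0 \<le> t \<and> t \<le> 1}}"

lemma gamma_weighted: "has_gamma_bound (exp \<bar>a\<bar> * C) (weighted a)"
  unfolding weighted_def by (rule gamma_bound_scale[OF gamma_local]) simp

lemma exp_weight_le:
  assumes "Re z \<le> a" "0 \<le> t" "t \<le> 1" shows "cmod (exp (z * of_real t)) \<le> exp \<bar>a\<bar>"
proof -
  have "Re z * t \<le> \<bar>a\<bar> * t" using assms by (intro mult_right_mono) auto
  also have "\<dots> \<le> \<bar>a\<bar> * 1" using assms by (intro mult_left_mono) auto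
  finally show ?thesis by simp
qed

lemma weighted_mem:
  assumes "Re z \<le> a" "0 \<le> t" "t \<le> 1" "cmod c \<le> 1"
  shows "(c * exp (z * of_real t)) *\<^sub>C T t \<in> weighted a"
proof -
  have "cmod (c * exp (z * of_real t)) \<le> 1 * exp \<bar>a\<bar>"
    unfolding norm_mult using assms exp_weight_le by (intro mult_mono) auto
  then show ?thesis using assms unfolding weighted_def by auto
qed

lemma orbit_weighted: "orbit z v t = (exp (z * of_real t) *\<^sub>C T t) v"
  by (simp add: orbit_def blinfun_apply_scaleC)

lemma local_transform_gamma_bound: "has_gamma_bound (exp \<bar>a\<bar> * C) {local_transform z | z. Re z \<le> a}"
proof (rule gamma_bound_limit[OF gamma_bound_mean[OF gamma_weighted[of a]]])
  fix S assume "S \<in> {local_transform z | z. Re z \<le> a}"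
  then obtain z where z: "S = local_transform z" "Re z \<le> a" by blast
  define U where "U = (\<lambda>m k. exp (z * of_real (real k / real m)) *\<^sub>C T (real k / real m))"
  define f where "f = (\<lambda>m. (1 / real m) *\<^sub>R (\<Sum>k<m. U m k))"
  have "U m k \<in> weighted a" if "k < m" for m k
    using weighted_mem[OF z(2), of "real k / real m" 1] that by (simp add: U_def)
  then have mem: "f m \<in> {(1 / real m) *\<^sub>R (\<Sum>k<m. S k) | S. \<forall>k<m. S k \<in> weighted a}" for m
    unfolding f_def by blast
  have lim: "(\<lambda>m. (f m) v) \<longlonglongrightarrow> S v" for v
    using Riemann_sums_tendsto[OF orbit_continuous_on[of 0 1 z v]]
    by (simp add: z local_transform_apply f_def U_def orbit_weighted blinfun.scaleR_left blinfun.sum_left)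
  show "\<exists>f. (\<forall>m. f m \<in> {(1 / real m) *\<^sub>R (\<Sum>k<m. S k) | S. \<forall>k<m. S k \<in> weighted a}) \<and>
      (\<forall>v. (\<lambda>m. (f m) v) \<longlonglongrightarrow> S v)"
    using mem lim by blast
qed

abbreviation freq :: "complex \<Rightarrow> nat \<Rightarrow> complex"
  where "freq z k \<equiv> z + 2 * of_real pi * \<i> * of_nat k"

lemma exp_freq: "exp (freq z k * of_real t) = cis (2 * pi * (real k * t)) * exp (z * of_real t)"
  by (simp add: cis_conv_exp exp_add[symmetric] algebra_simps)

lemma orbit_freq: "orbit (freq z k) x t = cis (2 * pi * (real k * t)) *\<^sub>C orbit z x t"
  unfolding orbit_def exp_freq by (simp add: scaleC_scaleC)

lemma orbit_freq_one: "orbit (freq z k) x 1 = orbit z x 1"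
  using orbit_freq[of z k x 1] cis_eq_one_of_nat[of 1 k] by simp

text \<open>A Bessel inequality for the orbit of \<open>v\<close>. The discrete Fourier transform of \<open>2\<^sup>m\<close> samples is isometric, and
the samples are local operators applied to a constant family of Gaussian norm \<open>\<parallel>v\<parallel>\<close>. For \<open>m \<rightarrow> \<infinity>\<close> the
discrete coefficients are Riemann sums for \<open>P\<^bsub>\<nu> + 2\<pi>ik\<^esub> v\<close>.\<close>

lemma local_transform_analysis:
  assumes "Re \<nu> \<le> a"
  shows "gn {..<K} (\<lambda>k. (local_transform (freq \<nu> k)) v) \<le> exp \<bar>a\<bar> * C * norm v"
proof (rule gn_le_lim[where y = "\<lambda>m. dft 1 (2 ^ m) (\<lambda>j. (1 / sqrt (2 ^ m)) *\<^sub>R orbit \<nu> v (real j / 2 ^ m))"])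
  fix k assume "k \<in> {..<K}"
  have "dft 1 N (\<lambda>j. (1 / sqrt (real N)) *\<^sub>R orbit \<nu> v (real j / real N)) k =
      (1 / real N) *\<^sub>R (\<Sum>j<N. orbit (freq \<nu> k) v (real j / real N))" for N
  proof -
    have "(1 / sqrt (real N)) * (1 / sqrt (real N)) = 1 / real N" by simp
    then show ?thesis
      unfolding dft_def orbit_freq
      by (simp only: scaleC_scaleR scaleR_sum_right[symmetric] scaleR_scaleR)
        (simp add: mult_ac)
  qed
  from this[of "2 ^ m" for m]
  have eq: "dft 1 (2 ^ m) (\<lambda>j. (1 / sqrt (2 ^ m)) *\<^sub>R orbit \<nu> v (real j / 2 ^ m)) k =
      (1 / real (2 ^ m)) *\<^sub>R (\<Sum>j<2 ^ m. orbit (freq \<nu> k) v (real j / real (2 ^ m)))" for m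
    by simp
  have "(\<lambda>N. (1 / real N) *\<^sub>R (\<Sum>j<N. orbit (freq \<nu> k) v (real j / real N)))
      \<longlonglongrightarrow> (local_transform (freq \<nu> k)) v"
    unfolding local_transform_apply by (rule Riemann_sums_tendsto) (simp add: orbit_continuous_on)
  from LIMSEQ_subseq_LIMSEQ[OF this, of "\<lambda>m. 2 ^ m"]
  show "(\<lambda>m. dft 1 (2 ^ m) (\<lambda>j. (1 / sqrt (2 ^ m)) *\<^sub>R orbit \<nu> v (real j / 2 ^ m)) k)
      \<longlonglongrightarrow> (local_transform (freq \<nu> k)) v"
    unfolding eq by (simp add: o_def strict_mono_def)
next
  have "gn {..<K} (dft 1 (2 ^ m) (\<lambda>j. (1 / sqrt (2 ^ m)) *\<^sub>R orbit \<nu> v (real j / 2 ^ m))) \<le> exp \<bar>a\<bar> * C * norm v"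
    if "K \<le> m" for m
  proof -
    let ?x = "\<lambda>j. (1 / sqrt (2 ^ m)) *\<^sub>R orbit \<nu> v (real j / 2 ^ m)"
    have "K \<le> 2 ^ m" using that less_exp[of m] by linarith
    then have "gn {..<K} (dft 1 (2 ^ m) ?x) \<le> gn {..<2 ^ m} (dft 1 (2 ^ m) ?x)"
      by (intro gn_subset) auto
    also have "\<dots> = gn {..<2 ^ m} ?x" by (simp add: gn_dft)
    also have "\<dots> = gn {..<2 ^ m} (\<lambda>j. (exp (\<nu> * of_real (real j / 2 ^ m)) *\<^sub>C T (real j / 2 ^ m))
        ((1 / sqrt (2 ^ m)) *\<^sub>R v))"
      by (intro gn_cong) (simp only: orbit_weighted blinfun.scaleR_right)
    also have "\<dots> \<le> exp \<bar>a\<bar> * C * gn {..<2 ^ m} (\<lambda>j :: nat. (1 / sqrt (2 ^ m)) *\<^sub>R v)"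
    proof (rule has_gamma_boundD[OF gamma_weighted])
      fix j :: nat assume "j \<in> {..<2 ^ m}"
      then have "real j \<le> 2 ^ m" by (simp add: less_imp_le of_nat_less_numeral_power_cancel_iff)
      then show "exp (\<nu> * of_real (real j / 2 ^ m)) *\<^sub>C T (real j / 2 ^ m) \<in> weighted a"
        using weighted_mem[OF assms, of "real j / 2 ^ m" 1] by simp
    qed simp
    finally show ?thesis by (simp only: gn_constant)
  qed
  then show "eventually (\<lambda>m. gn {..<K} (dft 1 (2 ^ m) (\<lambda>j. (1 / sqrt (2 ^ m)) *\<^sub>R orbit \<nu> v (real j / 2 ^ m)))
      \<le> exp \<bar>a\<bar> * C * norm v) sequentially"
    unfolding eventually_sequentially by blast
qed simp

text \<open>With \<open>w = e\<^sup>\<nu> T\<^sub>1 v\<close> the bridge identity reads \<open>R v = R w - P v\<close> and \<open>\<parallel>w\<parallel> \<le> \<parallel>v\<parallel>/2\<close>. Thus a bound \<open>c \<parallel>v\<parallel>\<close> for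
\<open>(R\<^sub>k v)\<^sub>k\<close> improves to \<open>(c/2 + E) \<parallel>v\<parallel>\<close>. Iterating from the crude bound \<open>L\<close>, which depends on the number
of frequencies, leads to \<open>2E\<close>, which does not.\<close>

lemma resolvent_analysis_far_left:
  assumes \<nu>: "Re \<nu> \<le> a" and small: "exp (Re \<nu>) * norm (T 1) \<le> 1 / 2"
    and R: "\<And>k. k < K \<Longrightarrow> is_resolvent A (freq \<nu> k) (R k)"
  shows "gn {..<K} (\<lambda>k. (R k) u) \<le> 2 * (exp \<bar>a\<bar> * C) * norm u"
proof -
  define E where "E = exp \<bar>a\<bar> * C"
  define L where "L = (\<Sum>k<K. norm (R k))"
  have E: "0 \<le> E" and L: "0 \<le> L" using C_nonneg by (auto simp: E_def L_def intro: sum_nonneg)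
  have bound: "gn {..<K} (\<lambda>k. (R k) v) \<le> (L / 2 ^ n + 2 * E) * norm v" for n v
  proof (induction n arbitrary: v)
    case 0
    have "gn {..<K} (\<lambda>k. (R k) v) \<le> (\<Sum>k<K. norm ((R k) v))"
      by (rule gn_le_sum_norm) simp
    also have "\<dots> \<le> L * norm v"
      unfolding L_def sum_distrib_right by (intro sum_mono norm_blinfun)
    also have "\<dots> \<le> (L / 2 ^ 0 + 2 * E) * norm v"
      using C_nonneg by (intro mult_right_mono) (auto simp: E_def)
    finally show ?case .
  next
    case (Suc n)
    define w where "w = orbit \<nu> v 1"
    have "norm w \<le> exp (Re \<nu>) * (norm (T 1) * norm v)"
      unfolding w_def orbit_def by (simp add: norm_scaleC norm_blinfun)
    also have "\<dots> \<le> 1 / 2 * norm v"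
      using mult_right_mono[OF small, of "norm v"] by (simp add: mult.assoc)
    finally have w: "norm w \<le> norm v / 2" by simp
    have Rv: "(R k) v = (R k) w + (- 1) *\<^sub>C (local_transform (freq \<nu> k)) v"
      if "k < K" for k
    proof -
      have eq: "(R k) w - (R k) v = (local_transform (freq \<nu> k)) v"
        using resolvent_local_transform[OF R[OF that], of v]
        unfolding orbit_freq_one w_def[symmetric] blinfun.diff_right .
      show ?thesis unfolding eq[symmetric] by (simp add: scaleC.minus_left)
    qed
    have "gn {..<K} (\<lambda>k. (R k) v) =
        gn {..<K} (\<lambda>k. (R k) w + (- 1) *\<^sub>C (local_transform (freq \<nu> k)) v)"
      using Rv by (intro gn_cong) auto
    also have "\<dots> \<le> gn {..<K} (\<lambda>k. (R k) w) +
        gn {..<K} (\<lambda>k. (- 1) *\<^sub>C (local_transform (freq \<nu> k)) v)"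
      by (rule gn_triangle) simp
    also have "\<dots> \<le> (L / 2 ^ n + 2 * E) * norm w + 1 * (E * norm v)"
      using gn_scale_le[of "{..<K}" "- 1" "\<lambda>k. (local_transform (freq \<nu> k)) v"]
        local_transform_analysis[OF \<nu>, of K v]
      by (intro add_mono Suc.IH) (simp add: E_def)
    also have "\<dots> \<le> (L / 2 ^ n + 2 * E) * (norm v / 2) + 1 * (E * norm v)"
      using w E L by (intro add_mono mult_left_mono) auto
    also have "\<dots> = (L / 2 ^ Suc n + 2 * E) * norm v" by (simp add: field_simps)
    finally show ?case .
  qed
  have lim: "(\<lambda>n. (L / 2 ^ n + 2 * E) * norm u) \<longlonglongrightarrow> (0 + 2 * E) * norm u"
  proof (intro tendsto_intros)
    have "(\<lambda>n. L * (1 / 2) ^ n) \<longlonglongrightarrow> L * 0"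
      by (intro tendsto_intros LIMSEQ_power_zero) auto
    then show "(\<lambda>n. L / 2 ^ n) \<longlonglongrightarrow> 0" by (simp add: power_divide)
  qed
  have "gn {..<K} (\<lambda>k. (R k) u) \<le> (0 + 2 * E) * norm u"
    by (rule LIMSEQ_le_const[OF lim]) (use bound in blast)
  then show ?thesis by (simp add: E_def)
qed

text \<open>The point \<open>z\<close> is compared with \<open>z - d\<close>, where \<open>d\<close> is so large that the previous lemma applies. By the
resolvent identity \<open>R(z\<^sub>k) = (I - d R(z\<^sub>k)) R(z\<^sub>k - d)\<close>, and the first factor is \<open>\<gamma>\<close>-bounded.\<close>

lemma resolvent_analysis:
  assumes spec: "spectrum A \<subseteq> {z. Re z > \<alpha>}"
    and D: "has_gamma_bound D {resolvent z A | z. Re z \<le> \<alpha>}"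
  shows "\<exists>B\<ge>0. \<forall>z K u. Re z \<le> \<alpha> \<longrightarrow> gn {..<K} (\<lambda>k. (resolvent (freq z k) A) u) \<le> B * norm u"
proof -
  define d where "d = \<bar>\<alpha>\<bar> + ln (2 * (norm (T 1) + 1))"
  have d: "0 \<le> d" by (simp add: d_def add_nonneg_nonneg ln_ge_zero)
  have small: "exp (\<alpha> - d) * norm (T 1) \<le> 1 / 2"
  proof -
    have "exp (\<alpha> - d) \<le> exp (- ln (2 * (norm (T 1) + 1)))" by (simp add: d_def)
    also have "\<dots> = 1 / (2 * (norm (T 1) + 1))"
      by (simp add: exp_minus divide_inverse add_nonneg_pos)
    finally have "exp (\<alpha> - d) * norm (T 1) \<le> 1 / (2 * (norm (T 1) + 1)) * norm (T 1)"
      by (intro mult_right_mono) auto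
    also have "\<dots> \<le> 1 / 2"
    proof -
      have "0 < 2 * (norm (T 1) + 1)" by (simp add: add_nonneg_pos)
      then show ?thesis by (simp add: pos_divide_le_eq)
    qed
    finally show ?thesis .
  qed
  have D0: "0 \<le> D" using D by (simp add: has_gamma_bound_def)
  define E where "E = 2 * (exp \<bar>\<alpha>\<bar> * C)"
  have res: "is_resolvent A z (resolvent z A)" if "Re z \<le> \<alpha>" for z
    using spec that by (intro is_resolvent_resolvent) force
  have "gn {..<K} (\<lambda>k. (resolvent (freq z k) A) u) \<le> (1 + d * D) * E * norm u"
    if z: "Re z \<le> \<alpha>" for z K u
  proof -
    define \<nu> where "\<nu> = z - of_real d"
    have \<nu>: "Re \<nu> \<le> \<alpha>" "exp (Re \<nu>) * norm (T 1) \<le> 1 / 2"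
    proof -
      show "Re \<nu> \<le> \<alpha>" using z d by (simp add: \<nu>_def)
      have "exp (Re \<nu>) * norm (T 1) \<le> exp (\<alpha> - d) * norm (T 1)"
        using z by (intro mult_right_mono) (auto simp: \<nu>_def)
      then show "exp (Re \<nu>) * norm (T 1) \<le> 1 / 2" using small by linarith
    qed
    let ?S = "\<lambda>k. (resolvent (freq \<nu> k) A) u"
    have S: "gn {..<K} ?S \<le> E * norm u"
      unfolding E_def by (rule resolvent_analysis_far_left[OF \<nu>]) (use \<nu> res in auto)
    have "gn {..<K} (\<lambda>k. (resolvent (freq z k) A) u) =
        gn {..<K} (\<lambda>k. ?S k + (- of_real d) *\<^sub>C (resolvent (freq z k) A) (?S k))"
    proof (rule gn_cong)
      fix k
      have "freq \<nu> k - freq z k = - of_real d" by (simp add: \<nu>_def)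
      moreover have "(resolvent (freq z k) A) u =
          ?S k + (freq \<nu> k - freq z k) *\<^sub>C (resolvent (freq z k) A) (?S k)"
      proof (rule resolvent_identity)
        show "is_resolvent A (freq z k) (resolvent (freq z k) A)" by (rule res) (use z in simp)
        show "is_resolvent A (freq \<nu> k) (resolvent (freq \<nu> k) A)" by (rule res) (use \<nu>(1) in simp)
      qed
      ultimately show "(resolvent (freq z k) A) u =
          ?S k + (- of_real d) *\<^sub>C (resolvent (freq z k) A) (?S k)" by simp
    qed
    also have "\<dots> \<le> gn {..<K} ?S +
        gn {..<K} (\<lambda>k. (- of_real d) *\<^sub>C (resolvent (freq z k) A) (?S k))"
      by (rule gn_triangle) simp
    also have "\<dots> \<le> gn {..<K} ?S + d * gn {..<K} (\<lambda>k. (resolvent (freq z k) A) (?S k))"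
      using gn_scale_le[of "{..<K}" "- of_real d" "\<lambda>k. (resolvent (freq z k) A) (?S k)"] d
      by (intro add_left_mono) simp
    also have "\<dots> \<le> gn {..<K} ?S + d * (D * gn {..<K} ?S)"
      using d z by (intro add_left_mono mult_left_mono has_gamma_boundD[OF D]) auto
    also have "\<dots> = (1 + d * D) * gn {..<K} ?S" by (simp add: algebra_simps)
    also have "\<dots> \<le> (1 + d * D) * (E * norm u)"
      using d D0 by (intro mult_left_mono S) auto
    finally show ?thesis by (simp add: mult.assoc)
  qed
  moreover have "0 \<le> (1 + d * D) * E" using d D0 C_nonneg by (simp add: E_def)
  ultimately show ?thesis by blast
qed

end

section \<open>The Fejer kernel\<close>

text \<open>The Fejer kernel as the square of a Dirichlet kernel; \<open>r\<close> is measured in periods.\<close>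

definition fejer :: "nat \<Rightarrow> real \<Rightarrow> real"
  where "fejer K r = (cmod (\<Sum>p<K. cis (2 * pi * (real p * r))))\<^sup>2 / real K"

lemma fejer_nonneg: "0 \<le> fejer K r"
  by (simp add: fejer_def)

lemma fejer_expand:
  "complex_of_real (fejer K r) = of_real (1 / real K) * (\<Sum>p<K. \<Sum>q<K. cis (2 * pi * ((real p - real q) * r)))"
proof -
  let ?D = "\<Sum>p<K. cis (2 * pi * (real p * r))"
  have "complex_of_real ((cmod ?D)\<^sup>2) = ?D * cnj ?D"
    by (rule complex_norm_square)
  also have "\<dots> = (\<Sum>p<K. \<Sum>q<K. cis (2 * pi * (real p * r)) * cnj (cis (2 * pi * (real q * r))))"
    unfolding cnj_sum by (rule sum_product)
  also have "\<dots> = (\<Sum>p<K. \<Sum>q<K. cis (2 * pi * ((real p - real q) * r)))"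
    by (intro sum.cong) (simp_all add: cis_cnj cis_mult algebra_simps)
  finally show ?thesis by (simp add: fejer_def)
qed

lemma fejer_continuous: "continuous_on S (\<lambda>s. fejer K (s - t))"
  unfolding fejer_def divide_inverse by (intro continuous_intros)

lemma fejer_integral:
  assumes "0 < K" shows "integral {0..1} (\<lambda>s. fejer K (s - t)) = 1"
proof -
  have one: "((\<lambda>s. cos (2 * pi * ((real p - real q) * (s - t)))) has_integral (if p = q then 1 else 0)) {0..1}" for p q :: nat
  proof (cases "p = q")
    case True
    then show ?thesis using has_integral_const_real[of "1 :: real" 0 1] by simp
  next
    case False
    define n where "n = 2 * pi * (real p - real q)"
    have n: "n \<noteq> 0" using False by (simp add: n_def)
    have "((\<lambda>s. cos (n * (s - t))) has_integral (sin (n * (1 - t)) / n - sin (n * (0 - t)) / n)) {0..1}"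
      by (rule fundamental_theorem_of_calculus)
        (use n in \<open>auto intro!: derivative_eq_intros simp flip: has_real_derivative_iff_has_vector_derivative\<close>)
    moreover have "sin (n * (1 - t)) = sin (n * (0 - t))"
    proof -
      have "n * (1 - t) = n * (0 - t) + 2 * pi * of_int (int p - int q)"
        by (simp add: n_def algebra_simps)
      then show ?thesis by (simp only: sin_add sin_int_2pin cos_int_2pin)
    qed
    ultimately show ?thesis using False by (simp add: n_def mult.assoc)
  qed
  have eq: "fejer K (s - t) = (1 / real K) * (\<Sum>p<K. \<Sum>q<K. cos (2 * pi * ((real p - real q) * (s - t))))" for s
  proof -
    have "fejer K (s - t) = Re (of_real (1 / real K) * (\<Sum>p<K. \<Sum>q<K. cis (2 * pi * ((real p - real q) * (s - t)))))"
      unfolding fejer_expand[symmetric] by simp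
    also have "\<dots> = (1 / real K) * Re (\<Sum>p<K. \<Sum>q<K. cis (2 * pi * ((real p - real q) * (s - t))))"
      by (simp only: times_complex.sel Re_complex_of_real Im_complex_of_real mult_zero_left diff_zero)
    finally show ?thesis by simp
  qed
  have hi: "((\<lambda>s. (1 / real K) * (\<Sum>p<K. \<Sum>q<K. cos (2 * pi * ((real p - real q) * (s - t))))) has_integral
      (1 / real K) * (\<Sum>p<K. \<Sum>q<K. if p = q then 1 else 0)) {0..1}"
    by (intro has_integral_mult_right has_integral_sum one finite_lessThan)
  show ?thesis unfolding eq integral_unique[OF hi] using assms by simp
qed

text \<open>The Dirichlet kernel is a geometric sum, which is bounded as long as \<open>r\<close> stays away from the integers.
The range \<open>|r| \<le> 3/4\<close> covers all differences of a point of \<open>[0, 1]\<close> and a point of \<open>[1/4, 3/4]\<close>.\<close>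

lemma fejer_off_diagonal:
  assumes "0 < d" "d \<le> 3 / 4"
  shows "\<exists>c>0. \<forall>K r. 0 < K \<longrightarrow> d \<le> \<bar>r\<bar> \<longrightarrow> \<bar>r\<bar> \<le> 3 / 4 \<longrightarrow> fejer K r \<le> c / real K"
proof -
  define S where "S = {- (3 / 4)..- d} \<union> {d..3 / 4}"
  have compact: "compact S" by (simp add: S_def compact_Un)
  have nonempty: "S \<noteq> {}" using assms by (auto simp: S_def)
  have cont: "continuous_on S (\<lambda>r. cmod (1 - cis (2 * pi * r)))"
    by (intro continuous_intros)
  obtain r0 where r0: "r0 \<in> S" "\<And>r. r \<in> S \<Longrightarrow> cmod (1 - cis (2 * pi * r0)) \<le> cmod (1 - cis (2 * pi * r))"
    using continuous_attains_inf[OF compact nonempty cont] by blast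
  define b where "b = cmod (1 - cis (2 * pi * r0))"
  have "b \<noteq> 0"
  proof
    assume "b = 0"
    then have "cos (2 * pi * r0) = 1" by (simp add: b_def complex_eq_iff)
    then obtain n :: int where "2 * pi * r0 = of_int n * 2 * pi" unfolding cos_one_2pi_int by blast
    then have "r0 = of_int n" by simp
    moreover have "0 < \<bar>r0\<bar> \<and> \<bar>r0\<bar> < 1" using r0(1) assms unfolding S_def by auto
    ultimately have "0 < \<bar>n\<bar> \<and> \<bar>n\<bar> < 1" by linarith
    then show False by linarith
  qed
  then have b: "0 < b" by (simp add: b_def)
  have "fejer K r \<le> (2 / b)\<^sup>2 / real K" if K: "0 < K" and r: "d \<le> \<bar>r\<bar>" "\<bar>r\<bar> \<le> 3 / 4" for K r
  proof -
    let ?w = "cis (2 * pi * r)"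
    have "r \<in> S" using r unfolding S_def by (cases "0 \<le> r") auto
    then have le: "b \<le> cmod (1 - ?w)" using r0(2) by (simp add: b_def)
    have "(\<Sum>p<K. cis (2 * pi * (real p * r))) = (\<Sum>p<K. ?w ^ p)"
      by (intro sum.cong) (simp_all add: Complex.DeMoivre mult_ac)
    then have "(1 - ?w) * (\<Sum>p<K. cis (2 * pi * (real p * r))) = 1 - ?w ^ K"
      by (simp add: one_diff_power_eq)
    then have "cmod (1 - ?w) * cmod (\<Sum>p<K. cis (2 * pi * (real p * r))) = cmod (1 - ?w ^ K)"
      by (metis norm_mult)
    also have "\<dots> \<le> 2"
      using norm_triangle_ineq4[of 1 "?w ^ K"] by (simp add: norm_power)
    finally have "b * cmod (\<Sum>p<K. cis (2 * pi * (real p * r))) \<le> 2"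
      using mult_right_mono[OF le, of "cmod (\<Sum>p<K. cis (2 * pi * (real p * r)))"] by simp
    then have "cmod (\<Sum>p<K. cis (2 * pi * (real p * r))) \<le> 2 / b"
      using b by (simp add: field_simps)
    then show ?thesis
      unfolding fejer_def by (intro divide_right_mono power_mono) auto
  qed
  then show ?thesis using b by (intro exI[of _ "(2 / b)\<^sup>2"]) auto
qed

text \<open>The convergence is uniform for \<open>t\<close> in the middle half of the period only: an orbit is not periodic, and near
the ends of \<open>[0, 1]\<close> the kernel would mix its two boundary values.\<close>

lemma fejer_approximate_identity:
  fixes G :: "real \<Rightarrow> 'a :: banach"
  assumes G: "continuous_on {0..2} G" and e: "0 < e"
  shows "\<exists>K0. \<forall>K\<ge>K0. \<forall>t\<in>{1/4..3/4}.
    norm (integral {0..1} (\<lambda>s. fejer K (s - t) *\<^sub>R G (1 - t + s)) - G 1) \<le> e"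
proof -
  have "compact (G ` {0..2})" using G by (rule compact_continuous_image) simp
  then obtain B where B: "0 < B" "\<And>s. s \<in> {0..2} \<Longrightarrow> norm (G s) \<le> B"
    using compact_imp_bounded bounded_pos by (metis imageI)
  have "isCont G 1"
    using G by (rule continuous_on_interior) simp
  then obtain d0 where d0: "0 < d0" "\<And>s. dist s 1 < d0 \<Longrightarrow> dist (G s) (G 1) < e / 2"
    using e unfolding continuous_at_eps_delta by (metis half_gt_zero dist_norm)
  define d where "d = min (d0 / 2) (1 / 2)"
  have d: "0 < d" "d \<le> 3 / 4" "d < d0" using d0(1) by (auto simp: d_def)
  obtain c where c: "0 < c" "\<And>K r. \<lbrakk>0 < K; d \<le> \<bar>r\<bar>; \<bar>r\<bar> \<le> 3 / 4\<rbrakk> \<Longrightarrow> fejer K r \<le> c / real K"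
    using fejer_off_diagonal[OF d(1,2)] by blast
  obtain K0 where K0: "4 * B * c / e < real K0" using reals_Archimedean2 by blast
  have "norm (integral {0..1} (\<lambda>s. fejer K (s - t) *\<^sub>R G (1 - t + s)) - G 1) \<le> e"
    if K: "K0 \<le> K" and t: "t \<in> {1/4..3/4}" for K t
  proof -
    have Kpos: "0 < real K" and Kbig: "2 * B * (c / real K) \<le> e / 2"
    proof -
      have "4 * B * c / e < real K" using K K0 by linarith
      moreover have "0 < 4 * B * c / e" using B c e by simp
      ultimately show "0 < real K" by linarith
      then show "2 * B * (c / real K) \<le> e / 2"
        using \<open>4 * B * c / e < real K\<close> e by (simp add: field_simps)
    qed
    have c1: "continuous_on {0..1} (\<lambda>s. G (1 - t + s))"
      by (rule continuous_on_compose2[OF G]) (use t in \<open>auto intro!: continuous_intros\<close>)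
    have i1: "(\<lambda>s. fejer K (s - t) *\<^sub>R G (1 - t + s)) integrable_on {0..1}"
      by (intro integrable_continuous_real continuous_intros fejer_continuous c1)
    have i2: "(\<lambda>s. fejer K (s - t) *\<^sub>R G 1) integrable_on {0..1}"
      by (intro integrable_continuous_real continuous_intros fejer_continuous)
    have i3: "(\<lambda>s. fejer K (s - t)) integrable_on {0..1}"
      by (intro integrable_continuous_real fejer_continuous)
    have "integral {0..1} (\<lambda>s. fejer K (s - t) *\<^sub>R G 1) = G 1"
    proof -
      have "integral {0..1} ((\<lambda>r. r *\<^sub>R G 1) \<circ> (\<lambda>s. fejer K (s - t))) = 1 *\<^sub>R G 1"
        using integral_linear[OF i3 bounded_linear_scaleR_left[of "G 1"]] fejer_integral[of K t] Kpos by simp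
      then show ?thesis by (simp add: o_def)
    qed
    then have "integral {0..1} (\<lambda>s. fejer K (s - t) *\<^sub>R G (1 - t + s)) - G 1 =
        integral {0..1} (\<lambda>s. fejer K (s - t) *\<^sub>R (G (1 - t + s) - G 1))"
      using integral_diff[OF i1 i2] by (simp add: scaleR_diff_right)
    also have "norm \<dots> \<le> integral {0..1} (\<lambda>s. e / 2 * fejer K (s - t) + 2 * B * (c / real K))"
    proof (rule integral_norm_bound_integral)
      show "(\<lambda>s. fejer K (s - t) *\<^sub>R (G (1 - t + s) - G 1)) integrable_on {0..1}"
        by (intro integrable_continuous_real continuous_intros fejer_continuous c1)
      show "(\<lambda>s. e / 2 * fejer K (s - t) + 2 * B * (c / real K)) integrable_on {0..1}"
        by (intro integrable_continuous_real continuous_intros fejer_continuous)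
      fix s :: real assume s: "s \<in> {0..1}"
      have "0 \<le> 2 * B * (c / real K)" using B(1) c(1) by simp
      show "norm (fejer K (s - t) *\<^sub>R (G (1 - t + s) - G 1)) \<le> e / 2 * fejer K (s - t) + 2 * B * (c / real K)"
      proof (cases "\<bar>s - t\<bar> < d")
        case True
        then have "norm (G (1 - t + s) - G 1) \<le> e / 2"
          using d0(2)[of "1 - t + s"] d(3) by (simp add: dist_norm less_imp_le)
        then have "fejer K (s - t) * norm (G (1 - t + s) - G 1) \<le> fejer K (s - t) * (e / 2)"
          by (rule mult_left_mono[OF _ fejer_nonneg])
        then show ?thesis using \<open>0 \<le> 2 * B * (c / real K)\<close> fejer_nonneg[of K "s - t"] by (simp add: mult.commute)
      next
        case False
        have "norm (G (1 - t + s) - G 1) \<le> B + B"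
          using norm_triangle_ineq4[of "G (1 - t + s)" "G 1"] B(2)[of "1 - t + s"] B(2)[of 1] s t by simp
        moreover have "fejer K (s - t) \<le> c / real K"
        proof (rule c(2))
          show "\<bar>s - t\<bar> \<le> 3 / 4" unfolding abs_le_iff using s t by auto
        qed (use False Kpos in auto)
        ultimately have "fejer K (s - t) * norm (G (1 - t + s) - G 1) \<le> c / real K * (B + B)"
          using c(1) by (intro mult_mono) auto
        moreover have "0 \<le> e / 2 * fejer K (s - t)" using e fejer_nonneg by simp
        moreover have "c / real K * (B + B) = 2 * B * (c / real K)" by (simp add: algebra_simps)
        ultimately show ?thesis unfolding norm_scaleR abs_of_nonneg[OF fejer_nonneg] by linarith
      qed
    qed
    also have "\<dots> = e / 2 * 1 + 2 * B * (c / real K)"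
    proof (rule integral_unique)
      have "((\<lambda>s. fejer K (s - t)) has_integral 1) {0..1}"
        using integrable_integral[OF i3] fejer_integral[of K t] Kpos by simp
      from has_integral_add[OF has_integral_mult_right[OF this, of "e / 2"]
          has_integral_const_real[of "2 * B * (c / real K)" 0 1]]
      show "((\<lambda>s. e / 2 * fejer K (s - t) + 2 * B * (c / real K)) has_integral
          e / 2 * 1 + 2 * B * (c / real K)) {0..1}" by simp
    qed
    finally show ?thesis using Kbig by simp
  qed
  then show ?thesis by blast
qed

section \<open>A lower bound for orbits\<close>

text \<open>The normalised number of pairs \<open>(p, q)\<close> with \<open>p - q = k - K\<close>. The shift by \<open>K\<close> moves the frequencies of the
Fejer kernel into the range \<open>0 \<le> k < 2K\<close> of a discrete Fourier transform.\<close>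

definition fejer_weight :: "nat \<Rightarrow> nat \<Rightarrow> real"
  where "fejer_weight K k = real (card {pq \<in> {..<K} \<times> {..<K}. fst pq + (K - snd pq) = k}) / real K"

lemma fejer_weight_bounds: "0 \<le> fejer_weight K k" "fejer_weight K k \<le> 1"
proof -
  let ?S = "{pq \<in> {..<K} \<times> {..<K}. fst pq + (K - snd pq) = k}"
  have "inj_on fst ?S" by (auto simp: inj_on_def)
  then have "card ?S \<le> card {..<K}" by (rule card_inj_on_le) auto
  then show "fejer_weight K k \<le> 1" by (cases "K = 0") (simp_all add: fejer_weight_def)
qed (simp add: fejer_weight_def)

lemma fejer_weight_sum:
  fixes f :: "nat \<Rightarrow> complex"
  shows "(\<Sum>k<2 * K. of_real (fejer_weight K k) * f k) = of_real (1 / real K) * (\<Sum>p<K. \<Sum>q<K. f (p + (K - q)))"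
proof -
  let ?S = "{..<K} \<times> {..<K}" and ?g = "\<lambda>pq. fst pq + (K - snd pq)"
  have "(\<Sum>p<K. \<Sum>q<K. f (p + (K - q))) = (\<Sum>pq\<in>?S. f (?g pq))"
    unfolding sum.cartesian_product case_prod_beta ..
  also have "\<dots> = (\<Sum>k<2 * K. \<Sum>pq\<in>{pq \<in> ?S. ?g pq = k}. f (?g pq))"
    by (rule sum.group[symmetric]) auto
  also have "\<dots> = (\<Sum>k<2 * K. of_nat (card {pq \<in> ?S. ?g pq = k}) * f k)"
    by (intro sum.cong) auto
  finally show ?thesis
    by (simp add: fejer_weight_def sum_distrib_left)
qed

lemma fejer_weight_kernel:
  "(\<Sum>k<2 * K. of_real (fejer_weight K k) * cis (2 * pi * (real k * r))) = cis (2 * pi * (real K * r)) * of_real (fejer K r)"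
proof -
  have "(\<Sum>k<2 * K. of_real (fejer_weight K k) * cis (2 * pi * (real k * r))) =
      of_real (1 / real K) * (\<Sum>p<K. \<Sum>q<K. cis (2 * pi * (real (p + (K - q)) * r)))"
    by (rule fejer_weight_sum)
  also have "(\<Sum>p<K. \<Sum>q<K. cis (2 * pi * (real (p + (K - q)) * r))) =
      (\<Sum>p<K. \<Sum>q<K. cis (2 * pi * (real K * r)) * cis (2 * pi * ((real p - real q) * r)))"
    by (intro sum.cong refl) (simp add: cis_mult of_nat_diff algebra_simps)
  also have "\<dots> = cis (2 * pi * (real K * r)) * (\<Sum>p<K. \<Sum>q<K. cis (2 * pi * ((real p - real q) * r)))"
    by (simp add: sum_distrib_left)
  finally show ?thesis unfolding fejer_expand by (simp add: mult_ac)
qed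

context gamma_bounded_semigroup
begin

text \<open>Weighting the Fourier coefficients means convolving the orbit with the Fejer kernel. Because of the shift
by \<open>K\<close>, the transform starts at the frequency of \<open>z' = z - 2\<pi>iK\<close>.\<close>

lemma fejer_synthesis:
  fixes z :: complex
  defines "z' \<equiv> \<lambda>K. z - 2 * of_real pi * \<i> * of_nat K"
  shows "(\<Sum>k<2 * K. (of_real (fejer_weight K k) * cis (- (2 * pi * (real k * t)))) *\<^sub>C
      (local_transform (freq (z' K) k)) x) =
    cis (- (2 * pi * (real K * t))) *\<^sub>C integral {0..1} (\<lambda>s. fejer K (s - t) *\<^sub>R orbit z x s)"
proof -
  let ?c = "\<lambda>k. of_real (fejer_weight K k) * cis (- (2 * pi * (real k * t)))"
  let ?d = "cis (- (2 * pi * (real K * t)))"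
  have "((\<lambda>s. \<Sum>k<2 * K. ?c k *\<^sub>C orbit (freq (z' K) k) x s) has_integral
      (\<Sum>k<2 * K. ?c k *\<^sub>C (local_transform (freq (z' K) k)) x)) {0..1}"
    unfolding local_transform_apply
    using has_integral_linear[OF integrable_integral[OF orbit_integrable[of 0 _ x 1]] bounded_linear_scaleC]
    by (intro has_integral_sum) (auto simp: o_def)
  moreover have "(\<Sum>k<2 * K. ?c k *\<^sub>C orbit (freq (z' K) k) x s) = ?d *\<^sub>C fejer K (s - t) *\<^sub>R orbit z x s" for s
  proof -
    have o: "orbit z x s = cis (2 * pi * (real K * s)) *\<^sub>C orbit (z' K) x s"
      using orbit_freq[of "z' K" K x s] by (simp add: z'_def)
    have sc: "?c k * cis (2 * pi * (real k * s)) = of_real (fejer_weight K k) * cis (2 * pi * (real k * (s - t)))" for k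
      by (simp add: mult.assoc cis_mult algebra_simps)
    have "(\<Sum>k<2 * K. ?c k *\<^sub>C orbit (freq (z' K) k) x s) =
        (\<Sum>k<2 * K. of_real (fejer_weight K k) * cis (2 * pi * (real k * (s - t)))) *\<^sub>C orbit (z' K) x s"
      unfolding orbit_freq scaleC_scaleC sc scaleC.sum_left ..
    also have "\<dots> = (cis (2 * pi * (real K * (s - t))) * of_real (fejer K (s - t))) *\<^sub>C orbit (z' K) x s"
      by (simp only: fejer_weight_kernel)
    also have "cis (2 * pi * (real K * (s - t))) = ?d * cis (2 * pi * (real K * s))"
      by (simp add: cis_mult algebra_simps)
    finally show ?thesis
      by (simp add: o scaleC_scaleC mult_ac flip: scaleC_of_real)
  qed
  ultimately have "((\<lambda>s. ?d *\<^sub>C fejer K (s - t) *\<^sub>R orbit z x s) has_integral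
      (\<Sum>k<2 * K. ?c k *\<^sub>C (local_transform (freq (z' K) k)) x)) {0..1}" by simp
  moreover have "((\<lambda>s. ?d *\<^sub>C fejer K (s - t) *\<^sub>R orbit z x s) has_integral
      ?d *\<^sub>C integral {0..1} (\<lambda>s. fejer K (s - t) *\<^sub>R orbit z x s)) {0..1}"
  proof -
    have "(\<lambda>s. fejer K (s - t) *\<^sub>R orbit z x s) integrable_on {0..1}"
      by (intro integrable_continuous_real continuous_intros fejer_continuous orbit_continuous_on) simp
    from has_integral_linear[OF integrable_integral[OF this] bounded_linear_scaleC]
    show ?thesis by (simp add: o_def)
  qed
  ultimately show ?thesis by (rule has_integral_unique)
qed

lemma orbit_shift_integral:
  assumes t: "0 \<le> t" "t \<le> 1"
  shows "exp (z * of_real (1 - t)) *\<^sub>C (T (1 - t)) (integral {0..1} (\<lambda>s. fejer K (s - t) *\<^sub>R orbit z x s)) =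
    integral {0..1} (\<lambda>s. fejer K (s - t) *\<^sub>R orbit z x (1 - t + s))"
proof -
  let ?L = "\<lambda>v. exp (z * of_real (1 - t)) *\<^sub>C (T (1 - t)) v"
  have L: "bounded_linear ?L"
    by (rule bounded_linear_compose[OF bounded_linear_scaleC blinfun.bounded_linear_right])
  have i: "(\<lambda>s. fejer K (s - t) *\<^sub>R orbit z x s) integrable_on {0..1}"
    by (intro integrable_continuous_real continuous_intros fejer_continuous orbit_continuous_on) simp
  have "?L (integral {0..1} (\<lambda>s. fejer K (s - t) *\<^sub>R orbit z x s)) =
      integral {0..1} (\<lambda>s. ?L (fejer K (s - t) *\<^sub>R orbit z x s))"
    using integral_linear[OF i L] by (simp add: o_def)
  also have "\<dots> = integral {0..1} (\<lambda>s. fejer K (s - t) *\<^sub>R orbit z x (1 - t + s))"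
  proof (rule integral_cong)
    fix s :: real assume "s \<in> {0..1}"
    then have "?L (orbit z x s) = (exp (z * of_real (1 - t)) * exp (- z * of_real (1 - t))) *\<^sub>C orbit z x (1 - t + s)"
      using T_orbit[of "1 - t" s z x] t by (simp add: scaleC_scaleC add.commute)
    also have "exp (z * of_real (1 - t)) * exp (- z * of_real (1 - t)) = 1"
      by (simp add: exp_minus)
    finally show "?L (fejer K (s - t) *\<^sub>R orbit z x s) = fejer K (s - t) *\<^sub>R orbit z x (1 - t + s)"
      by (simp add: blinfun.scaleR_right scaleC_scaleR)
  qed
  finally show ?thesis .
qed

text \<open>Let \<open>u = e\<^sup>z T\<^sub>1 x - x\<close>. The coefficients \<open>P\<^bsub>z'\<^sub>k\<^esub> x = R(z'\<^sub>k, A) u\<close> have Gaussian norm at most \<open>B \<parallel>u\<parallel>\<close>; Fejer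
weights, the inverse Fourier transform and the local operators \<open>e\<^bsup>z(1-t\<^sub>j)\<^esup> T\<^bsub>1-t\<^sub>j\<^esub>\<close> increase this norm only by a
constant. At the grid points \<open>t\<^sub>j\<close> of the middle half, what results is close to \<open>e\<^sup>z T\<^sub>1 x\<close>,
independently of \<open>j\<close>, because \<open>e\<^bsup>z(1-t)\<^esup> T\<^bsub>1-t\<^esub>\<close> carries the point \<open>e\<^bsup>zt\<^esup> T\<^sub>t x\<close> of the orbit to its end. Only the
average over \<open>j\<close> is compared with \<open>e\<^sup>z T\<^sub>1 x\<close>: an average is controlled by the Gaussian norm, whereas
\<open>N\<close> small errors need not add up to a family of small Gaussian norm.\<close>

lemma orbit_bounded_below:
  assumes spec: "spectrum A \<subseteq> {z. Re z > \<alpha>}"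
    and D: "has_gamma_bound D {resolvent z A | z. Re z \<le> \<alpha>}"
  shows "\<exists>B\<ge>0. \<forall>z x. Re z \<le> \<alpha> \<longrightarrow> norm (orbit z x 1) \<le> B * norm (orbit z x 1 - x)"
proof -
  obtain B where B: "0 \<le> B" "\<And>z K u. Re z \<le> \<alpha> \<Longrightarrow>
      gn {..<K} (\<lambda>k. (resolvent (freq z k) A) u) \<le> B * norm u"
    using resolvent_analysis[OF spec D] by blast
  define E where "E = exp \<bar>\<alpha>\<bar> * C"
  have E: "0 \<le> E" using C_nonneg by (simp add: E_def)
  have "norm (orbit z x 1) \<le> 2 * E * B * norm (orbit z x 1 - x)" if z: "Re z \<le> \<alpha>" for z x
  proof (rule field_le_epsilon)
    fix e :: real assume e: "0 < e"
    define u where "u = orbit z x 1 - x"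
    define y where "y = (\<lambda>K t. integral {0..1} (\<lambda>s. fejer K (s - t) *\<^sub>R orbit z x (1 - t + s)))"
    obtain K0 where K0: "\<And>K t. K0 \<le> K \<Longrightarrow> t \<in> {1/4..3/4} \<Longrightarrow> norm (y K t - orbit z x 1) \<le> e"
      using fejer_approximate_identity[OF orbit_continuous_on[of 0 2 z x] e] unfolding y_def by blast
    \<comment> \<open>\<open>K\<close> is the order of the Fejer kernel, \<open>N\<close> the number of frequencies and of grid points, and
      \<open>M \<le> j < 3 M\<close> the middle half of the grid\<close>
    define M :: nat where "M = 2 ^ K0"
    define K where "K = 2 * M"
    define N where "N = 2 * K"
    have N: "N = 2 ^ (K0 + 2)" "N = 4 * M" "0 < M" by (simp_all add: N_def K_def M_def power_add)
    have "K0 \<le> K" using less_exp[of K0] unfolding K_def M_def by linarith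
    define z' where "z' = z - 2 * of_real pi * \<i> * of_nat K"
    have z': "Re z' \<le> \<alpha>" using z by (simp add: z'_def)
    have u': "orbit (freq z' k) x 1 - x = u" for k
      using orbit_freq_one[of z' k x] orbit_freq_one[of z' K x] by (simp add: u_def z'_def)
    define a where "a = (\<lambda>k. of_real (fejer_weight K k) *\<^sub>C (local_transform (freq z' k)) x)"
    have "gn {..<N} a \<le> 1 * gn {..<N} (\<lambda>k. (local_transform (freq z' k)) x)"
      unfolding a_def using fejer_weight_bounds by (intro gn_contract) auto
    also have "\<dots> = gn {..<N} (\<lambda>k. (resolvent (freq z' k) A) u)"
    proof -
      have "(local_transform (freq z' k)) x = (resolvent (freq z' k) A) u" for k
      proof -
        have "is_resolvent A (freq z' k) (resolvent (freq z' k) A)"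
          using spec z' by (intro is_resolvent_resolvent) force
        from resolvent_local_transform[OF this, of x] show ?thesis by (simp only: u')
      qed
      then show ?thesis by simp
    qed
    also have "\<dots> \<le> B * norm u" by (rule B(2)[OF z'])
    finally have ga: "gn {..<N} a \<le> B * norm u" .
    define q where "q = dft (- 1) N a"
    have gq: "gn {..<N} q \<le> B * norm u"
      using ga gn_dft[of "- 1" "K0 + 2" a] unfolding q_def N(1) by simp
    define t where "t = (\<lambda>j. real j / real N)"
    define c where "c = (\<lambda>j. if j \<in> {M..<3 * M} then 1 else 0 :: real)"
    \<comment> \<open>the phase undoes the shift of the frequencies by \<open>K\<close>\<close>
    define U where "U = (\<lambda>j. ((of_real (c j) * cis (2 * pi * (real K * t j))) * exp (z * of_real (1 - t j))) *\<^sub>C T (1 - t j))"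
    have t01: "0 \<le> t j" "t j \<le> 1" if "j < N" for j using that by (auto simp: t_def)
    have U: "U j \<in> weighted \<alpha>" if "j < N" for j
      unfolding U_def using t01[OF that] by (intro weighted_mem[OF z]) (auto simp: norm_mult c_def)
    have Uq: "(U j) (q j) = (1 / sqrt (real N)) *\<^sub>R c j *\<^sub>R y K (t j)" if j: "j < N" for j
    proof -
      have "q j = (1 / sqrt (real N)) *\<^sub>R (\<Sum>k<2 * K. (of_real (fejer_weight K k) * cis (- (2 * pi * (real k * t j)))) *\<^sub>C
          (local_transform (freq z' k)) x)"
        unfolding q_def dft_def a_def N_def[symmetric]
        by (simp add: t_def scaleC_scaleC mult.commute)
      also have "\<dots> = (1 / sqrt (real N)) *\<^sub>R cis (- (2 * pi * (real K * t j))) *\<^sub>C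
          integral {0..1} (\<lambda>s. fejer K (s - t j) *\<^sub>R orbit z x s)"
        unfolding z'_def fejer_synthesis ..
      finally have "(U j) (q j) = (1 / sqrt (real N)) *\<^sub>R
          (of_real (c j) * (cis (2 * pi * (real K * t j)) * cis (- (2 * pi * (real K * t j))))) *\<^sub>C
          exp (z * of_real (1 - t j)) *\<^sub>C (T (1 - t j)) (integral {0..1} (\<lambda>s. fejer K (s - t j) *\<^sub>R orbit z x s))"
        using t01[OF j] by (simp add: U_def blinfun_apply_scaleC blinfun.scaleR_right T_scaleC scaleC_scaleR scaleC_scaleC mult_ac)
      also have "cis (2 * pi * (real K * t j)) * cis (- (2 * pi * (real K * t j))) = 1"
        by (simp add: cis_mult)
      finally show ?thesis
        using orbit_shift_integral[OF t01[OF j]] by (simp add: y_def scaleC_of_real)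
    qed
    have "norm ((1 / sqrt (2 ^ (K0 + 2))) *\<^sub>R (\<Sum>j<2 ^ (K0 + 2). (U j) (q j))) \<le> gn {..<N} (\<lambda>j. (U j) (q j))"
      unfolding N(1) by (rule norm_mean_le_gn)
    also have "\<dots> \<le> exp \<bar>\<alpha>\<bar> * C * gn {..<N} q"
      by (rule has_gamma_boundD[OF gamma_weighted]) (use U in auto)
    also have "\<dots> \<le> E * (B * norm u)"
      unfolding E_def[symmetric] by (rule mult_left_mono[OF gq E])
    finally have 1: "norm ((1 / sqrt (real N)) *\<^sub>R (\<Sum>j<N. (U j) (q j))) \<le> E * B * norm u"
      by (simp add: N(1) mult.assoc)
    have "(1 / sqrt (real N)) *\<^sub>R (\<Sum>j<N. (U j) (q j)) =
        (1 / sqrt (real N)) *\<^sub>R (1 / sqrt (real N)) *\<^sub>R (\<Sum>j<N. c j *\<^sub>R y K (t j))"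
      using Uq by (simp add: scaleR_sum_right)
    also have "\<dots> = (1 / real N) *\<^sub>R (\<Sum>j<N. c j *\<^sub>R y K (t j))"
    proof -
      have "(1 / sqrt (real N)) * (1 / sqrt (real N)) = 1 / real N" by simp
      then show ?thesis by (simp only: scaleR_scaleR)
    qed
    also have "(\<Sum>j<N. c j *\<^sub>R y K (t j)) = (\<Sum>j\<in>{M..<3 * M}. y K (t j))"
    proof -
      have "(\<Sum>j\<in>{M..<3 * M}. y K (t j)) = (\<Sum>j\<in>{M..<3 * M}. c j *\<^sub>R y K (t j))"
        by (intro sum.cong) (auto simp: c_def)
      also have "\<dots> = (\<Sum>j<N. c j *\<^sub>R y K (t j))"
        by (rule sum.mono_neutral_left) (auto simp: c_def N(2))
      finally show ?thesis ..
    qed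
    finally have 2: "norm ((1 / real N) *\<^sub>R (\<Sum>j\<in>{M..<3 * M}. y K (t j))) \<le> E * B * norm u"
      using 1 by simp
    have "norm (\<Sum>j\<in>{M..<3 * M}. y K (t j) - orbit z x 1) \<le> (\<Sum>j\<in>{M..<3 * M}. e)"
    proof (rule sum_norm_le)
      fix j assume "j \<in> {M..<3 * M}"
      then have "t j \<in> {1/4..3/4}" using N(2,3) by (auto simp: t_def field_simps)
      then show "norm (y K (t j) - orbit z x 1) \<le> e" using K0 \<open>K0 \<le> K\<close> by blast
    qed
    then have "norm ((\<Sum>j\<in>{M..<3 * M}. y K (t j)) - (2 * real M) *\<^sub>R orbit z x 1) \<le> 2 * real M * e"
      by (simp add: sum_subtractf sum_constant_scaleR)
    then have "norm ((2 * real M) *\<^sub>R orbit z x 1) \<le> 2 * real M * e + norm (\<Sum>j\<in>{M..<3 * M}. y K (t j))"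
      using norm_triangle_sub[of "(2 * real M) *\<^sub>R orbit z x 1" "\<Sum>j\<in>{M..<3 * M}. y K (t j)"]
      by (simp add: norm_minus_commute)
    moreover have "norm (\<Sum>j\<in>{M..<3 * M}. y K (t j)) \<le> 4 * real M * (E * B * norm u)"
      using 2 N(2,3) by (simp add: field_simps)
    ultimately have "2 * real M * norm (orbit z x 1) \<le> 2 * real M * (e + 2 * (E * B * norm u))"
      by (simp add: algebra_simps)
    then have "norm (orbit z x 1) \<le> e + 2 * (E * B * norm u)"
      using N(3) by simp
    then show "norm (orbit z x 1) \<le> 2 * E * B * norm (orbit z x 1 - x) + e"
      by (simp add: u_def mult.assoc)
  qed
  moreover have "0 \<le> 2 * E * B" using E B(1) by simp
  ultimately show ?thesis by blast
qed

end

section \<open>An elementary spectral radius argument\<close>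

lemma roots_of_unity_average:
  assumes "m < N" "n < N"
  shows "(\<Sum>j<N. cis (2 * pi * (real j * (real n - real m) / real N))) = (if n = m then of_nat N else 0)"
proof (cases "n = m")
  case False
  define w where "w = cis (2 * pi * ((real n - real m) / real N))"
  have pow: "cis (2 * pi * (real j * (real n - real m) / real N)) = w ^ j" for j
    by (simp add: w_def Complex.DeMoivre mult_ac)
  have "w \<noteq> 1"
  proof
    assume "w = 1"
    then have "cos (2 * pi * ((real n - real m) / real N)) = 1" by (simp add: w_def complex_eq_iff)
    then obtain k :: int where "2 * pi * ((real n - real m) / real N) = of_int k * 2 * pi"
      unfolding cos_one_2pi_int by blast
    then have "2 * pi * ((real n - real m) / real N) = 2 * pi * of_int k" by (simp only: mult_ac)
    then have "(real n - real m) / real N = of_int k"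
      by (rule mult_left_cancel[of "2 * pi", THEN iffD1, rotated]) simp
    then have "real n - real m = of_int k * real N" using assms by (simp add: field_simps)
    then have "of_int (int n - int m) = (of_int (k * int N) :: real)" by simp
    then have k: "int n - int m = k * int N" by (simp only: of_int_eq_iff)
    then have "k \<noteq> 0" using False by auto
    then have "1 * int N \<le> \<bar>k\<bar> * int N" by (intro mult_right_mono) auto
    then have "int N \<le> \<bar>k * int N\<bar>" by (simp add: abs_mult)
    then show False using k assms by linarith
  qed
  moreover have "w ^ N = 1"
  proof -
    have "w ^ N = cis (2 * pi * of_int (int n - int m))"
      using assms by (simp add: w_def Complex.DeMoivre)
    then show ?thesis by (simp del: of_int_diff)
  qed
  ultimately show ?thesis using False unfolding pow by (simp add: sum_gp_strict)
qed simp

text \<open>Cauchy's estimate for the coefficients of a polynomial, with an average over roots of unity in place of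
a contour integral.\<close>

lemma coefficient_extraction:
  fixes v :: "nat \<Rightarrow> 'a :: complex_banach"
  assumes m: "m < N" and r: "0 \<le> r"
    and bound: "\<And>\<mu>. cmod \<mu> = r \<Longrightarrow> norm (\<Sum>n<N. \<mu> ^ n *\<^sub>C v n) \<le> b"
  shows "r ^ m * norm (v m) \<le> b"
proof -
  define \<mu> where "\<mu> = (\<lambda>j. of_real r * cis (2 * pi * (real j / real N)))"
  define c where "c = (\<lambda>j. cis (- (2 * pi * (real j * real m / real N))))"
  have cl: "c j * \<mu> j ^ n = of_real (r ^ n) * cis (2 * pi * (real j * (real n - real m) / real N))" for j n
    unfolding c_def \<mu>_def power_mult_distrib Complex.DeMoivre
    by (simp add: cis_mult mult.left_commute diff_divide_distrib algebra_simps)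
  have "(\<Sum>j<N. c j *\<^sub>C (\<Sum>n<N. \<mu> j ^ n *\<^sub>C v n)) = (\<Sum>n<N. (\<Sum>j<N. c j * \<mu> j ^ n) *\<^sub>C v n)"
    unfolding scaleC.sum_right scaleC.sum_left scaleC_scaleC by (rule sum.swap)
  also have "\<dots> = (\<Sum>n<N. if n = m then (of_nat N * of_real (r ^ m)) *\<^sub>C v m else 0)"
  proof (rule sum.cong[OF refl])
    fix n assume "n \<in> {..<N}"
    then show "(\<Sum>j<N. c j * \<mu> j ^ n) *\<^sub>C v n = (if n = m then (of_nat N * of_real (r ^ m)) *\<^sub>C v m else 0)"
      unfolding cl sum_distrib_left[symmetric] using roots_of_unity_average[OF m, of n] by (auto simp: mult.commute)
  qed
  also have "\<dots> = (of_nat N * of_real (r ^ m)) *\<^sub>C v m" using m by simp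
  finally have "norm ((of_nat N * of_real (r ^ m)) *\<^sub>C v m) = norm (\<Sum>j<N. c j *\<^sub>C (\<Sum>n<N. \<mu> j ^ n *\<^sub>C v n))"
    by simp
  also have "\<dots> \<le> (\<Sum>j<N. b)"
  proof (rule sum_norm_le)
    fix j
    have "cmod (\<mu> j) = r" using r by (simp add: \<mu>_def norm_mult)
    then show "norm (c j *\<^sub>C (\<Sum>n<N. \<mu> j ^ n *\<^sub>C v n)) \<le> b"
      using bound by (simp add: norm_scaleC c_def)
  qed
  finally have "real N * (r ^ m * norm (v m)) \<le> real N * b"
    using r by (simp add: norm_scaleC norm_mult norm_power mult.assoc)
  then show ?thesis using m by simp
qed

text \<open>Division of \<open>n\<close> by \<open>m\<close> with remainder gives \<open>b n \<le> 2 B \<rho>\<^sup>n\<close> with \<open>\<rho> = 2\<^bsup>-1/m\<^esup>\<close>, and a geometric decay absorbs the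
linear factor.\<close>

lemma semigroup_geometric_decay:
  fixes b :: "nat \<Rightarrow> real"
  assumes nonneg: "\<And>n. 0 \<le> b n" and mult: "\<And>n k. b (n + k) \<le> b n * b k"
    and m: "0 < m" "b m \<le> 1 / 2"
  shows "(\<lambda>n. real (Suc n) * b n) \<longlonglongrightarrow> 0"
proof -
  define \<rho> where "\<rho> = root m (1 / 2)"
  have \<rho>: "0 < \<rho>" "\<rho> < 1" "\<rho> ^ m = 1 / 2" using m by (simp_all add: \<rho>_def)
  define B where "B = (\<Sum>i<m. b i)"
  have B: "b i \<le> B" if "i < m" for i
    unfolding B_def using that nonneg by (intro member_le_sum) auto
  have B0: "0 \<le> B" unfolding B_def by (simp add: sum_nonneg nonneg)
  have pow: "b (q * m + i) \<le> (1 / 2) ^ q * b i" for q i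
  proof (induction q)
    case (Suc q)
    have "b (Suc q * m + i) \<le> b m * b (q * m + i)" using mult[of m "q * m + i"] by (simp add: add.assoc)
    also have "\<dots> \<le> 1 / 2 * ((1 / 2) ^ q * b i)"
      using m(2) nonneg Suc by (intro mult_mono) auto
    finally show ?case by simp
  qed simp
  have le: "b n \<le> 2 * B * \<rho> ^ n" for n
  proof -
    have "b n \<le> (1 / 2) ^ (n div m) * b (n mod m)" using pow[of "n div m" "n mod m"] by simp
    also have "\<dots> \<le> (1 / 2) ^ (n div m) * B" using m by (intro mult_left_mono B) auto
    also have "(1 / 2) ^ (n div m) = \<rho> ^ (m * (n div m))" by (simp add: power_mult \<rho>)
    also have "\<dots> = 2 * \<rho> ^ (m * (n div m) + m)" by (simp add: power_add \<rho>)
    also have "\<dots> \<le> 2 * \<rho> ^ n"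
    proof -
      have "n \<le> m * (n div m) + m"
        using mult_div_mod_eq[of m n] mod_less_divisor[OF m(1), of n] by linarith
      then show ?thesis using \<rho> by (intro mult_left_mono power_decreasing) auto
    qed
    finally show ?thesis using B0 by (simp add: mult_ac mult_right_mono)
  qed
  have "(\<lambda>n. real n * \<rho> ^ n) \<longlonglongrightarrow> 0" using \<rho> by (intro powser_times_n_limit_0) auto
  moreover have "(\<lambda>n. \<rho> ^ n) \<longlonglongrightarrow> 0" using \<rho> by (intro LIMSEQ_power_zero) auto
  ultimately have "(\<lambda>n. 2 * B * (real n * \<rho> ^ n + \<rho> ^ n)) \<longlonglongrightarrow> 2 * B * (0 + 0)"
    by (intro tendsto_mult_left tendsto_add)
  then have lim: "(\<lambda>n. 2 * B * (real n * \<rho> ^ n + \<rho> ^ n)) \<longlonglongrightarrow> 0" by simp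
  show ?thesis
  proof (rule tendsto_sandwich[OF _ _ tendsto_const lim])
    show "eventually (\<lambda>n. 0 \<le> real (Suc n) * b n) sequentially" using nonneg by simp
    have "real (Suc n) * b n \<le> 2 * B * (real n * \<rho> ^ n + \<rho> ^ n)" for n
      using mult_left_mono[OF le[of n], of "real (Suc n)"] by (simp add: algebra_simps)
    then show "eventually (\<lambda>n. real (Suc n) * b n \<le> 2 * B * (real n * \<rho> ^ n + \<rho> ^ n)) sequentially" by simp
  qed
qed

text \<open>The powers \<open>V\<^sub>n = S\<^sup>n\<close> of an operator \<open>S\<close> for which \<open>I - \<mu> S\<close> is bounded below uniformly in the closed unit
disc. That some power is a contraction is shown without inverses and without complex analysis:
where the powers of \<open>r S\<close> decay, the truncated power series of \<open>(I - \<mu> S)\<^sup>-\<^sup>2\<close>, \<open>|\<mu>| = r\<close>, is almost bounded by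
\<open>K\<^sup>2\<close>. Its coefficients grow linearly, and so Cauchy's estimate \<open>(m + 1) r\<^sup>m \<parallel>V\<^sub>m\<parallel> \<le> K\<^sup>2\<close> forces
decay at a rate that does not depend on \<open>r\<close>. This allows \<open>r\<close> to be increased up to 1.\<close>

locale operator_powers =
  fixes V :: "nat \<Rightarrow> 'a :: complex_banach \<Rightarrow>\<^sub>L 'a" and K :: real
  assumes V0: "V 0 = id_blinfun" and V_add: "\<And>m n. V (m + n) = V m o\<^sub>L V n"
    and V_complex: "\<And>n. V n \<in> complex_ops"
    and below: "\<And>\<mu> x. cmod \<mu> \<le> 1 \<Longrightarrow> norm x \<le> K * norm (x - \<mu> *\<^sub>C (V 1) x)"
    and K: "0 \<le> K"
begin

lemma V_Suc: "(V 1) ((V n) x) = (V (Suc n)) x"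
  using V_add[of 1 n] by simp

lemma V_lin: "(V 1) (c *\<^sub>C x) = c *\<^sub>C (V 1) x"
  using V_complex by (simp add: complex_ops_def)

lemma telescope:
  "(\<Sum>n<N. \<mu> ^ n *\<^sub>C f n) - \<mu> *\<^sub>C (\<Sum>n<N. \<mu> ^ n *\<^sub>C g n) = (\<Sum>n<N. \<mu> ^ n *\<^sub>C f n - \<mu> ^ Suc n *\<^sub>C g n)"
  for f g :: "nat \<Rightarrow> 'a"
  by (simp add: sum_subtractf scaleC.sum_right scaleC_scaleC)

text \<open>The operator \<open>I - \<mu> V\<^sub>1\<close> maps \<open>w = \<Sum>\<^bsub>n<N\<^esub> (n + 1) \<mu>\<^sup>n V\<^sub>n x\<close> to \<open>v = \<Sum>\<^bsub>n<N\<^esub> \<mu>\<^sup>n V\<^sub>n x\<close>, and \<open>v\<close> to \<open>x\<close>, up to terms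
that carry the factor \<open>\<mu>\<^sup>N\<close>. The lower bound is applied twice.\<close>

lemma resolvent_power_bounds:
  assumes \<mu>: "cmod \<mu> = r" "r \<le> 1"
  shows "norm (\<Sum>n<N. \<mu> ^ n *\<^sub>C (real (Suc n) *\<^sub>R (V n) x))
    \<le> (K * K + (K * K + K) * (real (Suc N) * (r ^ N * norm (V N)))) * norm x"
proof -
  have r: "0 \<le> r" using \<mu>(1) by auto
  define v where "v = (\<Sum>n<N. \<mu> ^ n *\<^sub>C (V n) x)"
  define w where "w = (\<Sum>n<N. \<mu> ^ n *\<^sub>C (real (Suc n) *\<^sub>R (V n) x))"
  define h where "h = r ^ N * norm (V N)"
  have h: "0 \<le> h" using r by (simp add: h_def)
  have last: "norm (\<mu> ^ N *\<^sub>C (V N) x) \<le> h * norm x"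
    using mult_left_mono[OF norm_blinfun[of "V N" x], of "r ^ N"] r \<mu>
    by (simp add: norm_scaleC norm_power h_def mult.assoc)
  have "(V 1) v = (\<Sum>n<N. \<mu> ^ n *\<^sub>C (V (Suc n)) x)"
    unfolding v_def blinfun.sum_right V_lin V_Suc ..
  then have "v - \<mu> *\<^sub>C (V 1) v = (\<Sum>n<N. \<mu> ^ n *\<^sub>C (V n) x - \<mu> ^ Suc n *\<^sub>C (V (Suc n)) x)"
    unfolding v_def by (simp only: telescope)
  also have "\<dots> = x - \<mu> ^ N *\<^sub>C (V N) x"
    using sum_lessThan_telescope'[of "\<lambda>n. \<mu> ^ n *\<^sub>C (V n) x" N] by (simp add: V0)
  finally have "norm v \<le> K * norm (x - \<mu> ^ N *\<^sub>C (V N) x)"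
    using below[of \<mu> v] \<mu> by simp
  also have "\<dots> \<le> K * (norm x + h * norm x)"
    using norm_triangle_ineq4[of x "\<mu> ^ N *\<^sub>C (V N) x"] last K by (intro mult_left_mono) auto
  finally have v: "norm v \<le> K * (norm x + h * norm x)" .
  have "(V 1) w = (\<Sum>n<N. \<mu> ^ n *\<^sub>C (real (Suc n) *\<^sub>R (V (Suc n)) x))"
    unfolding w_def blinfun.sum_right V_lin blinfun.scaleR_right V_Suc ..
  then have "w - \<mu> *\<^sub>C (V 1) w = (\<Sum>n<N. \<mu> ^ n *\<^sub>C (real (Suc n) *\<^sub>R (V n) x)
      - \<mu> ^ Suc n *\<^sub>C (real (Suc n) *\<^sub>R (V (Suc n)) x))"
    unfolding w_def by (simp only: telescope)
  also have "\<dots> = (\<Sum>n<N. \<mu> ^ n *\<^sub>C (V n) x) +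
      (\<Sum>n<N. \<mu> ^ n *\<^sub>C (real n *\<^sub>R (V n) x) - \<mu> ^ Suc n *\<^sub>C (real (Suc n) *\<^sub>R (V (Suc n)) x))"
    unfolding sum.distrib[symmetric]
    by (intro sum.cong refl) (simp add: scaleR_left_distrib scaleC_add_right)
  also have "\<dots> = v - real N *\<^sub>R \<mu> ^ N *\<^sub>C (V N) x"
    using sum_lessThan_telescope'[of "\<lambda>n. \<mu> ^ n *\<^sub>C (real n *\<^sub>R (V n) x)" N]
    by (simp only: v_def scaleC_scaleR) simp
  finally have "norm w \<le> K * norm (v - real N *\<^sub>R \<mu> ^ N *\<^sub>C (V N) x)"
    using below[of \<mu> w] \<mu> by simp
  also have "\<dots> \<le> K * (K * (norm x + h * norm x) + real N * (h * norm x))"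
    using norm_triangle_ineq4[of v "real N *\<^sub>R \<mu> ^ N *\<^sub>C (V N) x"] v K
      mult_left_mono[OF last, of "real N"]
    by (intro mult_left_mono) auto
  also have "\<dots> = (K * K + (K * K * h + K * (real N * h))) * norm x" by (simp add: algebra_simps)
  also have "\<dots> \<le> (K * K + (K * K + K) * (real (Suc N) * h)) * norm x"
  proof (intro mult_right_mono add_left_mono)
    have "K * K * h + K * (real N * h) \<le> K * K * (real (Suc N) * h) + K * (real (Suc N) * h)"
      using K h by (intro add_mono mult_left_mono) (auto simp: algebra_simps)
    then show "K * K * h + K * (real N * h) \<le> (K * K + K) * (real (Suc N) * h)" by (simp add: algebra_simps)
  qed simp
  finally show ?thesis by (simp add: w_def h_def)
qed

lemma weighted_power_bound:
  assumes r: "0 \<le> r" "r \<le> 1" and lim: "(\<lambda>n. real (Suc n) * (r ^ n * norm (V n))) \<longlonglongrightarrow> 0"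
  shows "real (Suc m) * (r ^ m * norm (V m)) \<le> K * K"
proof -
  have "real (Suc m) * r ^ m * norm ((V m) x) \<le> K * K * norm x" for x
  proof (rule LIMSEQ_le_const)
    show "(\<lambda>N. (K * K + (K * K + K) * (real (Suc N) * (r ^ N * norm (V N)))) * norm x) \<longlonglongrightarrow> K * K * norm x"
      using tendsto_mult_right[OF tendsto_add[OF tendsto_const tendsto_mult_left[OF lim]], of "K * K" "K * K + K" "norm x"]
      by simp
    have "real (Suc m) * r ^ m * norm ((V m) x) \<le> (K * K + (K * K + K) * (real (Suc N) * (r ^ N * norm (V N)))) * norm x"
      if "Suc m \<le> N" for N
    proof -
      have "r ^ m * norm (real (Suc m) *\<^sub>R (V m) x) \<le> (K * K + (K * K + K) * (real (Suc N) * (r ^ N * norm (V N)))) * norm x"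
        by (rule coefficient_extraction[of m N]) (use that r resolvent_power_bounds in auto)
      then show ?thesis by (simp add: mult_ac)
    qed
    then show "\<exists>N0. \<forall>N\<ge>N0. real (Suc m) * r ^ m * norm ((V m) x) \<le> (K * K + (K * K + K) * (real (Suc N) * (r ^ N * norm (V N)))) * norm x"
      by blast
  qed
  then have "norm ((real (Suc m) * r ^ m) *\<^sub>R V m) \<le> K * K"
    using r K by (intro norm_blinfun_bound) (simp_all add: blinfun.scaleR_left abs_mult)
  then show ?thesis using r by (simp add: abs_mult mult.assoc)
qed

text \<open>Choose \<open>m\<close> with \<open>m + 1 \<ge> 4K\<^sup>2\<close>. If the powers of \<open>r S\<close> decay, then \<open>r\<^sup>m \<parallel>V\<^sub>m\<parallel> \<le> 1/4\<close>, and replacing \<open>r\<close> by \<open>2\<^bsup>1/m\<^esup> r\<close> only doubles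
this, so that the powers still decay. The step does not depend on \<open>r\<close>, and \<open>r = 1\<close> is
reached after finitely many steps.\<close>

lemma eventual_contraction: "\<exists>m>0. norm (V m) \<le> 1 / 2"
proof -
  define m where "m = Suc (nat \<lceil>4 * (K * K)\<rceil>)"
  have m: "0 < m" "4 * (K * K) \<le> real (Suc m)"
  proof -
    show "0 < m" by (simp add: m_def)
    have "4 * (K * K) \<le> real (nat \<lceil>4 * (K * K)\<rceil>)" by (rule real_nat_ceiling_ge)
    then show "4 * (K * K) \<le> real (Suc m)" unfolding m_def of_nat_Suc by linarith
  qed
  define Q where "Q = (\<lambda>r. (\<lambda>n. real (Suc n) * (r ^ n * norm (V n))) \<longlonglongrightarrow> 0)"
  have decay: "Q r" if "0 \<le> r" "0 < k" "r ^ k * norm (V k) \<le> 1 / 2" for r k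
    unfolding Q_def
  proof (rule semigroup_geometric_decay)
    show "r ^ (n + l) * norm (V (n + l)) \<le> r ^ n * norm (V n) * (r ^ l * norm (V l))" for n l
    proof -
      have "norm (V (n + l)) \<le> norm (V n) * norm (V l)" by (simp add: V_add norm_blinfun_compose)
      then have "r ^ (n + l) * norm (V (n + l)) \<le> r ^ (n + l) * (norm (V n) * norm (V l))"
        using that(1) by (intro mult_left_mono) auto
      then show ?thesis by (simp add: power_add mult_ac)
    qed
  qed (use that in auto)
  have small: "r ^ m * norm (V m) \<le> 1 / 4" if "0 \<le> r" "r \<le> 1" "Q r" for r
  proof -
    have "real (Suc m) * (r ^ m * norm (V m)) \<le> K * K"
      using that unfolding Q_def by (intro weighted_power_bound)
    also have "\<dots> \<le> real (Suc m) * (1 / 4)" using m(2) by simp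
    finally show ?thesis by (rule mult_left_le_imp_le) simp
  qed
  define c where "c = root m 2"
  have c: "1 < c" "c ^ m = 2" using m by (simp_all add: c_def)
  define r0 where "r0 = 1 / (2 * (norm (V 1) + 1))"
  have r0: "0 < r0" by (simp add: r0_def add_nonneg_pos)
  define r where "r = (\<lambda>k. min 1 (r0 * c ^ k))"
  have r: "0 \<le> r k" "r k \<le> 1" for k using r0 c by (auto simp: r_def)
  have "Q (r k)" for k
  proof (induction k)
    case 0
    have "r0 * norm (V 1) \<le> 1 / 2"
    proof -
      have "0 < norm (V 1) + 1" by (simp add: add_nonneg_pos)
      then show ?thesis unfolding r0_def by (simp add: field_simps)
    qed
    moreover have "r 0 \<le> r0" by (simp add: r_def)
    ultimately have "r 0 ^ 1 * norm (V 1) \<le> 1 / 2"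
      using mult_right_mono[of "r 0" r0 "norm (V 1)"] by simp
    then show ?case using decay[OF r(1), of 1] by simp
  next
    case (Suc k)
    have "r (Suc k) \<le> c * r k"
    proof (cases "r0 * c ^ k \<le> 1")
      case True
      then show ?thesis by (simp add: r_def mult_ac)
    next
      case False
      then show ?thesis using c(1) by (simp add: r_def)
    qed
    then have "r (Suc k) ^ m * norm (V m) \<le> (c * r k) ^ m * norm (V m)"
      using r by (intro mult_right_mono power_mono) auto
    also have "\<dots> = 2 * (r k ^ m * norm (V m))" by (simp add: power_mult_distrib c)
    also have "\<dots> \<le> 1 / 2" using small[OF r Suc] by simp
    finally show ?case using decay[OF r(1) m(1)] by simp
  qed
  moreover obtain k where "1 / r0 < c ^ k" using real_arch_pow[OF c(1)] by blast
  then have "r k = 1" using r0 by (simp add: r_def field_simps min_def)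
  ultimately have "Q 1" by metis
  then show ?thesis using small[of 1] m(1) by (intro exI[of _ m]) auto
qed

end

section \<open>Comparison of the abscissae\<close>

text \<open>Multiples of a single operator are \<open>\<gamma>\<close>-bounded by the contraction principle, and \<open>\<gamma>\<close>-bounds add up.\<close>

lemma gamma_bound_sum_of_multiples:
  fixes S :: "nat \<Rightarrow> 'a :: complex_banach \<Rightarrow>\<^sub>L 'a"
  assumes S: "\<And>n. S n \<in> complex_ops" and c: "\<And>n. 0 \<le> c n" 
  shows "has_gamma_bound (\<Sum>n<M. c n * norm (S n)) {\<Sum>n<M. d n *\<^sub>C S n | d. \<forall>n. cmod (d n) \<le> c n}"
  unfolding has_gamma_bound_def
proof (intro conjI allI impI)
  show "0 \<le> (\<Sum>n<M. c n * norm (S n))" using c by (simp add: sum_nonneg)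
  fix N :: nat and U :: "nat \<Rightarrow> 'a \<Rightarrow>\<^sub>L 'a" and x :: "nat \<Rightarrow> 'a"
  assume "\<forall>i<N. U i \<in> {\<Sum>n<M. d n *\<^sub>C S n | d. \<forall>n. cmod (d n) \<le> c n}"
  then obtain d where d: "\<And>i. i < N \<Longrightarrow> U i = (\<Sum>n<M. d i n *\<^sub>C S n) \<and> (\<forall>n. cmod (d i n) \<le> c n)"
    by simp metis
  have "gn {..<N} (\<lambda>i. (U i) (x i)) = gn {..<N} (\<lambda>i. \<Sum>n<M. (S n) (d i n *\<^sub>C x i))"
    using d S by (intro gn_cong) (simp add: blinfun.sum_left blinfun_apply_scaleC complex_ops_def)
  also have "\<dots> \<le> (\<Sum>n<M. gn {..<N} (\<lambda>i. (S n) (d i n *\<^sub>C x i)))"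
    by (rule gn_sum) auto
  also have "\<dots> \<le> (\<Sum>n<M. norm (S n) * (c n * gn {..<N} x))"
  proof (rule sum_mono)
    fix n
    have "gn {..<N} (\<lambda>i. (S n) (d i n *\<^sub>C x i)) \<le> norm (S n) * gn {..<N} (\<lambda>i. d i n *\<^sub>C x i)"
      by (rule gn_operator) (use S in auto)
    also have "\<dots> \<le> norm (S n) * (c n * gn {..<N} x)"
      using d c by (intro mult_left_mono gn_contract) auto
    finally show "gn {..<N} (\<lambda>i. (S n) (d i n *\<^sub>C x i)) \<le> norm (S n) * (c n * gn {..<N} x)" .
  qed
  also have "\<dots> = (\<Sum>n<M. c n * norm (S n)) * gn {..<N} x"
    by (subst sum_distrib_right) (simp only: mult_ac)
  finally show "gn {..<N} (\<lambda>i. (U i) (x i)) \<le> (\<Sum>n<M. c n * norm (S n)) * gn {..<N} x" .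
qed

lemma has_gamma_bound_mono:
  fixes \<T> :: "('a :: complex_banach \<Rightarrow>\<^sub>L 'a) set"
  shows "has_gamma_bound C \<T> \<Longrightarrow> C \<le> D \<Longrightarrow> has_gamma_bound D \<T>"
proof -
  assume C: "has_gamma_bound C \<T>" and le: "C \<le> D"
  show "has_gamma_bound D \<T>"
    unfolding has_gamma_bound_def
  proof (intro conjI allI impI)
    show "0 \<le> D" using C le by (simp add: has_gamma_bound_def)
    fix N :: nat and T :: "nat \<Rightarrow> 'a \<Rightarrow>\<^sub>L 'a" and x :: "nat \<Rightarrow> 'a"
    assume "\<forall>n<N. T n \<in> \<T>"
    then have "gn {..<N} (\<lambda>n. (T n) (x n)) \<le> C * gn {..<N} x"
      by (intro has_gamma_boundD[OF C]) auto
    also have "\<dots> \<le> D * gn {..<N} x" using le by (intro mult_right_mono) auto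
    finally show "gn {..<N} (\<lambda>n. (T n) (x n)) \<le> D * gn {..<N} x" .
  qed
qed

lemma exp_weight_cancel:
  fixes w t n K :: real
  assumes "exp (w * t) * n \<le> K" shows "n \<le> K * exp (- w * t)"
proof -
  have "exp (- w * t) * (exp (w * t) * n) \<le> exp (- w * t) * K"
    using assms by (rule mult_left_mono) simp
  moreover have "exp (- w * t) * exp (w * t) = 1" by (simp add: mult_exp_exp)
  then have "exp (- w * t) * (exp (w * t) * n) = n" by (simp only: mult.assoc[symmetric] mult_1)
  ultimately show ?thesis by (simp only: mult.commute)
qed

context gamma_bounded_semigroup
begin

text \<open>One contractive time \<open>m\<close> suffices, by division of \<open>t\<close> by \<open>m\<close> with remainder.\<close>

lemma growth_from_contraction:
  assumes m: "0 < m" "exp (\<omega> * real m) * norm (T (real m)) \<le> 1"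
  shows "\<exists>K>0. \<forall>t\<ge>0. norm (T t) \<le> K * exp (- \<omega> * t)"
proof -
  obtain B where B: "0 \<le> B" "\<And>t. t \<in> {0..real m} \<Longrightarrow> norm (T t) \<le> B" using T_bounded_on by blast
  define K where "K = exp (\<bar>\<omega>\<bar> * real m) * B + 1"
  have step: "exp (\<omega> * (real (q * m) + r)) * norm (T (real (q * m) + r)) \<le> K" if r: "0 \<le> r" "r \<le> real m" for q r
  proof (induction q)
    case 0
    have "\<omega> * r \<le> \<bar>\<omega>\<bar> * real m" using r by (intro mult_mono) auto
    then have "exp (\<omega> * r) * norm (T r) \<le> exp (\<bar>\<omega>\<bar> * real m) * B"
      using B r by (intro mult_mono) auto
    then show ?case by (simp add: K_def)
  next
    case (Suc q)
    let ?t = "real (q * m) + r"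
    have e: "real (Suc q * m) + r = real m + ?t" by simp
    have "norm (T (real m + ?t)) \<le> norm (T (real m)) * norm (T ?t)"
      using T_add[of "real m" ?t] r by (simp add: norm_blinfun_compose)
    then have "exp (\<omega> * (real m + ?t)) * norm (T (real m + ?t)) \<le> exp (\<omega> * (real m + ?t)) * (norm (T (real m)) * norm (T ?t))"
      by (intro mult_left_mono) auto
    also have "\<dots> = (exp (\<omega> * real m) * norm (T (real m))) * (exp (\<omega> * ?t) * norm (T ?t))"
      by (simp add: distrib_left exp_add mult_ac)
    also have "\<dots> \<le> 1 * K"
      using m(2) Suc by (intro mult_mono) auto
    finally show ?case unfolding e by simp
  qed
  have "norm (T t) \<le> K * exp (- \<omega> * t)" if t: "0 \<le> t" for t
  proof -
    define q where "q = nat \<lfloor>t / real m\<rfloor>"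
    have q: "real q = of_int \<lfloor>t / real m\<rfloor>" using t m(1) by (simp add: q_def)
    have "of_int \<lfloor>t / real m\<rfloor> \<le> t / real m" "t / real m < of_int \<lfloor>t / real m\<rfloor> + 1" by linarith+
    then have "real q * real m \<le> t" "t < (real q + 1) * real m"
      using m(1) unfolding q[symmetric] by (simp_all only: pos_le_divide_eq pos_divide_less_eq of_nat_0_less_iff)
    then have r: "0 \<le> t - real (q * m)" "t - real (q * m) \<le> real m"
      unfolding of_nat_mult distrib_right by linarith+
    have "exp (\<omega> * t) * norm (T t) \<le> K"
      using step[OF r, of q] by simp
    then show ?thesis by (rule exp_weight_cancel)
  qed
  moreover have "0 < K" using B(1) by (simp add: K_def add_nonneg_pos)
  ultimately show ?thesis by blast
qed

text \<open>Every \<open>\<mu> \<noteq> 0\<close> in the closed unit disc has the form \<open>\<mu> = e\<^bsup>z-\<alpha>\<^esup>\<close> with \<open>Re z \<le> \<alpha>\<close>, so that the bound from below for the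
orbits is the hypothesis of the spectral radius argument for \<open>e\<^sup>\<alpha> T\<^sub>1\<close>.\<close>

lemma growth_from_resolvent:
  assumes spec: "spectrum A \<subseteq> {z. Re z > \<alpha>}"
    and D: "has_gamma_bound D {resolvent z A | z. Re z \<le> \<alpha>}"
  shows "\<exists>K>0. \<forall>t\<ge>0. norm (T t) \<le> K * exp (- \<alpha> * t)"
proof -
  obtain B where B: "0 \<le> B" "\<And>z x. Re z \<le> \<alpha> \<Longrightarrow> norm (orbit z x 1) \<le> B * norm (orbit z x 1 - x)"
    using orbit_bounded_below[OF spec D] by blast
  define V where "V = (\<lambda>n. exp (\<alpha> * real n) *\<^sub>R T (real n))"
  have V: "(V n) x = exp (\<alpha> * real n) *\<^sub>R (T (real n)) x" for n x
    by (simp add: V_def blinfun.scaleR_left)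
  interpret operator_powers V "B + 1"
  proof
    show "V 0 = id_blinfun" by (simp add: V_def T_zero)
    show "V (m + n) = V m o\<^sub>L V n" for m n
      by (rule blinfun_eqI) (simp add: V T_add_apply distrib_left exp_add blinfun.scaleR_right)
    show "V n \<in> complex_ops" for n
      by (simp add: complex_ops_def V T_scaleC scaleC_scaleR)
    show "0 \<le> B + 1" using B(1) by simp
    fix \<mu> :: complex and x :: 'a assume \<mu>: "cmod \<mu> \<le> 1"
    show "norm x \<le> (B + 1) * norm (x - \<mu> *\<^sub>C (V 1) x)"
    proof (cases "\<mu> = 0")
      case True
      then show ?thesis using B(1) by (simp add: distrib_right)
    next
      case False
      define z where "z = Ln \<mu> + of_real \<alpha>"
      have z: "Re z \<le> \<alpha>" using \<mu> False by (simp add: z_def)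
      have o: "orbit z x 1 = \<mu> *\<^sub>C (V 1) x"
        using False by (simp add: orbit_def z_def exp_add V exp_of_real scaleC_scaleC flip: scaleC_of_real)
      have "norm (orbit z x 1) \<le> B * norm (x - orbit z x 1)"
        using B(2)[OF z, of x] by (simp only: norm_minus_commute)
      then show ?thesis
        using norm_triangle_sub[of x "orbit z x 1"] unfolding o by (simp add: distrib_right)
    qed
  qed
  obtain m where m: "0 < m" "norm (V m) \<le> 1 / 2" using eventual_contraction by blast
  show ?thesis
    by (rule growth_from_contraction[OF m(1)]) (use m(2) in \<open>simp add: V_def\<close>)
qed

lemma summable_from_growth:
  assumes K: "\<And>t. 0 \<le> t \<Longrightarrow> norm (T t) \<le> K * exp (- \<omega> * t)" and less: "\<alpha> < \<omega>"
  shows "summable (\<lambda>n. exp (\<alpha> * real n) * norm (T (real n)))"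
proof (rule summable_comparison_test)
  have "norm (exp (\<alpha> * real n) * norm (T (real n))) \<le> K * exp (\<alpha> - \<omega>) ^ n" for n
  proof -
    have "exp (\<alpha> * real n) * norm (T (real n)) \<le> exp (\<alpha> * real n) * (K * exp (- \<omega> * real n))"
      by (intro mult_left_mono K) auto
    also have "\<dots> = K * exp (\<alpha> - \<omega>) ^ n"
      by (simp add: exp_of_nat_mult[symmetric] exp_add[symmetric] algebra_simps)
    finally show ?thesis by simp
  qed
  then show "\<exists>N. \<forall>n\<ge>N. norm (exp (\<alpha> * real n) * norm (T (real n))) \<le> K * exp (\<alpha> - \<omega>) ^ n" by blast
  show "summable (\<lambda>n. K * exp (\<alpha> - \<omega>) ^ n)"
    using less by (intro summable_mult summable_geometric) auto
qed

text \<open>A family with summable norms is \<open>\<gamma>\<close>-bounded by the sum of the norms, since the terms that share an operator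
can be collected. Here this is applied to \<open>W\<^sub>n = e\<^bsup>\<omega>'n\<^esup> T\<^sub>n\<close>, after the fractional part of the time has been
absorbed into the vectors.\<close>

lemma gamma_bound_from_growth:
  assumes K: "\<And>t. 0 \<le> t \<Longrightarrow> norm (T t) \<le> K * exp (- \<omega> * t)" and less: "\<omega>' < \<omega>"
  shows "\<exists>D. has_gamma_bound D {exp (\<omega>' * t) *\<^sub>R T t | t. t \<ge> 0}"
proof -
  define b where "b = (\<lambda>n. exp (\<omega>' * real n) * norm (T (real n)))"
  have b0: "0 \<le> b n" for n by (simp add: b_def)
  have summ: "summable b"
    unfolding b_def by (rule summable_from_growth[OF K less])
  define D where "D = suminf b * (exp \<bar>\<omega>'\<bar> * C)"
  have "has_gamma_bound D {exp (\<omega>' * t) *\<^sub>R T t | t. t \<ge> 0}"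
    unfolding has_gamma_bound_def
  proof (intro conjI allI impI)
    show "0 \<le> D" using suminf_nonneg[OF summ b0] C_nonneg by (simp add: D_def)
    fix N :: nat and U :: "nat \<Rightarrow> 'a \<Rightarrow>\<^sub>L 'a" and x :: "nat \<Rightarrow> 'a"
    assume "\<forall>i<N. U i \<in> {exp (\<omega>' * t) *\<^sub>R T t | t. t \<ge> 0}"
    then obtain t where t: "\<And>i. i < N \<Longrightarrow> U i = exp (\<omega>' * t i) *\<^sub>R T (t i) \<and> 0 \<le> t i"
      by simp metis
    define k where "k = (\<lambda>i. nat \<lfloor>t i\<rfloor>)"
    define s where "s = (\<lambda>i. t i - real (k i))"
    have k: "0 \<le> s i" "s i \<le> 1" "t i = real (k i) + s i" if "i < N" for i
    proof -
      have "real (k i) = of_int \<lfloor>t i\<rfloor>" using t[OF that] by (simp add: k_def)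
      then show "0 \<le> s i" "s i \<le> 1" "t i = real (k i) + s i" unfolding s_def by linarith+
    qed
    define W where "W = (\<lambda>n. exp (\<omega>' * real n) *\<^sub>R T (real n))"
    have W: "W n \<in> complex_ops" "norm (W n) = b n" for n
      by (simp_all add: W_def b_def complex_ops_def blinfun.scaleR_left T_scaleC scaleC_scaleR)
    define y where "y = (\<lambda>i. orbit (of_real \<omega>') (x i) (s i))"
    have gy: "gn {..<N} y \<le> exp \<bar>\<omega>'\<bar> * C * gn {..<N} x"
      unfolding y_def orbit_weighted
    proof (rule has_gamma_boundD[OF gamma_weighted])
      fix i assume "i \<in> {..<N}"
      then show "exp (of_real \<omega>' * of_real (s i)) *\<^sub>C T (s i) \<in> weighted \<omega>'"
        using weighted_mem[of "of_real \<omega>'" \<omega>' "s i" 1] k by simp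
    qed simp
    define F where "F = k ` {..<N}"
    have F: "finite F" by (simp add: F_def)
    have "gn {..<N} (\<lambda>i. (U i) (x i)) =
        gn {..<N} (\<lambda>i. \<Sum>n\<in>F. (W n) ((if k i = n then 1 else 0) *\<^sub>C y i))"
    proof (rule gn_cong)
      fix i assume i: "i \<in> {..<N}"
      have "(U i) (x i) = (W (k i)) (y i)"
        using t[of i] k[of i] i T_add_apply[of "real (k i)" "s i" "x i"]
        by (simp add: W_def y_def orbit_def blinfun.scaleR_left blinfun.scaleR_right scaleC_of_real
            distrib_left exp_add exp_of_real flip: of_real_mult)
      also have "\<dots> = (\<Sum>n\<in>F. if n = k i then (W n) (y i) else 0)"
        using i F by (simp add: F_def)
      also have "\<dots> = (\<Sum>n\<in>F. (W n) ((if k i = n then 1 else 0) *\<^sub>C y i))"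
        by (intro sum.cong) auto
      finally show "(U i) (x i) = \<dots>" .
    qed
    also have "\<dots> \<le> (\<Sum>n\<in>F. gn {..<N} (\<lambda>i. (W n) ((if k i = n then 1 else 0) *\<^sub>C y i)))"
      by (rule gn_sum) (use F in auto)
    also have "\<dots> \<le> (\<Sum>n\<in>F. b n * gn {..<N} y)"
    proof (rule sum_mono)
      fix n
      have "gn {..<N} (\<lambda>i. (W n) ((if k i = n then 1 else 0) *\<^sub>C y i)) \<le>
          norm (W n) * gn {..<N} (\<lambda>i. (if k i = n then 1 else 0) *\<^sub>C y i)"
        by (rule gn_operator) (use W in auto)
      also have "\<dots> \<le> b n * (1 * gn {..<N} y)"
        unfolding W(2) by (intro mult_left_mono gn_contract) (auto simp: b0)
      finally show "gn {..<N} (\<lambda>i. (W n) ((if k i = n then 1 else 0) *\<^sub>C y i)) \<le> b n * gn {..<N} y"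
        by simp
    qed
    also have "\<dots> \<le> suminf b * gn {..<N} y"
      unfolding sum_distrib_right[symmetric]
      by (intro mult_right_mono sum_le_suminf summ F) (auto simp: b0)
    also have "\<dots> \<le> suminf b * (exp \<bar>\<omega>'\<bar> * C * gn {..<N} x)"
      by (intro mult_left_mono gy suminf_nonneg summ b0)
    finally show "gn {..<N} (\<lambda>i. (U i) (x i)) \<le> D * gn {..<N} x"
      by (simp add: D_def mult.assoc)
  qed
  then show ?thesis by blast
qed

text \<open>The resolvent is \<open>- P\<^sub>z S\<^sub>z\<close> with the Neumann series \<open>S\<^sub>z = \<Sum>\<^sub>n e\<^bsup>zn\<^esup> T\<^sub>n\<close>, which inverts \<open>I - e\<^sup>z T\<^sub>1\<close>.\<close>

lemma resolvent_from_growth: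
  assumes K: "\<And>t. 0 \<le> t \<Longrightarrow> norm (T t) \<le> K * exp (- \<omega> * t)" and less: "\<alpha> < \<omega>"
  shows "spectrum A \<subseteq> {z. Re z > \<alpha>} \<and> (\<exists>D. has_gamma_bound D {resolvent z A | z. Re z \<le> \<alpha>})"
proof -
  define b where "b = (\<lambda>n. exp (\<alpha> * real n) * norm (T (real n)))"
  have b0: "0 \<le> b n" for n by (simp add: b_def)
  have summ: "summable b"
    unfolding b_def by (rule summable_from_growth[OF K less])
  define W where "W = (\<lambda>z n. exp (z * of_nat n) *\<^sub>C T (real n))"
  have cexp: "cmod (exp (z * of_nat n)) \<le> exp (\<alpha> * real n)" if "Re z \<le> \<alpha>" for z n
    using that by (simp add: mult_right_mono)
  have normW: "norm (W z n) \<le> b n" if "Re z \<le> \<alpha>" for z n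
    using mult_right_mono[OF cexp[OF that, of n], of "norm (T (real n))"] by (simp add: W_def norm_scaleC b_def)
  have sW: "summable (W z)" if "Re z \<le> \<alpha>" for z
    by (rule summable_comparison_test'[OF summ, of 0]) (use normW that in auto)
  define S where "S = (\<lambda>z. suminf (W z))"
  have lim: "(\<lambda>M. \<Sum>n<M. W z n) \<longlonglongrightarrow> S z" if "Re z \<le> \<alpha>" for z
    unfolding S_def using summable_LIMSEQ[OF sW[OF that]] .
  have sums: "(\<lambda>n. (W z n) x) sums (S z) x" if "Re z \<le> \<alpha>" for z x
    unfolding sums_def blinfun.sum_left[symmetric] by (intro tendsto_intros lim that)
  have W0: "W z 0 = id_blinfun" for z by (simp add: W_def T_zero)
  have W1: "(W z 1) x = orbit z x 1" for z x
    by (simp add: W_def orbit_def blinfun_apply_scaleC)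
  have Wc: "W z n \<in> complex_ops" for z n
    by (simp add: W_def complex_ops_def blinfun_apply_scaleC T_scaleC scaleC_scaleC mult.commute)
  have WSuc: "(W z (Suc n)) x = (W z 1) ((W z n) x)"
    "(W z (Suc n)) x = (W z n) ((W z 1) x)" for z n x
    using T_add_apply[of 1 "real n" x] T_add_apply[of "real n" 1 x]
    by (simp_all add: W_def blinfun_apply_scaleC T_scaleC scaleC_scaleC exp_add[symmetric] algebra_simps)
  have shift: "(\<lambda>n. (W z (Suc n)) x) sums ((S z) x - x)" if "Re z \<le> \<alpha>" for z x
    using sums[OF that, of x] sums_Suc_iff[of "\<lambda>n. (W z n) x" "(S z) x - x"] by (simp add: W0)
  have WS: "(W z 1) ((S z) x) = (S z) x - x" if "Re z \<le> \<alpha>" for z x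
    using bounded_linear.sums[OF blinfun.bounded_linear_right[of "W z 1"] sums[OF that, of x]] shift[OF that, of x]
    unfolding WSuc(1)[symmetric] by (rule sums_unique2)
  have SW: "(S z) ((W z 1) x) = (S z) x - x" if "Re z \<le> \<alpha>" for z x
    using sums[OF that, of "(W z 1) x"] shift[OF that, of x]
    unfolding WSuc(2)[symmetric] by (rule sums_unique2)
  have PW: "(local_transform z) ((W z n) x) = (W z n) ((local_transform z) x)" for z n x
    using local_transform_complex_ops[of z] T_local_transform(2)[of "real n" z x]
    by (simp add: W_def blinfun_apply_scaleC complex_ops_def)
  have PS: "(local_transform z) ((S z) x) = (S z) ((local_transform z) x)"
    if "Re z \<le> \<alpha>" for z x
    using bounded_linear.sums[OF blinfun.bounded_linear_right[of "local_transform z"] sums[OF that, of x]]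
      sums[OF that, of "(local_transform z) x"]
    unfolding PW by (rule sums_unique2)
  have Sc: "S z \<in> complex_ops" if "Re z \<le> \<alpha>" for z
  proof -
    have "(S z) (c *\<^sub>C x) = c *\<^sub>C (S z) x" for c x
    proof (rule sums_unique2)
      show "(\<lambda>n. (W z n) (c *\<^sub>C x)) sums (S z) (c *\<^sub>C x)" by (rule sums[OF that])
      show "(\<lambda>n. (W z n) (c *\<^sub>C x)) sums (c *\<^sub>C (S z) x)"
        using bounded_linear.sums[OF bounded_linear_scaleC sums[OF that, of x], of c] Wc by (simp add: complex_ops_def)
    qed
    then show ?thesis by (simp add: complex_ops_def)
  qed
  define R where "R = (\<lambda>z. (- 1) *\<^sub>C (local_transform z o\<^sub>L S z))"
  have R: "(R z) x = - (local_transform z) ((S z) x)" for z x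
    by (simp add: R_def blinfun_apply_scaleC scaleC.minus_left blinfun.minus_left)
  have A_minus: "A (- p) = Some (- q)" if "A p = Some q" for p q
  proof -
    have gen: "A p = Some y \<longleftrightarrow> ((\<lambda>t. ((T t) p - p) /\<^sub>R t) \<longlongrightarrow> - y) (at_right 0)" for p y
      using generates unfolding neg_generates_def by blast
    have "((\<lambda>t. - (((T t) p - p) /\<^sub>R t)) \<longlongrightarrow> - (- q)) (at_right 0)"
      using that unfolding gen by (rule tendsto_minus)
    moreover have "- (((T t) p - p) /\<^sub>R t) = ((T t) (- p) - (- p)) /\<^sub>R t" for t
      by (simp add: blinfun.minus_right flip: scaleR_minus_right)
    ultimately show ?thesis unfolding gen by simp
  qed
  have res: "is_resolvent A z (R z)" if z: "Re z \<le> \<alpha>" for z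
    unfolding is_resolvent_def
  proof (intro conjI allI impI)
    show "R z \<in> complex_ops"
      using local_transform_complex_ops[of z] Sc[OF z] by (simp add: complex_ops_def R scaleC.minus_right)
    fix x
    let ?v = "(S z) x"
    let ?p = "(local_transform z) ?v"
    have "A ?p = Some (z *\<^sub>C ?p + x)"
      using local_transform_in_domain[of z ?v] WS[OF z, of x, unfolded W1] by simp
    from A_minus[OF this] show "\<exists>y. A ((R z) x) = Some y \<and> z *\<^sub>C (R z) x - y = x"
      by (intro exI[of _ "- (z *\<^sub>C ?p + x)"]) (simp add: R scaleC.minus_right)
  next
    fix x y assume "A x = Some y"
    then have e: "(local_transform z) (z *\<^sub>C x - y) = orbit z x 1 - x"
      by (rule local_transform_on_domain)
    show "(R z) (z *\<^sub>C x - y) = x"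
      unfolding R PS[OF z] e using SW[OF z, of x, unfolded W1] by (simp add: blinfun.diff_right)
  qed
  have spec: "spectrum A \<subseteq> {z. Re z > \<alpha>}"
    using res unfolding spectrum_def resolvent_set_def by (auto simp: not_le[symmetric])
  have gS: "has_gamma_bound (suminf b) {S z | z. Re z \<le> \<alpha>}"
  proof (rule gamma_bound_limit)
    let ?\<T> = "\<lambda>M. {\<Sum>n<M. d n *\<^sub>C T (real n) | d. \<forall>n. cmod (d n) \<le> exp (\<alpha> * real n)}"
    show "has_gamma_bound (suminf b) (?\<T> M)" for M
    proof (rule has_gamma_bound_mono)
      show "has_gamma_bound (\<Sum>n<M. exp (\<alpha> * real n) * norm (T (real n))) (?\<T> M)"
        by (rule gamma_bound_sum_of_multiples) (auto intro: T_complex_ops)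
      show "(\<Sum>n<M. exp (\<alpha> * real n) * norm (T (real n))) \<le> suminf b"
        using sum_le_suminf[OF summ, of "{..<M}"] b0 by (simp add: b_def)
    qed
    fix U assume "U \<in> {S z | z. Re z \<le> \<alpha>}"
    then obtain z where z: "U = S z" "Re z \<le> \<alpha>" by blast
    have "(\<Sum>n<M. W z n) \<in> ?\<T> M" for M
      unfolding W_def
      by (intro CollectI exI[of _ "\<lambda>n. exp (z * of_nat n)"] conjI refl allI cexp z(2))
    moreover have "(\<lambda>M. (\<Sum>n<M. W z n) v) \<longlonglongrightarrow> U v" for v
      unfolding z(1) by (intro tendsto_intros lim z(2))
    ultimately show "\<exists>f. (\<forall>M. f M \<in> ?\<T> M) \<and> (\<forall>v. (\<lambda>M. (f M) v) \<longlonglongrightarrow> U v)"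
      by (intro exI[of _ "\<lambda>M. \<Sum>n<M. W z n"]) blast
  qed
  have "has_gamma_bound (1 * (exp \<bar>\<alpha>\<bar> * C * suminf b)) {resolvent z A | z. Re z \<le> \<alpha>}"
  proof (rule gamma_bound_subset[OF gamma_bound_scale[OF gamma_bound_compose[OF local_transform_gamma_bound[of \<alpha>] gS], of 1]])
    show "{resolvent z A | z. Re z \<le> \<alpha>} \<subseteq> {c *\<^sub>C U | c U. cmod c \<le> 1 \<and>
        U \<in> {P o\<^sub>L Q | P Q. P \<in> {local_transform z | z. Re z \<le> \<alpha>} \<and> Q \<in> {S z | z. Re z \<le> \<alpha>}}}"
    proof
      fix U assume "U \<in> {resolvent z A | z. Re z \<le> \<alpha>}"
      then obtain z where z: "U = resolvent z A" "Re z \<le> \<alpha>" by blast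
      then have "U = (- 1) *\<^sub>C (local_transform z o\<^sub>L S z)"
        using resolvent_eqI[OF res] by (simp add: R_def)
      moreover have "cmod (- 1) \<le> 1" by simp
      ultimately show "U \<in> {c *\<^sub>C U | c U. cmod c \<le> 1 \<and>
        U \<in> {P o\<^sub>L Q | P Q. P \<in> {local_transform z | z. Re z \<le> \<alpha>} \<and> Q \<in> {S z | z. Re z \<le> \<alpha>}}}"
        using z(2) by blast
    qed
  qed simp
  with spec show ?thesis by blast
qed

end

theorem corollary5p3:
  fixes M :: "'w measure"
    and \<gamma> :: "nat \<Rightarrow> 'w \<Rightarrow> complex"
    and A :: "'a :: complex_banach \<rightharpoonup> 'a"
    and T :: "real \<Rightarrow> 'a \<Rightarrow>\<^sub>L 'a"
  assumes "complex_gaussian_sequence M \<gamma>"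
    and "K_convex M \<gamma> TYPE('a)"
    and "neg_generates A T"
    and "omega_gamma M \<gamma> T > - \<infinity>"
  shows "omega_gamma M \<gamma> T = omega T \<and> omega T = s0_gamma M \<gamma> A"
proof -
  note gb = gamma_bounded_iff[OF assms(1)]
  have "{\<omega>. gamma_bounded M \<gamma> {exp (\<omega> * t) *\<^sub>R T t | t. t \<ge> 0}} \<noteq> {}"
  proof
    assume "{\<omega>. gamma_bounded M \<gamma> {exp (\<omega> * t) *\<^sub>R T t | t. t \<ge> 0}} = {}"
    then have "omega_gamma M \<gamma> T = - \<infinity>" by (simp add: omega_gamma_def bot_ereal_def)
    then show False using assms(4) by simp
  qed
  then obtain \<omega>0 C0 where C0: "has_gamma_bound C0 {exp (\<omega>0 * t) *\<^sub>R T t | t. t \<ge> 0}"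
    unfolding gb by blast
  have "has_gamma_bound (exp \<bar>\<omega>0\<bar> * C0) {T t | t. 0 \<le> t \<and> t \<le> 1}"
  proof (rule gamma_bound_subset[OF gamma_bound_scale[OF C0]])
    show "{T t | t. 0 \<le> t \<and> t \<le> 1} \<subseteq>
        {c *\<^sub>C S | c S. cmod c \<le> exp \<bar>\<omega>0\<bar> \<and> S \<in> {exp (\<omega>0 * t) *\<^sub>R T t | t. t \<ge> 0}}"
    proof clarify
      fix t :: real assume t: "0 \<le> t" "t \<le> 1"
      have "- (\<omega>0 * t) \<le> \<bar>\<omega>0\<bar> * t" using t mult_right_mono[of "- \<omega>0" "\<bar>\<omega>0\<bar>" t] by simp
      also have "\<dots> \<le> \<bar>\<omega>0\<bar> * 1" using t by (intro mult_left_mono) auto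
      finally have "cmod (of_real (exp (- (\<omega>0 * t)))) \<le> exp \<bar>\<omega>0\<bar>" by simp
      moreover have "T t = of_real (exp (- (\<omega>0 * t))) *\<^sub>C exp (\<omega>0 * t) *\<^sub>R T t"
        by (simp add: scaleC_of_real exp_add[symmetric])
      ultimately show "\<exists>c S. T t = c *\<^sub>C S \<and> cmod c \<le> exp \<bar>\<omega>0\<bar> \<and> S \<in> {exp (\<omega>0 * t) *\<^sub>R T t | t. t \<ge> 0}"
        using t by blast
    qed
  qed simp
  then interpret gamma_bounded_semigroup A T "exp \<bar>\<omega>0\<bar> * C0"
    by unfold_locales (use assms(3) in auto)
  have 1: "omega_gamma M \<gamma> T \<le> omega T"
    unfolding omega_gamma_def omega_def gb
  proof (rule SUP_subset_mono, safe)
    fix \<omega> C assume C: "has_gamma_bound C {exp (\<omega> * t) *\<^sub>R T t | t. t \<ge> 0}"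
    have "norm (T t) \<le> (C + 1) * exp (- \<omega> * t)" if "0 \<le> t" for t
    proof -
      have "norm (exp (\<omega> * t) *\<^sub>R T t) \<le> C"
        by (rule gamma_bound_norm[OF C]) (use that in blast)
      then have "exp (\<omega> * t) * norm (T t) \<le> C + 1" by simp
      then show ?thesis by (rule exp_weight_cancel)
    qed
    moreover have "0 < C + 1" using C by (simp add: has_gamma_bound_def)
    ultimately show "\<exists>K>0. \<forall>t\<ge>0. norm (T t) \<le> K * exp (- \<omega> * t)" by blast
  qed
  have 2: "omega T \<le> omega_gamma M \<gamma> T"
    unfolding omega_def
  proof (rule SUP_least, safe)
    fix \<omega> K assume K: "0 < K" "\<forall>t\<ge>0. norm (T t) \<le> K * exp (- \<omega> * t)"
    show "ereal \<omega> \<le> omega_gamma M \<gamma> T"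
    proof (rule ereal_le_epsilon2)
      fix e :: real assume "0 < e"
      then have "\<exists>D. has_gamma_bound D {exp ((\<omega> - e) * t) *\<^sub>R T t | t. t \<ge> 0}"
        using K by (intro gamma_bound_from_growth[of K \<omega>]) auto
      then have "ereal (\<omega> - e) \<le> omega_gamma M \<gamma> T"
        unfolding omega_gamma_def gb by (intro SUP_upper) blast
      then show "ereal \<omega> \<le> omega_gamma M \<gamma> T + ereal e"
        using add_right_mono[of "ereal (\<omega> - e)" "omega_gamma M \<gamma> T" "ereal e"] by simp
    qed
  qed
  have 3: "omega T \<le> s0_gamma M \<gamma> A"
    unfolding omega_def
  proof (rule SUP_least, safe)
    fix \<omega> K assume K: "0 < K" "\<forall>t\<ge>0. norm (T t) \<le> K * exp (- \<omega> * t)"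
    show "ereal \<omega> \<le> s0_gamma M \<gamma> A"
    proof (rule ereal_le_epsilon2)
      fix e :: real assume "0 < e"
      then have "spectrum A \<subseteq> {z. Re z > \<omega> - e} \<and> (\<exists>D. has_gamma_bound D {resolvent z A | z. Re z \<le> \<omega> - e})"
        using K by (intro resolvent_from_growth[of K \<omega>]) auto
      then have "ereal (\<omega> - e) \<le> s0_gamma M \<gamma> A"
        unfolding s0_gamma_def gb by (intro SUP_upper) blast
      then show "ereal \<omega> \<le> s0_gamma M \<gamma> A + ereal e"
        using add_right_mono[of "ereal (\<omega> - e)" "s0_gamma M \<gamma> A" "ereal e"] by simp
    qed
  qed
  have 4: "s0_gamma M \<gamma> A \<le> omega T"
    unfolding s0_gamma_def omega_def gb
  proof (rule SUP_subset_mono, rule subsetI)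
    fix \<alpha> assume "\<alpha> \<in> {\<alpha>. spectrum A \<subseteq> {z. Re z > \<alpha>} \<and> (\<exists>C. has_gamma_bound C {resolvent z A | z. Re z \<le> \<alpha>})}"
    then show "\<alpha> \<in> {\<omega>. \<exists>K>0. \<forall>t\<ge>0. norm (T t) \<le> K * exp (- \<omega> * t)}"
      using growth_from_resolvent by blast
  qed simp
  from 1 2 3 4 show ?thesis by (auto intro: antisym)
qed

end
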